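(* Let $n,m\ge 0$ be integers and $\nu,\mu,\lambda$ partitions with $\ell(\nu)\le n$, $\ell(\mu)\le m$ and $\lambda_{n+1}<m+1$. With the notation of the context, \[ \chi_{\mu,\nu,\lambda}^{n,m}(q)=(-1)^{r(m+n)}q^{\Delta^{m,n}_{\mu,\nu,\lambda}}\sum_{A_1>A_2>\ldots>A_r\geq 0}(-1)^{\sum_{i=1}^r A_i}q^{\sum_{i=1}^r \binom{A_i+1}2}\frac{a_{N}(q^A,q^{-P-1})\,a_{M}(q^{-A},q^{-Q})}{(q)_\infty^{m+n}}, \] where the sum runs over $r$-tuples of integers, $\Delta^{m,n}_{\mu,\nu,\lambda}=\sum_{j=1}^{m-r}M_jQ_j+\sum_{i=1}^{n-r}N_i(P_i+1)$, \[a_N(q^A,q^{-P-1})=\det\bigl(x_k^{N_l}\bigr)_{k,l=1}^n,\quad (x_1,\dots,x_n)=(q^{A_1},\dots,q^{A_r},q^{-P_1-1},\dots,q^{-P_{n-r}-1}),\] \[a_M(q^{-A},q^{-Q})=\det\bigl(y_k^{M_l}\bigr)_{k,l=1}^m,\quad (y_1,\dots,y_m)=(q^{-A_1},\dots,q^{-A_r},q^{-Q_1},\dots,q^{-Q_{m-r}}).\]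
   Context: Partitions are weakly decreasing sequences of nonnegative integers with finitely many nonzero parts; $\lambda_k=0$ for $k>\ell(\lambda)$, $\lambda'$ is the transposed partition, and $(i,j)\in\lambda$ means $1\le j\le\lambda_i$. Let $\mathcal{A}$ be the set of arrays $a=(a_{i,j})_{i,j\ge1}$ with entries in $\mathbb{Z}_{\ge0}\cup\{\infty\}$ such that $a_{i,j}\ge a_{i+1,j}$ and $a_{i,j}\ge a_{i,j+1}$ for all $i,j$; $a_{n+1,m+1}=0$; for each $i$, $a_{i,j}=\nu_i$ for all sufficiently large $j$; for each $j$, $a_{i,j}=\mu_j$ for all sufficiently large $i$; and $a_{i,j}=\infty$ if and only if $(i,j)\in\lambda$. The weight of $a$ is \[|a|=\sum_{i-n\le j-m,\ (i,j)\notin\lambda}(a_{i,j}-\nu_i)+\sum_{i-n>j-m,\ (i,j)\notin\lambda}(a_{i,j}-\mu_j),\] and $\chi^{n,m}_{\mu,\nu,\lambda}(q)=\sum_{a\in\mathcal{A}}q^{|a|}$ (formal power series in $q$). Let $(q)_\infty=\prod_{k\ge1}(1-q^k)$. Let $r=\min\{t\ge 0\mid \lambda_{n-t}\ge m-t\}$ with the convention $\lambda_0=+\infty$, so $0\le r\le\min(n,m)$. Define $\pi_i=\lambda_i-(m-r)$ for $1\le i\le n-r$ and $\kappa_j=\lambda'_j-(n-r)$ for $1\le j\le m-r$, and set $N_i=\nu_i+n-i$ ($1\le i\le n$), $M_j=\mu_j+m-j$ ($1\le j\le m$), $P_i=\pi_i+(n-r)-i$ ($1\le i\le n-r$), $Q_j=\kappa_j+(m-r)-j$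 ($1\le j\le m-r$). *)

theory Defs
  imports
    "HOL-Library.Extended_Nat"
    "HOL-Computational_Algebra.Formal_Laurent_Series"
    "HOL-Analysis.Infinite_Sum"
    "HOL-Analysis.Infinite_Products"
    "Jordan_Normal_Form.Determinant"
begin

text \<open>
  Partitions, arrays and the tuples built from them are indexed from 1. The value of a partition at
  index 0 is unconstrained and never used.
\<close>

definition is_partition :: "(nat \<Rightarrow> nat) \<Rightarrow> bool" where
  "is_partition lam \<longleftrightarrow> (\<forall>i\<ge>1. lam (Suc i) \<le> lam i) \<and> finite {i. i \<ge> 1 \<and> lam i \<noteq> 0}"

definition part_length :: "(nat \<Rightarrow> nat) \<Rightarrow> nat" where
  "part_length lam = card {i. i \<ge> 1 \<and> lam i \<noteq> 0}"

definition conj_part :: "(nat \<Rightarrow> nat) \<Rightarrow> nat \<Rightarrow> nat" where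
  "conj_part lam j = card {i. i \<ge> 1 \<and> j \<le> lam i}"

definition diagram :: "(nat \<Rightarrow> nat) \<Rightarrow> (nat \<times> nat) set" where
  "diagram lam = {(i, j). 1 \<le> i \<and> 1 \<le> j \<and> j \<le> lam i}"

text \<open>
  An array is a function on all of \<open>nat \<times> nat\<close>; the first condition fixes its values outside the
  range \<open>i, j \<ge> 1\<close>, so that each array is represented by exactly one function.
\<close>

definition pit_arrays ::
    "nat \<Rightarrow> nat \<Rightarrow> (nat \<Rightarrow> nat) \<Rightarrow> (nat \<Rightarrow> nat) \<Rightarrow> (nat \<Rightarrow> nat) \<Rightarrow> (nat \<Rightarrow> nat \<Rightarrow> enat) set" where
  "pit_arrays n m mu nu lam = {a.
     (\<forall>i j. i = 0 \<or> j = 0 \<longrightarrow> a i j = 0) \<and>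
     (\<forall>i\<ge>1. \<forall>j\<ge>1. a (i + 1) j \<le> a i j \<and> a i (j + 1) \<le> a i j) \<and>
     a (n + 1) (m + 1) = 0 \<and>
     (\<forall>i\<ge>1. \<forall>\<^sub>F j in sequentially. a i j = enat (nu i)) \<and>
     (\<forall>j\<ge>1. \<forall>\<^sub>F i in sequentially. a i j = enat (mu j)) \<and>
     (\<forall>i\<ge>1. \<forall>j\<ge>1. a i j = \<infinity> \<longleftrightarrow> (i, j) \<in> diagram lam)}"

text \<open>
  The sums range over infinite sets of positions, but for an array with a pit only finitely many
  summands are nonzero. All entries outside the diagram are finite, so \<open>the_enat\<close> loses nothing.
\<close>

definition pit_weight ::
    "nat \<Rightarrow> nat \<Rightarrow> (nat \<Rightarrow> nat) \<Rightarrow> (nat \<Rightarrow> nat) \<Rightarrow> (nat \<Rightarrow> nat) \<Rightarrow> (nat \<Rightarrow> nat \<Rightarrow> enat) \<Rightarrow> int" where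
  "pit_weight n m mu nu lam a =
     (\<Sum>\<^sub>\<infinity>(i, j)\<in>{(i, j). 1 \<le> i \<and> 1 \<le> j \<and> int i - int n \<le> int j - int m \<and> (i, j) \<notin> diagram lam}.
        int (the_enat (a i j)) - int (nu i)) +
     (\<Sum>\<^sub>\<infinity>(i, j)\<in>{(i, j). 1 \<le> i \<and> 1 \<le> j \<and> int i - int n > int j - int m \<and> (i, j) \<notin> diagram lam}.
        int (the_enat (a i j)) - int (mu j))"

text \<open>
  For \<open>part_length nu \<le> n\<close>, \<open>part_length mu \<le> m\<close> and \<open>lam (n + 1) < m + 1\<close>, weights are nonnegative
  and each weight is attained by only finitely many arrays.
\<close>

definition chi ::
    "nat \<Rightarrow> nat \<Rightarrow> (nat \<Rightarrow> nat) \<Rightarrow> (nat \<Rightarrow> nat) \<Rightarrow> (nat \<Rightarrow> nat) \<Rightarrow> rat fps" where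
  "chi n m mu nu lam =
     Abs_fps (\<lambda>k. of_nat (card {a \<in> pit_arrays n m mu nu lam. pit_weight n m mu nu lam a = int k}))"

definition q_infty :: "rat fps" where
  "q_infty = (\<Prod>k. 1 - fps_X ^ Suc k)"

text \<open>The disjunct \<open>t = n\<close> encodes the convention that the zeroth part of \<open>lam\<close> is infinite.\<close>

definition pit_rank :: "nat \<Rightarrow> nat \<Rightarrow> (nat \<Rightarrow> nat) \<Rightarrow> nat" where
  "pit_rank n m lam =
     (LEAST t. t \<le> n \<and> (t = n \<or> int (lam (n - t)) \<ge> int m - int t))"

lemma pit_rank_le: "pit_rank n m lam \<le> min n m"
proof -
  let ?P = "\<lambda>t. t \<le> n \<and> (t = n \<or> int (lam (n - t)) \<ge> int m - int t)"
  have "?P (min n m)" by auto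
  then show ?thesis unfolding pit_rank_def by (rule Least_le)
qed

definition pit_pi :: "nat \<Rightarrow> nat \<Rightarrow> (nat \<Rightarrow> nat) \<Rightarrow> nat \<Rightarrow> int" where
  "pit_pi n m lam i = int (lam i) - (int m - int (pit_rank n m lam))"

definition pit_kappa :: "nat \<Rightarrow> nat \<Rightarrow> (nat \<Rightarrow> nat) \<Rightarrow> nat \<Rightarrow> int" where
  "pit_kappa n m lam j = int (conj_part lam j) - (int n - int (pit_rank n m lam))"

definition pit_N :: "nat \<Rightarrow> (nat \<Rightarrow> nat) \<Rightarrow> nat \<Rightarrow> int" where
  "pit_N n nu i = int (nu i) + int n - int i"

definition pit_M :: "nat \<Rightarrow> (nat \<Rightarrow> nat) \<Rightarrow> nat \<Rightarrow> int" where
  "pit_M m mu j = int (mu j) + int m - int j"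

definition pit_P :: "nat \<Rightarrow> nat \<Rightarrow> (nat \<Rightarrow> nat) \<Rightarrow> nat \<Rightarrow> int" where
  "pit_P n m lam i = pit_pi n m lam i + (int n - int (pit_rank n m lam)) - int i"

definition pit_Q :: "nat \<Rightarrow> nat \<Rightarrow> (nat \<Rightarrow> nat) \<Rightarrow> nat \<Rightarrow> int" where
  "pit_Q n m lam j = pit_kappa n m lam j + (int m - int (pit_rank n m lam)) - int j"

definition pit_Delta ::
    "nat \<Rightarrow> nat \<Rightarrow> (nat \<Rightarrow> nat) \<Rightarrow> (nat \<Rightarrow> nat) \<Rightarrow> (nat \<Rightarrow> nat) \<Rightarrow> int" where
  "pit_Delta n m mu nu lam =
     (\<Sum>j = 1..m - pit_rank n m lam. pit_M m mu j * pit_Q n m lam j) +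
     (\<Sum>i = 1..n - pit_rank n m lam. pit_N n nu i * (pit_P n m lam i + 1))"

text \<open>
  The determinant of the \<open>d \<times> d\<close> matrix with \<open>(k, l)\<close> entry \<open>x\<^sub>k\<close> to the power \<open>E\<^sub>l\<close>. Both \<open>mat\<close> and
  list positions count from 0, whereas exponents are indexed from 1.
\<close>

definition alternant :: "nat \<Rightarrow> (nat \<Rightarrow> int) \<Rightarrow> 'a::field list \<Rightarrow> 'a" where
  "alternant d E xs = Determinant.det (mat d d (\<lambda>(k, l). (xs ! k) powi E (Suc l)))"

text \<open>The formal variable \<open>q\<close> is \<open>fls_X\<close>, viewed in the field of Laurent series over the rationals.\<close>

definition a_N :: "nat \<Rightarrow> nat \<Rightarrow> (nat \<Rightarrow> nat) \<Rightarrow> (nat \<Rightarrow> nat) \<Rightarrow> nat list \<Rightarrow> rat fls" where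
  "a_N n m nu lam A =
     alternant n (pit_N n nu)
       (map (\<lambda>a. fls_X powi int a) A @
        map (\<lambda>i. fls_X powi (- pit_P n m lam i - 1)) [1..<Suc (n - pit_rank n m lam)])"

definition a_M :: "nat \<Rightarrow> nat \<Rightarrow> (nat \<Rightarrow> nat) \<Rightarrow> (nat \<Rightarrow> nat) \<Rightarrow> nat list \<Rightarrow> rat fls" where
  "a_M n m mu lam A =
     alternant m (pit_M m mu)
       (map (\<lambda>a. fls_X powi (- int a)) A @
        map (\<lambda>j. fls_X powi (- pit_Q n m lam j)) [1..<Suc (m - pit_rank n m lam)])"

definition decreasing_tuples :: "nat \<Rightarrow> nat list set" where
  "decreasing_tuples r = {A. length A = r \<and> sorted_wrt (>) A}"

definition pit_term ::
    "nat \<Rightarrow> nat \<Rightarrow> (nat \<Rightarrow> nat) \<Rightarrow> (nat \<Rightarrow> nat) \<Rightarrow> (nat \<Rightarrow> nat) \<Rightarrow> nat list \<Rightarrow> rat fls" where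
  "pit_term n m mu nu lam A =
     (- 1) ^ sum_list A * fls_X ^ (\<Sum>a\<leftarrow>A. (a + 1) choose 2) *
     (a_N n m nu lam A * a_M n m mu lam A / fps_to_fls q_infty ^ (m + n))"

end

theory Submission
  imports Defs
begin

text \<open>
  Cutting an array along its main diagonal leaves a row arm and a column arm. Along successive diagonals
  an arm is a sequence of interlacing partitions, and the generating function of the arms with a given
  main diagonal \<open>x\<^sub>1 > \<dots> > x\<^sub>r\<close> is a determinant: its rows are \<open>1 / (q)\<^bsub>x-N\<^esub>\<close> for the finite entries and
  powers of \<open>q\<close> over \<open>(q)\<^sub>\<infinity>\<close> for the entries that are still infinite. Hence the generating function of
  all arrays is a sum of products of two determinants over strictly decreasing tuples. By multilinearity
  such a sum depends only on the scalar sums that pair a row of the first determinant with a row of the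
  second, and
  \<open>\<Sum>\<^sub>x q\<^bsup>x-N\<^esup> / ((q)\<^bsub>x-N\<^esub> (q)\<^bsub>x-M\<^esub>) = (q)\<^sub>\<infinity>\<^bsup>-2\<^esup> \<Sum>\<^sub>A (-1)\<^bsup>A\<^esup> q\<^bsup>A(A+1)/2 + A(N-M)\<^esup>\<close>
  shows that the alternants of the right-hand side give the same pairings.
\<close>


section \<open>Locally finite sums of Laurent series\<close>

text \<open>The terms involve negative powers of q and the sums are infinite, so every interchange
  of summations needs its own finiteness bound at each order. The two sums over decreasing tuples do
  not agree term by term; only the pairings of their rows do, which is why the comparison passes
  through all r-tuples, where the sum factors, at the price of r!. An arm has no last diagonal, so
  its determinant cannot be found by recursion from the end. It is verified coefficient by
  coefficient; the induction stops at the constant arm, which is reached because every other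
  diagonal without infinite entries uses up weight. The sign arises because the alternants list the
  r variable rows first and the determinants of the arms list them last: r(n-r) + r(m-r) has the
  parity of r(m+n). The exponent \<open>pit_Delta\<close> collects what the infinite entries
  contribute: column l gains q^(-N_l) on every counted diagonal, and the prefactor compensates by
  q^(N_k). The main diagonal is charged to the row arm alone, hence P_i + 1 for rows against Q_j for
  columns.\<close>

definition fls_vanishes :: "int \<Rightarrow> 'a::zero fls \<Rightarrow> bool" where
  "fls_vanishes K f \<longleftrightarrow> (\<forall>k\<le>K. fls_nth f k = 0)"

lemma fls_vanishesD: "fls_vanishes K f \<Longrightarrow> k \<le> K \<Longrightarrow> fls_nth f k = 0"
  by (simp add: fls_vanishes_def)

lemma fls_vanishes_0 [simp]: "fls_vanishes K 0"
  by (simp add: fls_vanishes_def)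

lemma fls_vanishes_add:
  "fls_vanishes K f \<Longrightarrow> fls_vanishes K g \<Longrightarrow> fls_vanishes K (f + g :: 'a::monoid_add fls)"
  by (simp add: fls_vanishes_def)

lemma fls_vanishes_diff:
  "fls_vanishes K f \<Longrightarrow> fls_vanishes K g \<Longrightarrow> fls_vanishes K (f - g :: 'a::group_add fls)"
  by (simp add: fls_vanishes_def)

lemma fls_vanishes_sum:
  fixes f :: "'b \<Rightarrow> 'a::comm_monoid_add fls"
  shows "(\<And>s. s \<in> F \<Longrightarrow> fls_vanishes K (f s)) \<Longrightarrow> fls_vanishes K (sum f F)"
  by (induction F rule: infinite_finite_induct) (auto intro: fls_vanishes_add)

lemma fls_vanishes_iff_subdegree: "fls_vanishes K f \<longleftrightarrow> f = 0 \<or> K < fls_subdegree f"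
proof (cases "f = 0")
  case False
  have "K < fls_subdegree f" if "fls_vanishes K f"
    using that nth_fls_subdegree_nonzero[OF False] fls_vanishesD not_less by blast
  moreover have "fls_vanishes K f" if "K < fls_subdegree f"
    using that by (auto simp: fls_vanishes_def intro!: fls_eq0_below_subdegree)
  ultimately show ?thesis using False by blast
qed simp

lemma fls_vanishes_mult:
  fixes f g :: "'a::{comm_monoid_add,mult_zero} fls"
  assumes "fls_vanishes K f" "L \<le> fls_subdegree g"
  shows "fls_vanishes (K + L) (g * f)"
proof (cases "f = 0")
  case False
  with assms have "K < fls_subdegree f" by (simp add: fls_vanishes_iff_subdegree)
  with assms(2) show ?thesis by (auto simp: fls_vanishes_def intro!: fls_times_nth_eq0)
qed simp

lemma fls_eq_if_vanishes:
  fixes f g :: "'a::group_add fls"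
  assumes "\<And>K. fls_vanishes K (f - g)"
  shows "f = g"
proof (rule fls_eqI)
  fix n
  show "fls_nth f n = fls_nth g n"
    using fls_vanishesD[OF assms[of n], of n] by simp
qed

text \<open>
  A family sums to \<open>t\<close> if, up to each order, all but finitely many members vanish and the remaining
  ones add up to \<open>t\<close>. This is unconditional convergence in the adic topology.
\<close>

definition lf_sum :: "('b \<Rightarrow> 'a::ab_group_add fls) \<Rightarrow> 'b set \<Rightarrow> 'a fls \<Rightarrow> bool" where
  "lf_sum f S t \<longleftrightarrow> (\<forall>K. \<exists>F. finite F \<and> F \<subseteq> S \<and> (\<forall>s\<in>S - F. fls_vanishes K (f s)) \<and>
     fls_vanishes K (t - sum f F))"

definition loc_finite :: "('b \<Rightarrow> 'a::zero fls) \<Rightarrow> 'b set \<Rightarrow> bool" where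
  "loc_finite f S \<longleftrightarrow> (\<forall>K. finite {s\<in>S. \<not> fls_vanishes K (f s)})"

text \<open>Members outside \<open>F\<close> vanish up to order \<open>K\<close>, so enlarging
  \<open>F\<close> does not spoil the approximation. In this form two sums can be compared on the
  union of their finite sets.\<close>

lemma lf_sumE:
  assumes "lf_sum f S t"
  obtains F where "finite F" "F \<subseteq> S" "\<And>s. s \<in> S \<Longrightarrow> s \<notin> F \<Longrightarrow> fls_vanishes K (f s)"
    "\<And>G. finite G \<Longrightarrow> F \<subseteq> G \<Longrightarrow> G \<subseteq> S \<Longrightarrow> fls_vanishes K (t - sum f G)"
proof -
  from assms obtain F where F: "finite F" "F \<subseteq> S" "\<forall>s\<in>S - F. fls_vanishes K (f s)"
     "fls_vanishes K (t - sum f F)"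
    unfolding lf_sum_def by blast
  have "fls_vanishes K (t - sum f G)" if "finite G" "F \<subseteq> G" "G \<subseteq> S" for G
  proof -
    have "sum f G = sum f F + sum f (G - F)"
      using that F(1) by (simp add: sum.subset_diff[of F G f] add.commute)
    moreover have "fls_vanishes K (sum f (G - F))"
      using F(3) that by (intro fls_vanishes_sum) auto
    ultimately show ?thesis
      using fls_vanishes_diff[OF F(4)] by (metis diff_diff_eq)
  qed
  moreover have "\<And>s. s \<in> S \<Longrightarrow> s \<notin> F \<Longrightarrow> fls_vanishes K (f s)" using F(3) by simp
  ultimately show ?thesis using that[OF F(1,2)] by simp
qed

lemma lf_sum_loc_finite: "lf_sum f S t \<Longrightarrow> loc_finite f S"
  unfolding loc_finite_def
proof
  fix K assume "lf_sum f S t"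
  then obtain F where F: "finite F" "\<And>s. s \<in> S \<Longrightarrow> s \<notin> F \<Longrightarrow> fls_vanishes K (f s)"
    by (rule lf_sumE[where K = K]) blast
  show "finite {s\<in>S. \<not> fls_vanishes K (f s)}"
    by (rule finite_subset[OF _ F(1)]) (use F(2) in blast)
qed

lemma lf_sum_unique:
  assumes "lf_sum f S t" "lf_sum f S u"
  shows "t = u"
proof (rule fls_eq_if_vanishes)
  fix K
  obtain F where F: "finite F" "F \<subseteq> S"
    "\<And>G. finite G \<Longrightarrow> F \<subseteq> G \<Longrightarrow> G \<subseteq> S \<Longrightarrow> fls_vanishes K (t - sum f G)"
    using assms(1) by (rule lf_sumE[where K = K]) blast
  obtain F' where F': "finite F'" "F' \<subseteq> S"
    "\<And>G. finite G \<Longrightarrow> F' \<subseteq> G \<Longrightarrow> G \<subseteq> S \<Longrightarrow> fls_vanishes K (u - sum f G)"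
    using assms(2) by (rule lf_sumE[where K = K]) blast
  have "fls_vanishes K ((t - sum f (F \<union> F')) - (u - sum f (F \<union> F')))"
    by (rule fls_vanishes_diff) (use F F' in auto)
  then show "fls_vanishes K (t - u)" by simp
qed

lemma lf_sum_nth:
  assumes "lf_sum f S t"
  shows "finite {s\<in>S. fls_nth (f s) k \<noteq> 0}"
    and "fls_nth t k = (\<Sum>s | s \<in> S \<and> fls_nth (f s) k \<noteq> 0. fls_nth (f s) k)"
proof -
  obtain F where F: "finite F" "F \<subseteq> S" "\<And>s. s \<in> S \<Longrightarrow> s \<notin> F \<Longrightarrow> fls_vanishes k (f s)"
    "\<And>G. finite G \<Longrightarrow> F \<subseteq> G \<Longrightarrow> G \<subseteq> S \<Longrightarrow> fls_vanishes k (t - sum f G)"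
    using assms by (rule lf_sumE[where K = k]) blast
  have sub: "{s\<in>S. fls_nth (f s) k \<noteq> 0} \<subseteq> F"
    using F(3) by (auto simp: fls_vanishes_def)
  then show "finite {s\<in>S. fls_nth (f s) k \<noteq> 0}"
    using F(1) finite_subset by blast
  have "fls_nth t k = (\<Sum>s\<in>F. fls_nth (f s) k)"
    using fls_vanishesD[OF F(4)[of F], of k] F(1,2) by (simp add: fls_nth_sum)
  also have "\<dots> = (\<Sum>s | s \<in> S \<and> fls_nth (f s) k \<noteq> 0. fls_nth (f s) k)"
    by (rule sum.mono_neutral_right) (use F(1,2) sub in auto)
  finally show "fls_nth t k = (\<Sum>s | s \<in> S \<and> fls_nth (f s) k \<noteq> 0. fls_nth (f s) k)" .
qed

lemma lf_sumI_nth: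
  assumes "loc_finite f S"
    and "\<And>k. fls_nth t k = (\<Sum>s | s \<in> S \<and> fls_nth (f s) k \<noteq> 0. fls_nth (f s) k)"
  shows "lf_sum f S t"
  unfolding lf_sum_def
proof
  fix K
  define F where "F = {s\<in>S. \<not> fls_vanishes K (f s)}"
  have fin: "finite F"
    using assms(1) by (simp add: loc_finite_def F_def)
  have "fls_vanishes K (t - sum f F)"
    unfolding fls_vanishes_def
  proof (intro allI impI)
    fix k assume "k \<le> K"
    then have "fls_nth t k = (\<Sum>s\<in>F. fls_nth (f s) k)"
      unfolding assms(2)
      by (intro sum.mono_neutral_left fin) (auto simp: F_def fls_vanishes_def)
    then show "fls_nth (t - sum f F) k = 0" by (simp add: fls_nth_sum)
  qed
  with fin show "\<exists>F. finite F \<and> F \<subseteq> S \<and> (\<forall>s\<in>S - F. fls_vanishes K (f s)) \<and> fls_vanishes K (t - sum f F)"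
    by (intro exI[of _ F]) (auto simp: F_def)
qed

text \<open>Completeness: only finitely many members reach order 0 or below, so the coefficientwise
  sums vanish below some \<open>L\<close> and define a Laurent series.\<close>

lemma loc_finite_imp_lf_sum:
  fixes f :: "'b \<Rightarrow> 'a::ab_group_add fls"
  assumes "loc_finite f S"
  obtains t where "lf_sum f S t"
proof -
  define c where "c k = (\<Sum>s | s \<in> S \<and> fls_nth (f s) k \<noteq> 0. fls_nth (f s) k)" for k
  define F where "F = {s\<in>S. \<not> fls_vanishes 0 (f s)}"
  have fin: "finite F"
    using assms by (simp add: loc_finite_def F_def)
  define L where "L = Min (insert 0 ((\<lambda>s. fls_subdegree (f s)) ` F))"
  have c0: "c k = 0" if "k < L" for k
  proof -
    have "fls_nth (f s) k = 0" if s: "s \<in> S" for s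
    proof (cases "s \<in> F")
      case True
      then have "L \<le> fls_subdegree (f s)"
        unfolding L_def using fin by (intro Min_le) auto
      then show ?thesis using \<open>k < L\<close> by simp
    next
      case False
      have "L \<le> 0" unfolding L_def using fin by (intro Min_le) auto
      with False s \<open>k < L\<close> show ?thesis by (auto simp: F_def fls_vanishes_def)
    qed
    then show ?thesis by (auto simp: c_def intro: sum.neutral)
  qed
  have "fls_nth (Abs_fls c) k = c k" for k
    using c0 by (intro nth_Abs_fls_lower_bound[of L]) auto
  then have "lf_sum f S (Abs_fls c)"
    using assms by (intro lf_sumI_nth) (auto simp: c_def)
  then show ?thesis by (rule that)
qed

lemma loc_finite_subset: "loc_finite f S \<Longrightarrow> T \<subseteq> S \<Longrightarrow> loc_finite f T"
  unfolding loc_finite_def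
proof
  fix K assume "\<forall>K. finite {s\<in>S. \<not> fls_vanishes K (f s)}" "T \<subseteq> S"
  then have "finite {s\<in>S. \<not> fls_vanishes K (f s)}"
    "{s\<in>T. \<not> fls_vanishes K (f s)} \<subseteq> {s\<in>S. \<not> fls_vanishes K (f s)}"
    by auto
  then show "finite {s\<in>T. \<not> fls_vanishes K (f s)}"
    by (rule finite_subset[rotated])
qed

lemma lf_sum_cong:
  assumes "\<And>s. s \<in> S \<Longrightarrow> f s = g s" "S = T" "t = u"
  shows "lf_sum f S t \<longleftrightarrow> lf_sum g T u"
proof -
  have "sum f F = sum g F" if "F \<subseteq> S" for F
    using assms(1) that by (intro sum.cong) auto
  then have "(finite F \<and> F \<subseteq> S \<and> (\<forall>s\<in>S - F. fls_vanishes K (f s)) \<and> fls_vanishes K (t - sum f F)) \<longleftrightarrow>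
      (finite F \<and> F \<subseteq> T \<and> (\<forall>s\<in>T - F. fls_vanishes K (g s)) \<and> fls_vanishes K (u - sum g F))" for F K
    using assms by auto
  then show ?thesis
    unfolding lf_sum_def by simp
qed

lemma lf_sum_finite: "finite S \<Longrightarrow> lf_sum f S (sum f S)"
  unfolding lf_sum_def by (intro allI exI[of _ S]) simp

lemma lf_sum_cmult:
  fixes f :: "'b \<Rightarrow> 'a::comm_ring fls"
  assumes "lf_sum f S t"
  shows "lf_sum (\<lambda>s. c * f s) S (c * t)"
  unfolding lf_sum_def
proof
  fix K
  obtain F where F: "finite F" "F \<subseteq> S" "\<And>s. s \<in> S \<Longrightarrow> s \<notin> F \<Longrightarrow> fls_vanishes (K - fls_subdegree c) (f s)"
    "\<And>G. finite G \<Longrightarrow> F \<subseteq> G \<Longrightarrow> G \<subseteq> S \<Longrightarrow> fls_vanishes (K - fls_subdegree c) (t - sum f G)"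
    using assms by (rule lf_sumE[where K = "K - fls_subdegree c"]) blast
  have "fls_vanishes K (c * t - (\<Sum>s\<in>F. c * f s))"
    using fls_vanishes_mult[OF F(4)[OF F(1) order_refl F(2)] order_refl, of c]
    by (simp add: right_diff_distrib sum_distrib_left)
  moreover have "fls_vanishes K (c * f s)" if "s \<in> S - F" for s
    using fls_vanishes_mult[OF F(3)[of s] order_refl, of c] that by simp
  ultimately show "\<exists>F. finite F \<and> F \<subseteq> S \<and> (\<forall>s\<in>S - F. fls_vanishes K (c * f s)) \<and>
      fls_vanishes K (c * t - (\<Sum>s\<in>F. c * f s))"
    using F(1,2) by blast
qed

lemma lf_sum_add:
  assumes "lf_sum f S t" "lf_sum g S u"
  shows "lf_sum (\<lambda>s. f s + g s) S (t + u)"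
  unfolding lf_sum_def
proof
  fix K
  obtain F where F: "finite F" "F \<subseteq> S" "\<And>s. s \<in> S \<Longrightarrow> s \<notin> F \<Longrightarrow> fls_vanishes K (f s)"
    "\<And>G. finite G \<Longrightarrow> F \<subseteq> G \<Longrightarrow> G \<subseteq> S \<Longrightarrow> fls_vanishes K (t - sum f G)"
    using assms(1) by (rule lf_sumE[where K = K]) blast
  obtain F' where F': "finite F'" "F' \<subseteq> S" "\<And>s. s \<in> S \<Longrightarrow> s \<notin> F' \<Longrightarrow> fls_vanishes K (g s)"
    "\<And>G. finite G \<Longrightarrow> F' \<subseteq> G \<Longrightarrow> G \<subseteq> S \<Longrightarrow> fls_vanishes K (u - sum g G)"
    using assms(2) by (rule lf_sumE[where K = K]) blast
  let ?F = "F \<union> F'"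
  have "fls_vanishes K ((t - sum f ?F) + (u - sum g ?F))"
    by (rule fls_vanishes_add) (use F F' in auto)
  then have "fls_vanishes K (t + u - (\<Sum>s\<in>?F. f s + g s))"
    by (simp add: sum.distrib algebra_simps)
  moreover have "\<forall>s\<in>S - ?F. fls_vanishes K (f s + g s)"
    using F(3) F'(3) by (auto intro: fls_vanishes_add)
  ultimately show "\<exists>F. finite F \<and> F \<subseteq> S \<and> (\<forall>s\<in>S - F. fls_vanishes K (f s + g s)) \<and>
      fls_vanishes K (t + u - (\<Sum>s\<in>F. f s + g s))"
    using F(1,2) F'(1,2) by (intro exI[of _ ?F]) auto
qed

lemma lf_sum_zero: "lf_sum (\<lambda>s. 0) S 0"
  unfolding lf_sum_def by (intro allI exI[of _ "{}"]) simp

lemma lf_sum_sum: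
  assumes "\<And>i. i \<in> I \<Longrightarrow> lf_sum (f i) S (t i)"
  shows "lf_sum (\<lambda>s. \<Sum>i\<in>I. f i s) S (\<Sum>i\<in>I. t i)"
  using assms
  by (induction I rule: infinite_finite_induct) (auto intro: lf_sum_zero lf_sum_add)

lemma lf_sum_reindex:
  assumes "bij_betw h T S" "lf_sum f S t"
  shows "lf_sum (\<lambda>s. f (h s)) T t"
  unfolding lf_sum_def
proof
  fix K
  obtain F where F: "finite F" "F \<subseteq> S" "\<And>s. s \<in> S \<Longrightarrow> s \<notin> F \<Longrightarrow> fls_vanishes K (f s)"
    "\<And>G. finite G \<Longrightarrow> F \<subseteq> G \<Longrightarrow> G \<subseteq> S \<Longrightarrow> fls_vanishes K (t - sum f G)"
    using assms(2) by (rule lf_sumE[where K = K]) blast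
  define G where "G = {s\<in>T. h s \<in> F}"
  have inj: "inj_on h G"
    using assms(1) by (auto simp: G_def bij_betw_def intro: inj_on_subset)
  have img: "h ` G = F"
    using assms(1) F(2) by (auto simp: G_def bij_betw_def)
  have "finite G"
    using F(1) img inj by (metis finite_imageD)
  moreover have "(\<Sum>s\<in>G. f (h s)) = sum f F"
    using img inj by (metis (mono_tags, lifting) comp_apply sum.cong sum.reindex)
  moreover have "\<forall>s\<in>T - G. fls_vanishes K (f (h s))"
    using F(3) assms(1) by (auto simp: G_def bij_betw_def)
  ultimately show "\<exists>F. finite F \<and> F \<subseteq> T \<and> (\<forall>s\<in>T - F. fls_vanishes K (f (h s))) \<and>
      fls_vanishes K (t - (\<Sum>s\<in>F. f (h s)))"
    using F(4)[of F] F(1,2) by (intro exI[of _ G]) (auto simp: G_def)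
qed

lemma lf_sum_reindex_iff:
  assumes "bij_betw h T S"
  shows "lf_sum (\<lambda>s. f (h s)) T t \<longleftrightarrow> lf_sum f S t"
proof
  assume L: "lf_sum (\<lambda>s. f (h s)) T t"
  have "lf_sum (\<lambda>s. f (h (the_inv_into T h s))) S t"
    by (rule lf_sum_reindex[OF bij_betw_the_inv_into[OF assms] L])
  then show "lf_sum f S t"
    by (rule lf_sum_cong[THEN iffD1, rotated -1])
      (use assms in \<open>auto simp: f_the_inv_into_f_bij_betw\<close>)
qed (rule lf_sum_reindex[OF assms])

lemma lf_sum_mono_neutral:
  assumes "T \<subseteq> S" "\<And>s. s \<in> S - T \<Longrightarrow> f s = 0"
  shows "lf_sum f T t \<longleftrightarrow> lf_sum f S t"
proof
  assume L: "lf_sum f T t"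
  show "lf_sum f S t"
  proof (rule lf_sumI_nth)
    have "{s\<in>S. \<not> fls_vanishes K (f s)} = {s\<in>T. \<not> fls_vanishes K (f s)}" for K
      using assms by fastforce
    then show "loc_finite f S"
      using lf_sum_loc_finite[OF L] by (simp add: loc_finite_def)
    have "{s\<in>S. fls_nth (f s) k \<noteq> 0} = {s\<in>T. fls_nth (f s) k \<noteq> 0}" for k
      using assms by fastforce
    then show "fls_nth t k = (\<Sum>s | s \<in> S \<and> fls_nth (f s) k \<noteq> 0. fls_nth (f s) k)" for k
      using lf_sum_nth(2)[OF L, of k] by simp
  qed
next
  assume L: "lf_sum f S t"
  show "lf_sum f T t"
  proof (rule lf_sumI_nth)
    show "loc_finite f T"
      using lf_sum_loc_finite[OF L] assms(1) by (rule loc_finite_subset)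
    have "{s\<in>S. fls_nth (f s) k \<noteq> 0} = {s\<in>T. fls_nth (f s) k \<noteq> 0}" for k
      using assms by fastforce
    then show "fls_nth t k = (\<Sum>s | s \<in> T \<and> fls_nth (f s) k \<noteq> 0. fls_nth (f s) k)" for k
      using lf_sum_nth(2)[OF L, of k] by simp
  qed
qed

text \<open>One half of Fubini, with the existence of the double sum assumed. At order
  \<open>K\<close> each inner sum is approximated on a finite slice that contains the slice of
  \<open>F\<close>; terms outside \<open>F\<close> are negligible, so only the projection of
  \<open>F\<close> matters for the outer sum.\<close>

lemma lf_sum_Sigma:
  assumes tot: "lf_sum (\<lambda>(x, y). f x y) (Sigma A B) t"
    and inner: "\<And>x. x \<in> A \<Longrightarrow> lf_sum (f x) (B x) (g x)"
  shows "lf_sum g A t"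
  unfolding lf_sum_def
proof
  fix K
  obtain F where F: "finite F" "F \<subseteq> Sigma A B"
    "\<And>s. s \<in> Sigma A B \<Longrightarrow> s \<notin> F \<Longrightarrow> fls_vanishes K (case s of (x, y) \<Rightarrow> f x y)"
    "\<And>G. finite G \<Longrightarrow> F \<subseteq> G \<Longrightarrow> G \<subseteq> Sigma A B \<Longrightarrow>
       fls_vanishes K (t - sum (\<lambda>(x, y). f x y) G)"
    using tot by (rule lf_sumE[where K = K]) blast
  define D where "D = fst ` F"
  have "\<exists>H. finite H \<and> {y. (x, y) \<in> F} \<subseteq> H \<and> H \<subseteq> B x \<and> fls_vanishes K (g x - sum (f x) H)"
    if x: "x \<in> A" for x
  proof -
    have fin: "finite {y. (x, y) \<in> F}"
      by (rule finite_subset[of _ "snd ` F"]) (use F(1) in force)+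
    obtain H where H: "finite H" "H \<subseteq> B x"
      "\<And>G. finite G \<Longrightarrow> H \<subseteq> G \<Longrightarrow> G \<subseteq> B x \<Longrightarrow> fls_vanishes K (g x - sum (f x) G)"
      using inner[OF x] by (rule lf_sumE[where K = K]) blast
    have "H \<union> {y. (x, y) \<in> F} \<subseteq> B x"
      using H(2) F(2) by auto
    then show ?thesis
      using H(1) fin H(3)[of "H \<union> {y. (x, y) \<in> F}"]
      by (intro exI[of _ "H \<union> {y. (x, y) \<in> F}"]) auto
  qed
  then obtain H where H: "\<And>x. x \<in> A \<Longrightarrow> finite (H x)" "\<And>x. x \<in> A \<Longrightarrow> {y. (x, y) \<in> F} \<subseteq> H x"
    "\<And>x. x \<in> A \<Longrightarrow> H x \<subseteq> B x" "\<And>x. x \<in> A \<Longrightarrow> fls_vanishes K (g x - sum (f x) (H x))"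
    by metis
  have D: "finite D" "D \<subseteq> A"
    using F(1,2) by (auto simp: D_def)
  have "fls_vanishes K (g x)" if "x \<in> A - D" for x
  proof -
    have "fls_vanishes K (sum (f x) (H x))"
    proof (rule fls_vanishes_sum)
      fix y assume "y \<in> H x"
      then have "(x, y) \<in> Sigma A B" using H(3) that by auto
      moreover have "(x, y) \<notin> F" using that by (force simp: D_def)
      ultimately show "fls_vanishes K (f x y)" using F(3) by force
    qed
    from fls_vanishes_add[OF H(4)[of x] this] that show ?thesis by simp
  qed
  moreover have "fls_vanishes K (t - sum g D)"
  proof -
    have sub: "F \<subseteq> Sigma D H"
      using H(2) F(2) by (force simp: D_def)
    have "fls_vanishes K (t - sum (\<lambda>(x, y). f x y) (Sigma D H))"
    proof (rule F(4)[OF _ sub])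
      show "finite (Sigma D H)" using D H(1) by (intro finite_SigmaI) auto
      show "Sigma D H \<subseteq> Sigma A B" using D(2) H(3) by (intro Sigma_mono) (auto dest: subsetD)
    qed
    moreover have "sum (\<lambda>(x, y). f x y) (Sigma D H) = (\<Sum>x\<in>D. sum (f x) (H x))"
      by (rule sum.Sigma[symmetric]) (use D H in auto)
    moreover have "fls_vanishes K (\<Sum>x\<in>D. g x - sum (f x) (H x))"
      by (rule fls_vanishes_sum) (use D H(4) in auto)
    ultimately have "fls_vanishes K ((t - (\<Sum>x\<in>D. sum (f x) (H x))) - (\<Sum>x\<in>D. g x - sum (f x) (H x)))"
      by (metis fls_vanishes_diff)
    then show ?thesis by (simp add: sum_subtractf)
  qed
  ultimately show "\<exists>F. finite F \<and> F \<subseteq> A \<and> (\<forall>s\<in>A - F. fls_vanishes K (g s)) \<and> fls_vanishes K (t - sum g F)"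
    using D by blast
qed

lemma lf_sum_bounded_below:
  assumes "lf_sum f S t"
  obtains L where "\<And>s. s \<in> S \<Longrightarrow> fls_vanishes L (f s)"
proof -
  define F where "F = {s\<in>S. \<not> fls_vanishes 0 (f s)}"
  have fin: "finite F"
    using lf_sum_loc_finite[OF assms] by (simp add: loc_finite_def F_def)
  \<comment> \<open>\<open>fls_vanishes L\<close> includes the coefficient at \<open>L\<close>
    itself, hence one less than the smallest order.\<close>
  define L where "L = Min (insert 0 ((\<lambda>s. fls_subdegree (f s)) ` F)) - 1"
  have "fls_vanishes L (f s)" if s: "s \<in> S" for s
  proof (cases "s \<in> F")
    case True
    then have "L + 1 \<le> fls_subdegree (f s)"
      unfolding L_def using fin by (auto intro!: Min_le)
    then show ?thesis by (simp add: fls_vanishes_iff_subdegree)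
  next
    case False
    have "L + 1 \<le> 0" unfolding L_def using fin by (auto intro!: Min_le)
    with False s show ?thesis by (auto simp: F_def fls_vanishes_def)
  qed
  then show ?thesis using that by blast
qed

lemma fls_vanishes_times:
  fixes f g :: "'a::{comm_monoid_add,mult_zero} fls"
  assumes "fls_vanishes K f" "fls_vanishes L g" "J \<le> K + L"
  shows "fls_vanishes J (f * g)"
proof (cases "f = 0 \<or> g = 0")
  case False
  with assms have "K < fls_subdegree f" "L < fls_subdegree g"
    by (simp_all add: fls_vanishes_iff_subdegree)
  with assms(3) show ?thesis by (auto simp: fls_vanishes_def intro!: fls_times_nth_eq0)
qed auto

text \<open>Orders are bounded below in both families, so a product reaches order \<open>K\<close>
  only if each factor lies in a finite set. This makes the double family summable, and iterated
  summation gives its value.\<close>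

lemma lf_sum_product:
  fixes f :: "'b \<Rightarrow> 'a::comm_ring fls"
  assumes "lf_sum f S t" "lf_sum g T u"
  shows "lf_sum (\<lambda>(x, y). f x * g y) (S \<times> T) (t * u)"
proof -
  obtain L where L: "\<And>s. s \<in> S \<Longrightarrow> fls_vanishes L (f s)"
    using lf_sum_bounded_below[OF assms(1)] by blast
  obtain M where M: "\<And>s. s \<in> T \<Longrightarrow> fls_vanishes M (g s)"
    using lf_sum_bounded_below[OF assms(2)] by blast
  have "loc_finite (\<lambda>(x, y). f x * g y) (S \<times> T)"
    unfolding loc_finite_def
  proof
    fix K
    define F where "F = {s\<in>S. \<not> fls_vanishes (K - M) (f s)}"
    define G where "G = {s\<in>T. \<not> fls_vanishes (K - L) (g s)}"
    have "finite (F \<times> G)"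
      using lf_sum_loc_finite[OF assms(1)] lf_sum_loc_finite[OF assms(2)]
      by (auto simp: loc_finite_def F_def G_def)
    moreover have "{p \<in> S \<times> T. \<not> fls_vanishes K (case p of (x, y) \<Rightarrow> f x * g y)} \<subseteq> F \<times> G"
      using fls_vanishes_times[of "K - M" _ M _ K] fls_vanishes_times[of L _ "K - L" _ K] L M
      by (force simp: F_def G_def)
    ultimately show "finite {p \<in> S \<times> T. \<not> fls_vanishes K (case p of (x, y) \<Rightarrow> f x * g y)}"
      using finite_subset by blast
  qed
  then obtain v where v: "lf_sum (\<lambda>(x, y). f x * g y) (S \<times> T) v"
    by (rule loc_finite_imp_lf_sum)
  have "lf_sum (\<lambda>x. f x * u) S v"
    by (rule lf_sum_Sigma[OF v]) (rule lf_sum_cmult[OF assms(2)])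
  moreover have "lf_sum (\<lambda>x. f x * u) S (t * u)"
    using lf_sum_cmult[OF assms(1), of u] by (simp add: mult.commute)
  ultimately show ?thesis
    using v lf_sum_unique by blast
qed

text \<open>Both iterated sums equal the sum over pairs, which exists by joint local
  finiteness.\<close>

lemma lf_sum_swap:
  assumes "loc_finite (\<lambda>(x, y). f x y) (A \<times> B)"
    and "\<And>x. x \<in> A \<Longrightarrow> lf_sum (f x) B (g x)"
    and "\<And>y. y \<in> B \<Longrightarrow> lf_sum (\<lambda>x. f x y) A (h y)"
    and "lf_sum h B t"
  shows "lf_sum g A t"
proof -
  obtain v where v: "lf_sum (\<lambda>(x, y). f x y) (A \<times> B) v"
    using assms(1) by (rule loc_finite_imp_lf_sum)
  have "lf_sum (\<lambda>p. (\<lambda>(x, y). f x y) (prod.swap p)) (B \<times> A) v"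
    by (rule lf_sum_reindex[OF _ v]) (simp add: bij_betw_def product_swap)
  then have "lf_sum (\<lambda>(y, x). f x y) (B \<times> A) v"
    by (rule lf_sum_cong[THEN iffD1, rotated -1]) auto
  then have "lf_sum h B v"
    by (rule lf_sum_Sigma) (rule assms(3))
  with assms(4) have "v = t" by (rule lf_sum_unique[rotated])
  moreover have "lf_sum g A v"
    by (rule lf_sum_Sigma[OF v]) (rule assms(2))
  ultimately show ?thesis by simp
qed

text \<open>Infinite distributivity, by induction on the index set; it allows a sum over tuples to
  be taken one coordinate at a time.\<close>

lemma lf_sum_prod_PiE:
  fixes f :: "'k \<Rightarrow> 'b \<Rightarrow> 'a::comm_ring_1 fls"
  assumes "finite I" "\<And>k. k \<in> I \<Longrightarrow> lf_sum (f k) (S k) (t k)"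
  shows "lf_sum (\<lambda>y. \<Prod>k\<in>I. f k (y k)) (PiE I S) (\<Prod>k\<in>I. t k)"
  using assms
proof (induction I)
  case empty
  show ?case
    using lf_sum_finite[of "{\<lambda>_. undefined}" "\<lambda>_. 1 :: 'a fls"] by simp
next
  case (insert i I)
  have "lf_sum (\<lambda>(x, y). f i x * (\<Prod>k\<in>I. f k (y k))) (S i \<times> PiE I S) (t i * (\<Prod>k\<in>I. t k))"
    using insert by (intro lf_sum_product) auto
  moreover have "bij_betw (\<lambda>(x, y). y(i := x)) (S i \<times> PiE I S) (PiE (insert i I) S)"
    unfolding bij_betw_def using insert(2)
    by (intro conjI) (auto intro: inj_combinator simp: PiE_insert_eq)
  moreover have "(\<Prod>k\<in>I. f k ((y(i := x)) k)) = (\<Prod>k\<in>I. f k (y k))" for x y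
    using insert(2) by (intro prod.cong) auto
  ultimately show ?case
    using insert(1,2) by (subst lf_sum_reindex_iff[symmetric]) (auto simp: case_prod_unfold)
qed

text \<open>The bridge to the topological sum in the theorem: the distance of two Laurent series is
  2 to the power of minus the order of their difference, so agreement up to order \<open>n\<close>
  is closeness.\<close>

lemma lf_sum_has_sum:
  assumes "lf_sum f S t"
  shows "(f has_sum t) S"
  unfolding has_sum_def
proof (rule tendstoI)
  fix e :: real assume "e > 0"
  then obtain n where n: "inverse (2 ^ n) < e"
    using real_arch_pow_inv[of e "1/2"] by (auto simp: power_one_over inverse_eq_divide)
  obtain F where F: "finite F" "F \<subseteq> S" 
    "\<And>G. finite G \<Longrightarrow> F \<subseteq> G \<Longrightarrow> G \<subseteq> S \<Longrightarrow> fls_vanishes (int n) (t - sum f G)"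
    using assms by (rule lf_sumE[where K = "int n"]) blast
  have "dist (sum f G) t < e" if G: "finite G" "F \<subseteq> G" "G \<subseteq> S" for G
  proof (cases "sum f G = t")
    case False
    then have less: "int n < fls_subdegree (sum f G - t)"
      using F(3)[OF G] by (auto simp: fls_vanishes_iff_subdegree fls_subdegree_minus_sym[of "sum f G"])
    then have "dist (sum f G) t = inverse (2 ^ nat (fls_subdegree (sum f G - t)))"
      using False by (simp add: dist_fls_def)
    also have "\<dots> \<le> inverse (2 ^ n)"
      using less by (intro le_imp_inverse_le power_increasing) auto
    finally show ?thesis using n by simp
  qed (use \<open>e > 0\<close> in simp)
  then show "\<forall>\<^sub>F G in finite_subsets_at_top S. dist (sum f G) t < e"
    unfolding eventually_finite_subsets_at_top using F(1,2) by blast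
qed

section \<open>Reciprocal q-factorials and identities of Euler\<close>

text \<open>A constant of its own keeps the simplifier from rewriting the power with
  \<open>fls_X_power_int\<close>, so that the laws of exponents stay applicable.\<close>

definition qpow :: "int \<Rightarrow> 'a::field fls" where
  "qpow k = fls_X powi k"

lemma qpow_0 [simp]: "qpow 0 = 1"
  by (simp add: qpow_def del: fls_X_power_int)

lemma qpow_add: "qpow (a + b) = qpow a * qpow b"
  by (simp add: qpow_def power_int_add del: fls_X_power_int)

lemma qpow_nonzero [simp]: "qpow k \<noteq> 0"
  by (simp add: qpow_def del: fls_X_power_int)

lemma qpow_powi: "qpow a powi k = qpow (a * k)"
  by (simp add: qpow_def power_int_mult del: fls_X_power_int)

lemma prod_qpow: "(\<Prod>i\<in>I. qpow (e i)) = qpow (\<Sum>i\<in>I. e i)"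
  by (induction I rule: infinite_finite_induct) (auto simp: qpow_add)

lemma fls_subdegree_qpow [simp]: "fls_subdegree (qpow k :: 'a::field fls) = k"
  by (simp add: qpow_def)

lemma fls_nth_qpow_mult: "fls_nth (qpow k * f) n = fls_nth f (n - k)"
  by (simp add: qpow_def fls_X_intpow_times_conv_shift)

lemma fls_nth_qpow: "fls_nth (qpow k :: 'a::field fls) n = (if n = k then 1 else 0)"
  using fls_nth_qpow_mult[of k 1 n] by simp

lemma fls_vanishes_qpow_mult:
  assumes "K < e" "0 \<le> fls_subdegree u"
  shows "fls_vanishes K (qpow e * u)"
  using assms by (simp add: fls_vanishes_def fls_nth_qpow_mult)

lemma fls_subdegree_mult_nonneg:
  fixes f g :: "'a::field fls"
  assumes "0 \<le> fls_subdegree f" "0 \<le> fls_subdegree g"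
  shows "0 \<le> fls_subdegree (f * g)"
  using assms by (cases "f = 0 \<or> g = 0") auto

definition qfac :: "nat \<Rightarrow> rat fps" where
  "qfac n = (\<Prod>i<n. 1 - fps_X ^ Suc i)"

lemma qfac_0 [simp]: "qfac 0 = 1"
  by (simp add: qfac_def)

lemma qfac_Suc: "qfac (Suc n) = qfac n * (1 - fps_X ^ Suc n)"
  by (simp add: qfac_def)

lemma fps_nth_qfac_0 [simp]: "fps_nth (qfac n) 0 = 1"
  by (induction n) (simp_all add: qfac_Suc)

text \<open>The factors after the first \<open>k\<close> have the form 1 - q^e with e > k and do not
  touch the coefficient of q^k.\<close>

lemma fps_nth_qfac_stable: "k \<le> n \<Longrightarrow> fps_nth (qfac n) k = fps_nth (qfac k) k"
proof (induction n)
  case (Suc n)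
  show ?case
  proof (cases "k = Suc n")
    case False
    have "qfac (Suc n) = qfac n - qfac n * fps_X ^ Suc n"
      by (simp only: qfac_Suc right_diff_distrib mult_1_right)
    then have "fps_nth (qfac (Suc n)) k = fps_nth (qfac n) k"
      using Suc.prems False by (simp only: fps_sub_nth fps_X_power_mult_right_nth) simp
    with Suc False show ?thesis by simp
  qed simp
qed simp

lemma fps_nth_q_infty: "fps_nth q_infty k = fps_nth (qfac k) k"
proof -
  define p where "p = Abs_fps (\<lambda>k. fps_nth (qfac k) k)"
  have "(\<lambda>n. qfac (Suc n)) \<longlonglongrightarrow> p"
  proof (rule tendsto_fpsI)
    fix k
    have "fps_nth (qfac (Suc n)) k = fps_nth p k" if "n \<ge> k" for n
      using that fps_nth_qfac_stable[of k "Suc n"] by (simp add: p_def)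
    then show "\<forall>\<^sub>F n in sequentially. fps_nth (qfac (Suc n)) k = fps_nth p k"
      by (auto simp: eventually_sequentially)
  qed
  \<comment> \<open>\<open>raw_has_prod\<close> demands a nonzero limit.\<close>
  moreover have "fps_nth p 0 = 1" by (simp add: p_def)
  then have "p \<noteq> 0" by auto
  ultimately have "(\<lambda>k. 1 - fps_X ^ Suc k :: rat fps) has_prod p"
    unfolding has_prod_def raw_has_prod_def qfac_def lessThan_Suc_atMost by simp
  then have "q_infty = p"
    unfolding q_infty_def by (rule has_prod_unique[symmetric])
  then show ?thesis unfolding p_def by (metis fps_nth_Abs_fps)
qed

lemma fps_nth_q_infty_0 [simp]: "fps_nth q_infty 0 = 1"
  by (simp add: fps_nth_q_infty)

lemma q_infty_nonzero [simp]: "q_infty \<noteq> 0"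
  using fps_nth_q_infty_0 by (metis fps_zero_nth zero_neq_one)

lemma qfac_nonzero [simp]: "qfac n \<noteq> 0"
  using fps_nth_qfac_0 by (metis fps_zero_nth zero_neq_one)

abbreviation qinf :: "rat fls" where
  "qinf \<equiv> fps_to_fls q_infty"

abbreviation qfacl :: "nat \<Rightarrow> rat fls" where
  "qfacl n \<equiv> fps_to_fls (qfac n)"

lemma fls_subdegree_fps_unit:
  assumes "fps_nth f 0 = (1::rat)"
  shows "fls_subdegree (fps_to_fls f) = 0" "fps_to_fls f \<noteq> 0"
    "fls_subdegree (inverse (fps_to_fls f)) = 0"
proof -
  have "f \<noteq> 0" using assms by auto
  moreover have "subdegree f = 0" using assms by simp
  ultimately show "fls_subdegree (fps_to_fls f) = 0" "fps_to_fls f \<noteq> 0"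
    by (simp_all add: fls_subdegree_fls_to_fps)
  then show "fls_subdegree (inverse (fps_to_fls f)) = 0"
    by simp
qed

lemmas qinf_unit [simp] = fls_subdegree_fps_unit[OF fps_nth_q_infty_0]
lemmas qfacl_unit [simp] = fls_subdegree_fps_unit[OF fps_nth_qfac_0]

lemma qfacl_Suc: "qfacl (Suc n) = qfacl n * (1 - qpow (int n + 1))"
  by (simp add: qfac_Suc fls_times_fps_to_fls fps_to_fls_power qpow_def
      power_int_add power_int_of_nat del: fls_X_power_int power_Suc) (simp add: mult.commute)

text \<open>This is \<open>1 / (q)\<^sub>z\<close>; the value for negative \<open>z\<close> makes the recursion below hold for all integers.\<close>

definition iqpoch :: "int \<Rightarrow> rat fls" where
  "iqpoch z = (if z < 0 then 0 else inverse (qfacl (nat z)))"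

lemma iqpoch_neg [simp]: "z < 0 \<Longrightarrow> iqpoch z = 0"
  by (simp add: iqpoch_def)

lemma iqpoch_0 [simp]: "iqpoch 0 = 1"
  by (simp add: iqpoch_def)

lemma fls_subdegree_iqpoch [simp]: "fls_subdegree (iqpoch z) = 0"
  by (simp add: iqpoch_def)

lemma iqpoch_of_nat: "iqpoch (int n) = inverse (qfacl n)"
  by (simp add: iqpoch_def)

lemma iqpoch_rec: "(1 - qpow z) * iqpoch z = iqpoch (z - 1)"
proof -
  consider "z < 0" | "z = 0" | n where "z = int (Suc n)"
    by (metis int_cases2 nat.exhaust neg_equal_0_iff_equal of_nat_0 linorder_cases zero_less_imp_eq_int gr0_conv_Suc)
  then show ?thesis
  proof cases
    case 3
    define w :: "rat fls" where "w = 1 - qpow z"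
    have fac: "qfacl (Suc n) = qfacl n * w"
      by (simp add: qfacl_Suc w_def 3 add.commute)
    have "w \<noteq> 0"
      using qfacl_unit(2)[of "Suc n"] unfolding fac by auto
    then have "w * inverse (qfacl n * w) = inverse (qfacl n)" by simp
    moreover have "z - 1 = int n" by (simp add: 3)
    ultimately show ?thesis
      unfolding w_def[symmetric] by (simp only: 3 iqpoch_of_nat fac)
  qed auto
qed

text \<open>The telescoping form of the recursion: weighting 1/(q)_z by q^z turns it into a
  difference of neighbours.\<close>

lemma qpow_mult_iqpoch: "qpow z * iqpoch z = iqpoch z - iqpoch (z - 1)"
  by (simp add: iqpoch_rec[symmetric] algebra_simps)

text \<open>The difference is (q)_z - (q)_inf times a series of order 0, and these two products
  agree up to order z.\<close>

lemma iqpoch_tendsto: "K \<le> z \<Longrightarrow> 0 \<le> z \<Longrightarrow> fls_vanishes K (inverse qinf - iqpoch z)"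
proof -
  assume z: "K \<le> z" "0 \<le> z"
  then obtain n where n: "z = int n" by (metis nonneg_int_cases)
  have "fls_vanishes K (qfacl n - qinf)"
    unfolding fls_vanishes_def
  proof (intro allI impI)
    fix k assume "k \<le> K"
    then show "fls_nth (qfacl n - qinf) k = 0"
      using z n fps_nth_qfac_stable[of "nat k" n] by (auto simp: fps_nth_q_infty)
  qed
  then have "fls_vanishes (K + 0) (inverse qinf * inverse (qfacl n) * (qfacl n - qinf))"
    by (rule fls_vanishes_mult) (auto intro!: fls_subdegree_mult_nonneg)
  moreover have "inverse qinf * inverse (qfacl n) * (qfacl n - qinf) = inverse qinf - iqpoch z"
    by (simp add: n iqpoch_of_nat divide_simps)
  ultimately show ?thesis by simp
qed

lemma sum_qpow_iqpoch:
  fixes a b :: nat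
  assumes "a \<le> b"
  shows "(\<Sum>y\<in>{a<..b}. qpow (int y - N) * iqpoch (int y - N)) = iqpoch (int b - N) - iqpoch (int a - N)"
  using assms
proof (induction b rule: dec_induct)
  case (step b)
  have "{a<..Suc b} = insert (Suc b) {a<..b}" using step by auto
  moreover have "int (Suc b) - N - 1 = int b - N" by simp
  ultimately show ?case
    using step.IH qpow_mult_iqpoch[of "int (Suc b) - N"] by simp
qed simp

lemma sum_qpow_iqpoch_atMost:
  fixes b :: nat
  assumes "0 \<le> N"
  shows "(\<Sum>y\<in>{..b}. qpow (int y - N) * iqpoch (int y - N)) = iqpoch (int b - N)"
proof -
  have "{..b} = insert 0 {0<..b}" by auto
  \<comment> \<open>The term y = 0 lies outside the telescoping range. For \<open>N > 0\<close> both
    sides are 0 because \<open>- N\<close> is negative, and for \<open>N = 0\<close> both are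
    1.\<close>
  moreover have "qpow (- N) * iqpoch (- N) = iqpoch (- N)"
    using assms by (cases "N = 0") auto
  ultimately show ?thesis
    using sum_qpow_iqpoch[of 0 b N] by simp
qed

text \<open>A range without upper end belongs to an entry whose predecessor is infinite; the upper
  end of the telescoped sum is replaced by its limit 1/(q)_inf.\<close>

lemma lf_sum_qpow_iqpoch:
  "lf_sum (\<lambda>y. qpow (int y - N) * iqpoch (int y - N)) {a<..} (inverse qinf - iqpoch (int a - N))"
  unfolding lf_sum_def
proof
  fix K
  define b where "b = max a (nat (\<bar>K\<bar> + \<bar>N\<bar>))"
  have b: "a \<le> b" "K \<le> int b - N" "0 \<le> int b - N" by (auto simp: b_def)
  have "inverse qinf - iqpoch (int a - N) - (\<Sum>y\<in>{a<..b}. qpow (int y - N) * iqpoch (int y - N)) =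
    inverse qinf - iqpoch (int b - N)"
    unfolding sum_qpow_iqpoch[OF b(1)] by simp
  then have "fls_vanishes K (inverse qinf - iqpoch (int a - N) -
      (\<Sum>y\<in>{a<..b}. qpow (int y - N) * iqpoch (int y - N)))"
    using iqpoch_tendsto[OF b(2,3)] by (rule ssubst)
  moreover have "fls_vanishes K (qpow (int y - N) * iqpoch (int y - N))" if "y \<in> {a<..} - {a<..b}" for y
    by (rule fls_vanishes_qpow_mult) (use b that in auto)
  ultimately have "finite {a<..b} \<and> {a<..b} \<subseteq> {a<..} \<and>
      (\<forall>s\<in>{a<..} - {a<..b}. fls_vanishes K (qpow (int s - N) * iqpoch (int s - N))) \<and>
      fls_vanishes K (inverse qinf - iqpoch (int a - N) - (\<Sum>y\<in>{a<..b}. qpow (int y - N) * iqpoch (int y - N)))"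
    by (intro conjI ballI) (simp_all only: finite_greaterThanAtMost, auto)
  then show "\<exists>F. finite F \<and> F \<subseteq> {a<..} \<and>
      (\<forall>s\<in>{a<..} - F. fls_vanishes K (qpow (int s - N) * iqpoch (int s - N))) \<and>
      fls_vanishes K (inverse qinf - iqpoch (int a - N) - (\<Sum>y\<in>F. qpow (int y - N) * iqpoch (int y - N)))"
    by (rule exI)
qed

lemma bij_betw_Suc_greaterThan_0: "bij_betw Suc UNIV {0<..}"
  by (auto simp: bij_betw_def image_iff gr0_conv_Suc)

lemma lf_sum_qpow_iqpoch_UNIV:
  assumes "0 \<le> N"
  shows "lf_sum (\<lambda>y. qpow (int y - N) * iqpoch (int y - N)) UNIV (inverse qinf)"
proof -
  \<comment> \<open>With \<open>N + 1\<close> in place of \<open>N\<close> the boundary term at 0 is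
    \<open>iqpoch (- (N + 1)) = 0\<close>; shifting the index by one then restores \<open>N\<close>
    and reaches y = 0.\<close>
  have "lf_sum (\<lambda>y. qpow (int y - (N + 1)) * iqpoch (int y - (N + 1))) {0<..} (inverse qinf)"
    using lf_sum_qpow_iqpoch[of "N + 1" 0] assms by simp
  moreover note bij_betw_Suc_greaterThan_0
  ultimately have "lf_sum (\<lambda>y. qpow (int (Suc y) - (N + 1)) * iqpoch (int (Suc y) - (N + 1))) UNIV (inverse qinf)"
    by (rule lf_sum_reindex[rotated])
  then show ?thesis by simp
qed

text \<open>Two identities of Euler, with \<open>z = q\<^sup>s\<close> substituted for the formal variable.\<close>

lemma euler_reciprocal: "lf_sum (\<lambda>k. qpow (int k * (int A + 1)) * iqpoch (int k)) UNIV (qfacl A * inverse qinf)"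
proof (induction A)
  case 0
  then show ?case using lf_sum_qpow_iqpoch_UNIV[of 0] by simp
next
  case (Suc A)
  let ?f = "\<lambda>A k. qpow (int k * (int A + 1)) * iqpoch (int k)"
  \<comment> \<open>Let S_A be the sum for \<open>A\<close>. Multiplying its terms by 1 - q^k lowers
    1/(q)_k to 1/(q)_(k-1), and after a shift the sum is q^(A+1) S_A. Subtracting this from S_A
    leaves the terms times q^k, which is S_(A+1).\<close>
  have shift: "lf_sum (\<lambda>k. ?f A (Suc k) * (1 - qpow (int k + 1))) UNIV (qpow (int A + 1) * (qfacl A * inverse qinf))"
  proof (rule lf_sum_cong[THEN iffD1, OF _ refl refl lf_sum_cmult[OF Suc.IH, of "qpow (int A + 1)"]])
    fix k
    have rec: "iqpoch (int (Suc k)) * (1 - qpow (int k + 1)) = iqpoch (int k)"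
      using iqpoch_rec[of "int (Suc k)"] by (simp add: algebra_simps)
    have split: "qpow (int (Suc k) * (int A + 1)) = qpow (int A + 1) * qpow (int k * (int A + 1))"
      by (simp flip: qpow_add add: algebra_simps)
    show "qpow (int A + 1) * (qpow (int k * (int A + 1)) * iqpoch (int k)) =
       ?f A (Suc k) * (1 - qpow (int k + 1))"
      unfolding split rec[symmetric] by (simp only: mult.assoc)
  qed
  from bij_betw_Suc_greaterThan_0 shift have "lf_sum (\<lambda>k. ?f A k * (1 - qpow (int k))) {0<..} (qpow (int A + 1) * (qfacl A * inverse qinf))"
    by (subst lf_sum_reindex_iff[symmetric, where h = Suc and T = UNIV])
       (simp_all add: add.commute)
  then have "lf_sum (\<lambda>k. ?f A k * (1 - qpow (int k))) UNIV (qpow (int A + 1) * (qfacl A * inverse qinf))"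
    by (subst (asm) lf_sum_mono_neutral[of _ UNIV]) auto
  then have "lf_sum (\<lambda>k. - 1 * (?f A k * (1 - qpow (int k)))) UNIV (- 1 * (qpow (int A + 1) * (qfacl A * inverse qinf)))"
    by (rule lf_sum_cmult)
  from lf_sum_add[OF Suc.IH this]
  have "lf_sum (\<lambda>k. ?f A k * qpow (int k)) UNIV (qfacl (Suc A) * inverse qinf)"
    by (simp add: qfacl_Suc algebra_simps)
  moreover have "?f A k * qpow (int k) = ?f (Suc A) k" for k
    by (simp add: mult_ac flip: qpow_add) (simp add: mult.assoc[symmetric] algebra_simps flip: qpow_add)
  ultimately show ?case by (simp only:)
qed

section \<open>Gaussian bounds and the expansion of (z;q)_inf at integral powers of q\<close>

lemma tri_add: "int ((n + 1) choose 2) = int (n choose 2) + int n"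
  by (simp add: numeral_2_eq_2)

text \<open>Quadratic growth beats every slope \<open>c\<close>. The constant
  \<open>c * (2 * c + 1)\<close> absorbs the range n < 2c + 1, where the right-hand side is not
  positive.\<close>

lemma binomial_2_ge: "int (n choose 2) \<ge> int c * int n - int c * (2 * int c + 1)"
proof (cases "2 * c + 1 \<le> n")
  case True
  have "2 * int (n choose 2) = int n * (int n - 1)"
  proof (induction n)
    case (Suc n)
    then show ?case using tri_add[of n] by (simp add: algebra_simps)
  qed simp
  moreover have "int n * (2 * int c) \<le> int n * (int n - 1)"
    using True by (intro mult_left_mono) auto
  moreover have "int n * (2 * int c) = 2 * (int c * int n)" by simp
  ultimately have "int c * int n \<le> int (n choose 2)" by linarith
  moreover have "0 \<le> int c * (2 * int c + 1)" by simp
  ultimately show ?thesis by linarith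
next
  case False
  then have "int c * int n \<le> int c * (2 * int c + 1)"
    by (intro mult_left_mono) auto
  then show ?thesis by simp
qed

lemma minus_one_power_fls_subdegree:
  "0 \<le> fls_subdegree u \<Longrightarrow> 0 \<le> fls_subdegree ((- 1) ^ n * u :: 'a::field fls)"
  by (cases "even n") auto

lemma loc_finite_gaussian:
  assumes "\<And>n. 0 \<le> fls_subdegree (u n)"
  shows "loc_finite (\<lambda>n. qpow (int (n choose 2) + int n * s) * u n) UNIV"
  unfolding loc_finite_def
proof
  fix K
  \<comment> \<open>With this slope c + s is at least 1, so the exponent is at least n - C whatever
    the sign of \<open>s\<close>.\<close>
  define c where "c = nat \<bar>s\<bar> + 1"
  define C where "C = int c * (2 * int c + 1)"
  have "fls_vanishes K (qpow (int (n choose 2) + int n * s) * u n)" if "n > nat (K + C)" for n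
  proof (rule fls_vanishes_qpow_mult[OF _ assms])
    have "int n * 1 \<le> int n * (int c + s)"
      by (intro mult_left_mono) (auto simp: c_def)
    then have "int n \<le> int c * int n + int n * s" by (simp add: algebra_simps)
    then show "K < int (n choose 2) + int n * s"
      using binomial_2_ge[of c n] that by (simp add: C_def)
  qed
  then have "{n \<in> UNIV. \<not> fls_vanishes K (qpow (int (n choose 2) + int n * s) * u n)} \<subseteq> {..nat (K + C)}"
    by (auto simp: not_less[symmetric])
  then show "finite {n \<in> UNIV. \<not> fls_vanishes K (qpow (int (n choose 2) + int n * s) * u n)}"
    using finite_subset by blast
qed

text \<open>The summand of Euler's expansion of (z;q)_inf at z = q^s. Nonpositive \<open>s\<close>
  is allowed; the product then contains the factor 1 - q^0 and vanishes.\<close>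

definition euler_term :: "int \<Rightarrow> nat \<Rightarrow> rat fls" where
  "euler_term s n = qpow (int (n choose 2) + int n * s) * ((- 1) ^ n * iqpoch (int n))"

lemma loc_finite_euler_term: "loc_finite (euler_term s) UNIV"
  unfolding euler_term_def
  by (rule loc_finite_gaussian) (simp add: minus_one_power_fls_subdegree)

text \<open>The functional equation (z;q)_inf = (1 - z) (qz;q)_inf, termwise: the factor 1 - q^(n+1)
  that the difference produces cancels the last factor of (q)_(n+1).\<close>

lemma euler_term_diff: "euler_term s (Suc n) - euler_term (s + 1) (Suc n) = - qpow s * euler_term (s + 1) n"
proof -
  have rec: "iqpoch (int (Suc n)) - qpow (int (Suc n)) * iqpoch (int (Suc n)) = iqpoch (int n)"
    using iqpoch_rec[of "int (Suc n)"] by (simp add: algebra_simps)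
  define e where "e = int (Suc n choose 2) + int (Suc n) * s"
  have e1: "int (Suc n choose 2) + int (Suc n) * (s + 1) = e + int (Suc n)"
    by (simp add: e_def algebra_simps)
  have e2: "e = s + (int (n choose 2) + int n * (s + 1))"
    using tri_add[of n] by (simp add: e_def algebra_simps)
  have "euler_term s (Suc n) - euler_term (s + 1) (Suc n) =
    qpow e * ((- 1) ^ Suc n * (iqpoch (int (Suc n)) - qpow (int (Suc n)) * iqpoch (int (Suc n))))"
    unfolding euler_term_def e1 unfolding e_def[symmetric] qpow_add by (simp add: algebra_simps)
  also have "\<dots> = - qpow s * euler_term (s + 1) n"
    unfolding rec e2 qpow_add euler_term_def by simp
  finally show ?thesis .
qed

lemma lf_sum_euler_term_step:
  assumes "lf_sum (euler_term (s + 1)) UNIV e"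
  shows "lf_sum (euler_term s) UNIV ((1 - qpow s) * e)"
proof -
  have "lf_sum (\<lambda>n. euler_term s (Suc n) - euler_term (s + 1) (Suc n)) UNIV (- qpow s * e)"
    unfolding euler_term_diff by (rule lf_sum_cmult[OF assms])
  then have "lf_sum (\<lambda>n. euler_term s n - euler_term (s + 1) n) {0<..} (- qpow s * e)"
    by (subst lf_sum_reindex_iff[OF bij_betw_Suc_greaterThan_0, symmetric])
  then have "lf_sum (\<lambda>n. euler_term s n - euler_term (s + 1) n) UNIV (- qpow s * e)"
    by (subst (asm) lf_sum_mono_neutral[of _ UNIV]) (auto simp: euler_term_def)
  from lf_sum_add[OF this assms] show ?thesis
    by (simp add: algebra_simps)
qed

text \<open>Both sides satisfy E(s) = (1 - q^s) E(s+1) and tend to 1 as s grows. Their difference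
  \<open>D\<close> is arbitrarily small for large s, hence zero for s >= 1, and the recursion
  carries this zero down to all integers.\<close>

lemma lf_sum_euler_term: "lf_sum (euler_term s) UNIV (qinf * iqpoch (s - 1))"
proof -
  have "\<forall>s. \<exists>t. lf_sum (euler_term s) UNIV t"
    using loc_finite_imp_lf_sum[OF loc_finite_euler_term] by blast
  then obtain e where e: "\<And>s. lf_sum (euler_term s) UNIV (e s)"
    by metis
  define D where "D s = e s - qinf * iqpoch (s - 1)" for s
  have e_rec: "e s = (1 - qpow s) * e (s + 1)" for s
    using lf_sum_unique[OF e lf_sum_euler_term_step[OF e]] .
  have D_rec: "D s = (1 - qpow s) * D (s + 1)" for s
  proof -
    have "D s = (1 - qpow s) * e (s + 1) - qinf * ((1 - qpow s) * iqpoch s)"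
      unfolding D_def iqpoch_rec using e_rec[of s] by simp
    then show ?thesis by (simp add: D_def right_diff_distrib mult.left_commute)
  qed
  have far: "fls_vanishes K (D s)" if s: "K + 1 \<le> s" "1 \<le> s" for K s
  proof -
    obtain F where F: "finite F" "F \<subseteq> UNIV"
      "\<And>G. finite G \<Longrightarrow> F \<subseteq> G \<Longrightarrow> G \<subseteq> UNIV \<Longrightarrow> fls_vanishes K (e s - sum (euler_term s) G)"
      using e by (rule lf_sumE[where K = K]) blast
    define G where "G = F - {0}"
    have "fls_vanishes K (e s - sum (euler_term s) (insert 0 G))"
      by (rule F(3)) (use F(1) in \<open>auto simp: G_def\<close>)
    then have "fls_vanishes K (e s - (euler_term s 0 + sum (euler_term s) G))"
      using F(1) by (subst (asm) sum.insert) (auto simp: G_def)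
    moreover have "fls_vanishes K (sum (euler_term s) G)"
    proof (rule fls_vanishes_sum)
      fix n assume "n \<in> G"
      then have "1 \<le> int n" by (auto simp: G_def)
      then have "1 * s \<le> int n * s" using s by (intro mult_right_mono) auto
      then have "K < int (n choose 2) + int n * s" using s by linarith
      then show "fls_vanishes K (euler_term s n)"
        unfolding euler_term_def
        by (intro fls_vanishes_qpow_mult minus_one_power_fls_subdegree) auto
    qed
    ultimately have "fls_vanishes K (e s - euler_term s 0)"
      using fls_vanishes_add by fastforce
    then have e1: "fls_vanishes K (e s - 1)" by (simp add: euler_term_def numeral_2_eq_2)
    have "fls_vanishes K (inverse qinf - iqpoch (s - 1))"
      by (rule iqpoch_tendsto) (use s in auto)
    then have "fls_vanishes (K + 0) (qinf * (inverse qinf - iqpoch (s - 1)))"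
      by (rule fls_vanishes_mult) simp
    then have "fls_vanishes K (1 - qinf * iqpoch (s - 1))"
      by (simp add: right_diff_distrib)
    from fls_vanishes_add[OF e1 this] show ?thesis by (simp add: D_def)
  qed
  \<comment> \<open>Passing from s to s - 1 multiplies \<open>D\<close> by 1 - q^(s-1), which has
    order at least 0 while s - 1 >= 1, so the precision of \<open>far\<close> is not lost on the way
    down.\<close>
  have near: "fls_vanishes K (D s)" if "1 \<le> s" for K s
  proof (cases "K + 1 \<le> s")
    case False
    then have "s \<le> K + 1" by simp
    then show ?thesis using that
    proof (induction rule: int_le_induct)
      case base
      then show ?case using far by simp
    next
      case (step i)
      have "0 \<le> fls_subdegree (1 - qpow (i - 1) :: rat fls)"
        by (cases "1 - qpow (i - 1) = (0 :: rat fls)")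
          (use step.prems in \<open>auto simp: fls_nth_qpow intro!: fls_subdegree_geI\<close>)
      then have "fls_vanishes (K + 0) ((1 - qpow (i - 1)) * D i)"
        using step by (intro fls_vanishes_mult) auto
      then show ?case using D_rec[of "i - 1"] by simp
    qed
  qed (use far that in simp)
  have pos: "D s = 0" if "1 \<le> s" for s
    by (rule fls_eq_if_vanishes) (use near[OF that] in simp)
  have "D s = 0"
  proof (cases "1 \<le> s")
    case False
    then have "s \<le> 1" by simp
    then show ?thesis
    proof (induction rule: int_le_induct)
      case base
      then show ?case using pos by simp
    next
      case (step i)
      then show ?case using D_rec[of "i - 1"] by simp
    qed
  qed (use pos in simp)
  then show ?thesis using e[of s] by (simp add: D_def)
qed

text \<open>
  Expanding \<open>1 / (q)\<^bsub>x-M\<^esub>\<close> by Euler's identity and summing over \<open>x\<close> first turns the left-hand sum into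
  the right-hand one.
\<close>

lemma diagonal_sum:
  obtains H where
    "lf_sum (\<lambda>x. (qpow (int x - int N) * iqpoch (int x - int N)) * iqpoch (int x - int M)) UNIV H"
    "lf_sum (\<lambda>A. (qpow (int A * int N) * inverse qinf) *
       ((- 1) ^ A * qpow (int ((A + 1) choose 2)) * (qpow (- int A * int M) * inverse qinf))) UNIV H"
proof -
  define h where "h A = (qpow (int A * int N) * inverse qinf) *
       ((- 1) ^ A * qpow (int ((A + 1) choose 2)) * (qpow (- int A * int M) * inverse qinf))" for A
  \<comment> \<open>The expansion of 1/(q)_(x-M) is \<open>lf_sum_euler_term\<close> at s = x - M +
    1, divided by (q)_inf. It also holds for x < M, where the value is 0.\<close>
  define f where "f x A = (qpow (int x - int N) * iqpoch (int x - int N)) * inverse qinf *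
       euler_term (int x - int M + 1) A" for x A
  have h_alt: "h A = qpow (int (A choose 2) + int A * (int N - int M + 1)) *
      ((- 1) ^ A * (inverse qinf * inverse qinf))" for A
  proof -
    have "int (A choose 2) + int A * (int N - int M + 1) =
      int A * int N + int ((A + 1) choose 2) + - int A * int M"
      unfolding tri_add by (simp add: algebra_simps)
    then show ?thesis
      by (simp only: h_def qpow_add) (simp add: mult_ac)
  qed
  have "loc_finite h UNIV"
    unfolding h_alt[abs_def]
    by (rule loc_finite_gaussian) (intro minus_one_power_fls_subdegree, simp)
  then obtain H where H: "lf_sum h UNIV H"
    by (rule loc_finite_imp_lf_sum)
  have inner_x: "lf_sum (f x) UNIV (qpow (int x - int N) * iqpoch (int x - int N) * iqpoch (int x - int M))" for x
  proof -
    have "lf_sum (f x) UNIV ((qpow (int x - int N) * iqpoch (int x - int N)) * inverse qinf *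
       (qinf * iqpoch (int x - int M + 1 - 1)))"
      unfolding f_def by (rule lf_sum_cmult[OF lf_sum_euler_term])
    moreover have "inverse qinf * (qinf * u) = u" for u
      by (simp add: mult.assoc[symmetric])
    ultimately show ?thesis by (simp add: mult.assoc)
  qed
  have inner_A: "lf_sum (\<lambda>x. f x A) UNIV (h A)" for A
  proof -
    define c where "c = qpow (int (A choose 2) + int A * (int N - int M + 1)) *
       ((- 1) ^ A * iqpoch (int A)) * inverse qinf"
    \<comment> \<open>Only x >= N contributes. For x = N + k the exponent splits into a part free of
      k and k(A + 1), so the sum over k is \<open>euler_reciprocal\<close>; its factor (q)_A cancels
      the 1/(q)_A in \<open>c\<close>.\<close>
    have f_shift: "f (N + k) A = c * (qpow (int k * (int A + 1)) * iqpoch (int k))" for k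
    proof -
      have "int (N + k) - int N + (int (A choose 2) + int A * (int (N + k) - int M + 1)) =
         (int (A choose 2) + int A * (int N - int M + 1)) + int k * (int A + 1)"
        by (simp add: algebra_simps)
      from arg_cong[OF this, of "qpow :: int \<Rightarrow> rat fls"] show ?thesis
        unfolding f_def euler_term_def c_def qpow_add
        by (simp add: mult_ac)
    qed
    have "lf_sum (\<lambda>k. f (N + k) A) UNIV (c * (qfacl A * inverse qinf))"
      unfolding f_shift by (rule lf_sum_cmult[OF euler_reciprocal])
    moreover have "bij_betw (\<lambda>k. N + k) UNIV {N..}"
      by (auto simp: bij_betw_def inj_on_def image_iff le_iff_add)
    ultimately have "lf_sum (\<lambda>x. f x A) {N..} (c * (qfacl A * inverse qinf))"
      by (subst lf_sum_reindex_iff[symmetric])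
    then have "lf_sum (\<lambda>x. f x A) UNIV (c * (qfacl A * inverse qinf))"
      by (subst (asm) lf_sum_mono_neutral[of _ UNIV]) (auto simp: f_def)
    moreover have "c * (qfacl A * inverse qinf) = h A"
      by (simp add: c_def h_alt iqpoch_of_nat)
    ultimately show ?thesis by simp
  qed
  have "loc_finite (\<lambda>(x, A). f x A) (UNIV \<times> UNIV)"
    unfolding loc_finite_def
  proof
    fix K
    \<comment> \<open>The slope M + 1 in \<open>binomial_2_ge\<close> outweighs q^(-AM) uniformly in
      x, so for x >= N the exponent is at least (x - N) + A - C, which bounds both indices.\<close>
    define C where "C = int (M + 1) * (2 * int (M + 1) + 1)"
    define B where "B = nat (K + int N + C)"
    have "fls_vanishes K (f x A)" if "x > B \<or> A > B" for x A
    proof (cases "x < N")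
      case False
      define e where "e = int x - int N + (int (A choose 2) + int A * (int x - int M + 1))"
      have bound: "a - c \<le> t + a * (y - k + 1)"
        if "0 \<le> a" "0 \<le> a * y" "t \<ge> (k + 1) * a - c" for a c t y k :: int
        using that by (simp add: algebra_simps)
      have "int (A choose 2) + int A * (int x - int M + 1) \<ge> int A - C"
        by (rule bound) (use binomial_2_ge[of "M + 1" A] in \<open>simp_all add: C_def add.commute\<close>)
      then have "K < e"
        using that False by (auto simp: e_def B_def)
      then have "fls_vanishes K (qpow e * (iqpoch (int x - int N) * inverse qinf * ((- 1) ^ A * iqpoch (int A))))"
        by (rule fls_vanishes_qpow_mult)
          (intro fls_subdegree_mult_nonneg minus_one_power_fls_subdegree, simp_all)
      moreover have "f x A = qpow e * (iqpoch (int x - int N) * inverse qinf * ((- 1) ^ A * iqpoch (int A)))"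
        unfolding f_def euler_term_def e_def qpow_add by (simp add: mult_ac)
      ultimately show ?thesis by simp
    qed (simp add: f_def)
    then have "{p \<in> UNIV \<times> UNIV. \<not> fls_vanishes K (case p of (x, A) \<Rightarrow> f x A)} \<subseteq> {..B} \<times> {..B}"
      by (auto simp: not_less[symmetric])
    then show "finite {p \<in> UNIV \<times> UNIV. \<not> fls_vanishes K (case p of (x, A) \<Rightarrow> f x A)}"
      by (rule finite_subset) simp
  qed
  then have "lf_sum (\<lambda>x. qpow (int x - int N) * iqpoch (int x - int N) * iqpoch (int x - int M)) UNIV H"
    by (rule lf_sum_swap[OF _ inner_x inner_A H])
  then show ?thesis
    using that[of H] H unfolding h_def by simp
qed

section \<open>Determinants and sums\<close>

abbreviation det_of :: "nat \<Rightarrow> (nat \<Rightarrow> nat \<Rightarrow> 'a) \<Rightarrow> 'a::comm_ring_1" where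
  "det_of n F \<equiv> Determinant.det (mat n n (\<lambda>(k, l). F k l))"

lemma det_of_leibniz:
  "det_of n F = (\<Sum>p | p permutes {..<n}. signof p * (\<Prod>k<n. F k (p k)))"
proof -
  have "(\<Prod>k<n. mat n n (\<lambda>(k, l). F k l) $$ (k, p k)) = (\<Prod>k<n. F k (p k))"
    if "p permutes {..<n}" for p
    using permutes_in_image[OF that] by (intro prod.cong) auto
  moreover have "det_of n F =
      (\<Sum>p | p permutes {..<n}. signof p * (\<Prod>k<n. mat n n (\<lambda>(k, l). F k l) $$ (k, p k)))"
    unfolding atLeast0LessThan[symmetric] by (rule det_def') simp
  ultimately show ?thesis by simp
qed

lemma det_of_cong:
  "(\<And>k l. k < n \<Longrightarrow> l < n \<Longrightarrow> F k l = G k l) \<Longrightarrow> det_of n F = det_of n G"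
  by (intro arg_cong[of _ _ Determinant.det] eq_matI) auto

lemma det_of_scale:
  fixes F :: "nat \<Rightarrow> nat \<Rightarrow> 'a::comm_ring_1"
  shows "det_of n (\<lambda>k l. a k * F k l * b l) = (\<Prod>k<n. a k) * (\<Prod>k<n. b k) * det_of n F"
proof -
  have "signof p * (\<Prod>k<n. a k * F k (p k) * b (p k)) =
      (\<Prod>k<n. a k) * (\<Prod>k<n. b k) * (signof p * (\<Prod>k<n. F k (p k)))"
    if "p permutes {..<n}" for p
    using prod.permute[OF that, of b] by (simp add: prod.distrib mult_ac o_def)
  then show ?thesis
    unfolding det_of_leibniz sum_distrib_left by (intro sum.cong) auto
qed

text \<open>All the differences at once are a left multiplication by the unitriangular matrix
  \<open>U\<close>. The last row has no successor and stays as it is.\<close>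

lemma det_of_row_differences:
  fixes G :: "nat \<Rightarrow> nat \<Rightarrow> 'a::{idom,ring_char_0}"
  shows "det_of n (\<lambda>k l. if c \<le> k \<and> Suc k < n then G k l - G (Suc k) l else G k l) = det_of n G"
    (is "det_of n ?F = _")
proof -
  define U where "U = mat n n (\<lambda>(i, j). if i = j then 1 else if j = Suc i \<and> c \<le> i then - 1 else (0 :: 'a))"
  have "mat n n (\<lambda>(k, l). ?F k l) = U * mat n n (\<lambda>(k, l). G k l)"
  proof (rule eq_matI)
    fix i j assume "i < dim_row (U * mat n n (\<lambda>(k, l). G k l))" "j < dim_col (U * mat n n (\<lambda>(k, l). G k l))"
    then have ij: "i < n" "j < n" by (auto simp: U_def)
    have "(U * mat n n (\<lambda>(k, l). G k l)) $$ (i, j) =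
        (\<Sum>k<n. (if k = i then G i j else 0) + (if k = Suc i then if c \<le> i then - G (Suc i) j else 0 else 0))"
    proof -
      have "(U * mat n n (\<lambda>(k, l). G k l)) $$ (i, j) =
          (\<Sum>k<n. (if i = k then 1 else if k = Suc i \<and> c \<le> i then - 1 else 0) * G k j)"
        using ij by (simp add: U_def scalar_prod_def atLeast0LessThan)
      then show ?thesis by (simp only:) (rule sum.cong, auto)
    qed
    also have "\<dots> = ?F i j"
      using ij by (simp add: sum.distrib)
    finally show "mat n n (\<lambda>(k, l). ?F k l) $$ (i, j) = (U * mat n n (\<lambda>(k, l). G k l)) $$ (i, j)"
      using ij by simp
  qed (auto simp: U_def)
  moreover have "det U = 1"
  proof -
    have "upper_triangular U" by (auto simp: U_def upper_triangular_def)
    then have "det U = prod_list (diag_mat U)"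
      by (rule det_upper_triangular[where n = n]) (simp add: U_def)
    also have "diag_mat U = map (\<lambda>_. 1) [0..<n]"
      by (auto simp: diag_mat_def U_def)
    finally show ?thesis by (simp add: map_replicate_const)
  qed
  ultimately show ?thesis
    by (simp add: det_mult[of _ n] U_def)
qed

text \<open>The n - i rows from \<open>i\<close> on are supported on only n - i - 1 columns, so by
  the pigeonhole principle every Leibniz term meets a zero.\<close>

lemma det_of_zero_block:
  assumes "i < n" "\<And>k l. i \<le> k \<Longrightarrow> k < n \<Longrightarrow> l \<le> i \<Longrightarrow> F k l = 0"
  shows "det_of n F = (0 :: 'a::idom)"
proof -
  have "(\<Prod>k<n. F k (p k)) = 0" if p: "p permutes {..<n}" for p
  proof -
    have "\<exists>k. i \<le> k \<and> k < n \<and> p k \<le> i"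
    proof (rule ccontr)
      assume "\<not> ?thesis"
      then have "p ` {i..<n} \<subseteq> {Suc i..<n}"
        using permutes_in_image[OF p] by (auto simp: not_le)
      moreover have "card (p ` {i..<n}) = n - i"
        using permutes_inj[OF p] by (simp add: card_image inj_on_subset)
      ultimately show False
        using card_mono[of "{Suc i..<n}" "p ` {i..<n}"] assms(1) by simp
    qed
    then show ?thesis using assms(2) by (auto intro!: prod_zero)
  qed
  then show ?thesis unfolding det_of_leibniz by (intro sum.neutral) simp
qed

text \<open>Multilinearity: each row of \<open>I\<close> has a variable of its own, and a Leibniz
  term takes exactly one factor from each row, so the sum over tuples enters row by row.\<close>

lemma lf_sum_det_of:
  fixes f :: "nat \<Rightarrow> 'b \<Rightarrow> nat \<Rightarrow> 'a::comm_ring_1 fls"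
  assumes I: "I \<subseteq> {..<n}" and f: "\<And>k l. k \<in> I \<Longrightarrow> l < n \<Longrightarrow> lf_sum (\<lambda>y. f k y l) (S k) (F k l)"
  shows "lf_sum (\<lambda>y. det_of n (\<lambda>k l. if k \<in> I then f k (y k) l else F k l)) (PiE I S) (det_of n F)"
  unfolding det_of_leibniz
proof (rule lf_sum_sum)
  fix p assume "p \<in> {p. p permutes {..<n}}"
  then have p: "p k < n" if "k < n" for k
    using permutes_in_image[of p "{..<n}" k] that by simp
  have split: "prod h {..<n} = prod h ({..<n} - I) * prod h I" for h :: "nat \<Rightarrow> 'a fls"
    using I by (simp add: prod.subset_diff)
  have "lf_sum (\<lambda>y. \<Prod>k\<in>I. f k (y k) (p k)) (PiE I S) (\<Prod>k\<in>I. F k (p k))"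
    using I p by (intro lf_sum_prod_PiE f finite_subset[OF I]) auto
  from lf_sum_cmult[OF this, of "signof p * (\<Prod>k\<in>{..<n} - I. F k (p k))"]
  show "lf_sum (\<lambda>y. signof p * (\<Prod>k<n. if k \<in> I then f k (y k) (p k) else F k (p k))) (PiE I S)
          (signof p * (\<Prod>k<n. F k (p k)))"
    by (simp add: split mult.assoc)
qed

section \<open>Products of two determinants summed over decreasing tuples\<close>

lemma permutes_shift:
  fixes a :: nat
  assumes "p permutes {..<r}"
  defines "p' \<equiv> \<lambda>k. if k < a then k else a + p (k - a)"
  shows "p' permutes {0..<a + r}" "sign p' = sign p"
proof -
  have "(\<lambda>k. if k < a then k else a + p (k - a)) permutes {0..<a + r} \<and>
      sign (\<lambda>k. if k < a then k else a + p (k - a)) = sign p"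
    using assms(1) finite_lessThan
  proof (induction rule: permutes_induct)
    case id
    have "(\<lambda>k. if k < a then k else a + id (k - a)) = id" by auto
    then show ?case by (simp add: permutes_id)
  next
    case (swap x y p)
    let ?p' = "\<lambda>k. if k < a then k else a + p (k - a)"
    \<comment> \<open>Shifting turns the transposition of x and y into that of a + x and a + y, so
      the signs agree by induction over transpositions.\<close>
    have eq: "(\<lambda>k. if k < a then k else a + (Transposition.transpose x y \<circ> p) (k - a)) =
        Transposition.transpose (a + x) (a + y) \<circ> ?p'"
      by (auto simp: Transposition.transpose_def fun_eq_iff)
    have t: "Transposition.transpose (a + x) (a + y) permutes {0..<a + r}"
      using swap by (intro permutes_swap_id) auto
    have p': "?p' permutes {0..<a + r}" "sign ?p' = sign p"
      using swap by auto
    have "permutation p" using swap by (meson finite_lessThan permutation_permutes)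
    then have "sign (Transposition.transpose x y \<circ> p) = sign (Transposition.transpose x y) * sign p"
      by (intro sign_compose permutation_swap_id)
    moreover have "permutation ?p'" using p' by (meson finite_atLeastLessThan permutation_permutes)
    then have "sign (Transposition.transpose (a + x) (a + y) \<circ> ?p') =
        sign (Transposition.transpose (a + x) (a + y)) * sign ?p'"
      by (intro sign_compose permutation_swap_id)
    ultimately have sgn: "sign (Transposition.transpose (a + x) (a + y) \<circ> ?p') =
        sign (Transposition.transpose x y \<circ> p)"
      by (simp only: p' sign_swap_id) simp
    show ?case
      unfolding eq by (rule conjI[OF permutes_compose[OF p'(1) t] sgn])
  qed
  then show "p' permutes {0..<a + r}" "sign p' = sign p"
    by (auto simp: p'_def)
qed

text \<open>The common shape of all determinants to be compared: \<open>a\<close> rows fixed by the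
  infinite entries, on top of \<open>r\<close> rows that depend on the entries of a tuple.\<close>

definition stacked_det :: "nat \<Rightarrow> nat \<Rightarrow> (nat \<Rightarrow> nat \<Rightarrow> 'a) \<Rightarrow> (nat \<Rightarrow> nat \<Rightarrow> 'a) \<Rightarrow> 'a::comm_ring_1" where
  "stacked_det a r u f = det_of (a + r) (\<lambda>k l. if k < a then u k l else f (k - a) l)"

lemma stacked_det_cong:
  "(\<And>k l. k < a \<Longrightarrow> l < a + r \<Longrightarrow> u k l = u' k l) \<Longrightarrow> (\<And>k l. k < r \<Longrightarrow> l < a + r \<Longrightarrow> f k l = f' k l) \<Longrightarrow>
   stacked_det a r u f = stacked_det a r u' f'"
  unfolding stacked_det_def by (intro det_of_cong) auto

lemma stacked_det_permute:
  assumes "p permutes {..<r}"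
  shows "stacked_det a r u (\<lambda>t. f (p t)) = signof p * stacked_det a r u f"
proof -
  let ?A = "mat (a + r) (a + r) (\<lambda>(k, l). if k < a then u k l else f (k - a) l)"
  let ?p = "\<lambda>k. if k < a then k else a + p (k - a)"
  have lt: "?p k < a + r" if "k < a + r" for k
    using permutes_in_image[OF permutes_shift(1)[OF assms, of a], of k] that by simp
  have "stacked_det a r u (\<lambda>t. f (p t)) = det (mat (a + r) (a + r) (\<lambda>(i, j). ?A $$ (?p i, j)))"
    unfolding stacked_det_def using lt by (intro arg_cong[of _ _ Determinant.det] eq_matI) auto
  also have "\<dots> = signof ?p * det ?A"
    by (rule det_permute_rows) (use permutes_shift(1)[OF assms] in auto)
  finally show ?thesis
    by (simp add: stacked_det_def permutes_shift(2)[OF assms])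
qed

lemma stacked_det_eq_0:
  assumes "s < r" "t < r" "s \<noteq> t" "f s = f t"
  shows "stacked_det a r u f = 0"
  unfolding stacked_det_def
  by (rule det_identical_rows[of _ "a + r" "a + s" "a + t"]) (use assms in auto)

lemma prod_lessThan_add: "prod h {..<a + r} = prod h {..<a} * (\<Prod>t<r. h (a + t :: nat))"
  for h :: "nat \<Rightarrow> 'a::comm_monoid_mult"
  by (induction r) (simp_all add: mult.assoc)

lemma stacked_det_leibniz:
  "stacked_det a r u f =
    (\<Sum>p | p permutes {..<a + r}. signof p * (\<Prod>k<a. u k (p k)) * (\<Prod>t<r. f t (p (a + t))))"
  unfolding stacked_det_def det_of_leibniz prod_lessThan_add by (simp add: mult.assoc)

text \<open>The outcome of an Andreief (continuous Cauchy-Binet) computation, with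
  \<open>H l l'\<close> the pairing of column l with column l'. What matters is only that the
  varying rows enter through \<open>H\<close> alone.\<close>

definition pairing_value ::
    "nat \<Rightarrow> nat \<Rightarrow> nat \<Rightarrow> (nat \<Rightarrow> nat \<Rightarrow> 'a) \<Rightarrow> (nat \<Rightarrow> nat \<Rightarrow> 'a) \<Rightarrow> (nat \<Rightarrow> nat \<Rightarrow> 'a) \<Rightarrow> 'a::comm_ring_1" where
  "pairing_value a b r u v H =
    (\<Sum>p | p permutes {..<a + r}. \<Sum>p' | p' permutes {..<b + r}.
      (signof p * (\<Prod>k<a. u k (p k)) * (signof p' * (\<Prod>k<b. v k (p' k)))) *
      (\<Prod>t<r. H (p (a + t)) (p' (b + t))))"

text \<open>After both Leibniz expansions the variable \<open>y t\<close> occurs in exactly one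
  factor of each determinant, so the sum over independent coordinates is a product of
  pairings.\<close>

lemma lf_sum_stacked_det_tuples:
  fixes f g :: "'b \<Rightarrow> nat \<Rightarrow> 'a::comm_ring_1 fls"
  assumes H: "\<And>l l'. l < a + r \<Longrightarrow> l' < b + r \<Longrightarrow> lf_sum (\<lambda>x. f x l * g x l') S (H l l')"
  shows "lf_sum (\<lambda>y. stacked_det a r u (\<lambda>t. f (y t)) * stacked_det b r v (\<lambda>t. g (y t)))
    ({..<r} \<rightarrow>\<^sub>E S) (pairing_value a b r u v H)"
proof -
  have "stacked_det a r u (\<lambda>t. f (y t)) * stacked_det b r v (\<lambda>t. g (y t)) =
    (\<Sum>p | p permutes {..<a + r}. \<Sum>p' | p' permutes {..<b + r}.
      (signof p * (\<Prod>k<a. u k (p k)) * (signof p' * (\<Prod>k<b. v k (p' k)))) *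
      (\<Prod>t<r. f (y t) (p (a + t)) * g (y t) (p' (b + t))))" for y
    unfolding stacked_det_leibniz sum_product prod.distrib by (simp add: mult_ac)
  moreover have "lf_sum (\<lambda>y. \<Sum>p | p permutes {..<a + r}. \<Sum>p' | p' permutes {..<b + r}.
      (signof p * (\<Prod>k<a. u k (p k)) * (signof p' * (\<Prod>k<b. v k (p' k)))) *
      (\<Prod>t<r. f (y t) (p (a + t)) * g (y t) (p' (b + t)))) ({..<r} \<rightarrow>\<^sub>E S) (pairing_value a b r u v H)"
    unfolding pairing_value_def
  proof (intro lf_sum_sum lf_sum_cmult lf_sum_prod_PiE H)
    fix p p' t assume "p \<in> {p. p permutes {..<a + r}}" "p' \<in> {p. p permutes {..<b + r}}" "t \<in> {..<r}"
    then show "p (a + t) < a + r" "p' (b + t) < b + r"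
      using permutes_in_image[of p "{..<a + r}" "a + t"] permutes_in_image[of p' "{..<b + r}" "b + t"] by auto
  qed simp
  ultimately show ?thesis by simp
qed

lemma decreasing_tuplesD:
  assumes "A \<in> decreasing_tuples r"
  shows "length A = r" "distinct A" "inj_on ((!) A) {..<r}" "(!) A ` {..<r} = set A"
    "\<And>s t. s < t \<Longrightarrow> t < r \<Longrightarrow> A ! t < A ! s"
proof -
  from assms have *: "length A = r" "sorted_wrt (>) A"
    by (auto simp: decreasing_tuples_def)
  then show "length A = r" "\<And>s t. s < t \<Longrightarrow> t < r \<Longrightarrow> A ! t < A ! s"
    by (auto simp: sorted_wrt_iff_nth_less)
  show "distinct A"
    using *(2) by (simp add: distinct_conv_nth sorted_wrt_iff_nth_less) (metis nat_neq_iff)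
  then show "inj_on ((!) A) {..<r}"
    using *(1) by (simp add: inj_on_nth)
  show "(!) A ` {..<r} = set A"
    using *(1) by (auto simp: set_conv_nth)
qed

lemma decreasing_tuples_eqI:
  assumes "A \<in> decreasing_tuples r" "B \<in> decreasing_tuples r" "set A = set B"
  shows "A = B"
proof -
  have "sorted_wrt (<) (rev A)" "sorted_wrt (<) (rev B)"
    using assms(1,2) by (auto simp: decreasing_tuples_def sorted_wrt_rev)
  then have "rev A = rev B"
    using assms(3) by (intro strict_sorted_equal) auto
  then show ?thesis by simp
qed

lemma decreasing_tuples_exists:
  assumes "finite X" "card X = r"
  obtains A where "A \<in> decreasing_tuples r" "set A = X"
  using that[of "rev (sorted_list_of_set X)"] assms
  by (auto simp: decreasing_tuples_def sorted_wrt_rev)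

text \<open>An injective tuple amounts to its set of values, listed in decreasing order, and the
  permutation that restores the given order.\<close>

lemma bij_betw_decreasing_tuples_permutations:
  "bij_betw (\<lambda>(A, p). \<lambda>t\<in>{..<r}. A ! p t) (decreasing_tuples r \<times> {p. p permutes {..<r}})
    {y \<in> {..<r} \<rightarrow>\<^sub>E UNIV. inj_on y {..<r}}" (is "bij_betw ?h ?D ?T")
proof (rule bij_betw_imageI)
  have img: "?h (A, p) ` {..<r} = set A" if "A \<in> decreasing_tuples r" "p permutes {..<r}" for A p
  proof -
    have "?h (A, p) ` {..<r} = (!) A ` p ` {..<r}" by auto
    then show ?thesis
      using decreasing_tuplesD(4)[OF that(1)] permutes_image[OF that(2)] by simp
  qed
  show "inj_on ?h ?D"
  proof (rule inj_onI, clarify)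
    fix A p B p'
    assume A: "A \<in> decreasing_tuples r" "B \<in> decreasing_tuples r"
      and p: "p permutes {..<r}" "p' permutes {..<r}"
      and eq: "(\<lambda>t\<in>{..<r}. A ! p t) = (\<lambda>t\<in>{..<r}. B ! p' t)"
    have "set A = set B"
      using img[OF A(1) p(1)] img[OF A(2) p(2)] eq by simp
    with A have AB: "A = B" by (rule decreasing_tuples_eqI)
    have "p t = p' t" for t
    proof (cases "t < r")
      case True
      then have "A ! p t = A ! p' t"
        using fun_cong[OF eq, of t] AB by simp
      moreover have "p t < r" "p' t < r"
        using permutes_in_image[OF p(1), of t] permutes_in_image[OF p(2), of t] True by auto
      ultimately show ?thesis
        using decreasing_tuplesD(3)[OF A(1)] by (auto dest: inj_onD)
    next
      case False
      then show ?thesis using p by (auto simp: permutes_def)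
    qed
    with AB show "A = B \<and> p = p'" by auto
  qed
  show "?h ` ?D = ?T"
  proof (intro equalityI subsetI)
    fix y assume "y \<in> ?h ` ?D"
    then obtain A p where Ap: "A \<in> decreasing_tuples r" "p permutes {..<r}" and y: "y = ?h (A, p)"
      by auto
    have "inj_on y {..<r}"
    proof (rule eq_card_imp_inj_on)
      show "card (y ` {..<r}) = card {..<r}"
        unfolding y img[OF Ap] using decreasing_tuplesD(1,2)[OF Ap(1)] by (simp add: distinct_card)
    qed simp
    then show "y \<in> ?T" by (auto simp: y)
  next
    fix y assume y: "y \<in> ?T"
    then have "card (y ` {..<r}) = r" by (simp add: card_image)
    then obtain A where A: "A \<in> decreasing_tuples r" "set A = y ` {..<r}"
      by (rule decreasing_tuples_exists[rotated]) auto
    define p where "p t = (if t < r then inv_into {..<r} ((!) A) (y t) else t)" for t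
    have "bij_betw ((!) A) {..<r} (set A)"
      using decreasing_tuplesD(3,4)[OF A(1)] by (simp add: bij_betw_def)
    then have "bij_betw (inv_into {..<r} ((!) A)) (set A) {..<r}"
      by (rule bij_betw_inv_into)
    moreover have "bij_betw y {..<r} (set A)"
      using y A(2) by (simp add: bij_betw_def)
    ultimately have "bij_betw (inv_into {..<r} ((!) A) \<circ> y) {..<r} {..<r}"
      by (rule bij_betw_trans[rotated])
    then have "bij_betw p {..<r} {..<r}"
      by (rule bij_betw_cong[THEN iffD1, rotated]) (simp add: p_def)
    then have "p permutes {..<r}"
      by (rule bij_imp_permutes) (simp add: p_def)
    moreover have "A ! p t = y t" if "t < r" for t
      using that A(2) decreasing_tuplesD(4)[OF A(1)] by (simp add: p_def f_inv_into_f)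
    then have "?h (A, p) = y"
      using y by (auto simp: PiE_def extensional_def fun_eq_iff)
    ultimately show "y \<in> ?h ` ?D"
      using A(1) by (intro image_eqI[of _ _ "(A, p)"]) auto
  qed
qed

text \<open>A repeated entry makes two rows equal, so only injective tuples count. Permuting a tuple
  changes both determinants by the same sign, so every decreasing tuple is met r! times with the
  same value.\<close>

lemma lf_sum_stacked_det:
  fixes f g :: "nat \<Rightarrow> nat \<Rightarrow> 'a::field_char_0 fls"
  assumes H: "\<And>l l'. l < a + r \<Longrightarrow> l' < b + r \<Longrightarrow> lf_sum (\<lambda>x. f x l * g x l') UNIV (H l l')"
  shows "lf_sum (\<lambda>A. stacked_det a r u (\<lambda>t. f (A ! t)) * stacked_det b r v (\<lambda>t. g (A ! t)))
    (decreasing_tuples r) (pairing_value a b r u v H / fact r)"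
proof -
  define D where "D y = stacked_det a r u (\<lambda>t. f (y t)) * stacked_det b r v (\<lambda>t. g (y t))" for y
  let ?Z = "pairing_value a b r u v H"
  let ?h = "\<lambda>(A, p). \<lambda>t\<in>{..<r}. A ! p t"
  let ?P = "{p. p permutes {..<r}}"
  have D_cong: "D y = D z" if "\<And>t. t < r \<Longrightarrow> y t = z t" for y z
    unfolding D_def using that by (intro arg_cong2[of _ _ _ _ "(*)"] stacked_det_cong) auto
  have "lf_sum D ({..<r} \<rightarrow>\<^sub>E UNIV) ?Z"
    unfolding D_def by (rule lf_sum_stacked_det_tuples[OF H])
  moreover have "D y = 0" if "\<not> inj_on y {..<r}" for y
    using that by (auto simp: inj_on_def D_def intro: stacked_det_eq_0)
  ultimately have "lf_sum D {y \<in> {..<r} \<rightarrow>\<^sub>E UNIV. inj_on y {..<r}} ?Z"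
    by (subst lf_sum_mono_neutral) auto
  then have "lf_sum (\<lambda>s. D (?h s)) (decreasing_tuples r \<times> ?P) ?Z"
    by (rule lf_sum_reindex[OF bij_betw_decreasing_tuples_permutations])
  moreover have "D (?h s) = (\<lambda>(A, p). D ((!) A)) s" if "s \<in> decreasing_tuples r \<times> ?P" for s
  proof -
    obtain A p where "s = (A, p)" by (cases s)
    with that have s: "s = (A, p)" "p permutes {..<r}" by auto
    have "D (?h s) = D (\<lambda>t. A ! p t)" by (rule D_cong) (simp add: s)
    also have "\<dots> = D ((!) A)"
      unfolding D_def
        stacked_det_permute[OF s(2), of a u "\<lambda>t. f (A ! t)"]
        stacked_det_permute[OF s(2), of b v "\<lambda>t. g (A ! t)"]
      by (simp add: sign_def)
    finally show ?thesis by (simp add: s)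
  qed
  ultimately have "lf_sum (\<lambda>(A, p). D ((!) A)) (decreasing_tuples r \<times> ?P) ?Z"
    by (rule lf_sum_cong[THEN iffD1, rotated -1]) auto
  moreover have "lf_sum (\<lambda>p. D ((!) A)) ?P (fact r * D ((!) A))" for A
    using lf_sum_finite[of ?P "\<lambda>p. D ((!) A)"]
    by (simp add: finite_permutations card_permutations[of _ r])
  ultimately have "lf_sum (\<lambda>A. fact r * D ((!) A)) (decreasing_tuples r) ?Z"
    by (rule lf_sum_Sigma)
  then have "lf_sum (\<lambda>A. inverse (fact r) * (fact r * D ((!) A))) (decreasing_tuples r) (inverse (fact r) * ?Z)"
    by (rule lf_sum_cmult)
  then show ?thesis
    by (simp add: D_def field_simps)
qed

section \<open>Arms of an array\<close>

text \<open>
  One arm of an array, read off along diagonals: \<open>b d k\<close> is the \<open>k\<close>-th largest entry of the \<open>d\<close>-th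
  diagonal, shifted so that the entries become strictly decreasing. The entries with \<open>k < c d\<close> are
  infinite, and are left undefined.
\<close>

definition arms :: "nat \<Rightarrow> (nat \<Rightarrow> nat) \<Rightarrow> (nat \<Rightarrow> nat) \<Rightarrow> (nat \<Rightarrow> nat) \<Rightarrow> (nat \<Rightarrow> nat \<Rightarrow> nat) set" where
  "arms n N c x = {b. b 0 = x \<and> (\<forall>d. b d \<in> extensional {c d..<n}) \<and>
     (\<forall>d k. c d \<le> k \<longrightarrow> k < n \<longrightarrow> b (Suc d) k \<le> b d k) \<and>
     (\<forall>d k. c (Suc d) \<le> k \<longrightarrow> Suc k < n \<longrightarrow> b d (Suc k) < b (Suc d) k) \<and>
     (\<forall>k<n. \<forall>\<^sub>F d in sequentially. b d k = N k)}"

definition fsum :: "(nat \<Rightarrow> nat) \<Rightarrow> nat" where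
  "fsum f = (\<Sum>d | f d \<noteq> 0. f d)"

text \<open>Both terms carry the same shift, so this is the entry of the array minus its limit. On
  arms the truncated subtraction is exact by \<open>arms_ge\<close>.\<close>

definition arm_excess :: "(nat \<Rightarrow> nat) \<Rightarrow> (nat \<Rightarrow> nat) \<Rightarrow> (nat \<Rightarrow> nat \<Rightarrow> nat) \<Rightarrow> nat \<Rightarrow> nat \<Rightarrow> nat" where
  "arm_excess N c b k d = (if c d \<le> k then b d k - N k else 0)"

text \<open>Counting starts at diagonal 1: the main diagonal is shared by the two arms and must be
  counted once only.\<close>

definition arm_weight :: "nat \<Rightarrow> (nat \<Rightarrow> nat) \<Rightarrow> (nat \<Rightarrow> nat) \<Rightarrow> (nat \<Rightarrow> nat \<Rightarrow> nat) \<Rightarrow> nat" where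
  "arm_weight n N c b = (\<Sum>k<n. fsum (\<lambda>d. arm_excess N c b k (Suc d)))"

text \<open>The first diagonal on which the \<open>k\<close>-th entry is finite.\<close>

definition arrival :: "(nat \<Rightarrow> nat) \<Rightarrow> nat \<Rightarrow> nat" where
  "arrival c k = (LEAST d. c d \<le> k)"

text \<open>Each counted diagonal multiplies column \<open>l\<close> by q^(-N_l). A finite row needs
  this factor for its summation; an infinite row accumulates it, once for each of the
  \<open>arrival c k - 1\<close> counted diagonals on which it is still infinite. The prefactor
  compensates for the \<open>N k\<close> of entries that carry no weight.\<close>

definition arm_gf :: "nat \<Rightarrow> (nat \<Rightarrow> nat) \<Rightarrow> (nat \<Rightarrow> nat) \<Rightarrow> (nat \<Rightarrow> nat) \<Rightarrow> rat fls" where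
  "arm_gf n N c x = qpow (\<Sum>k<c 0. int (N k) * (int (arrival c k) - 1)) *
     det_of n (\<lambda>k l. if k < c 0 then qpow (- ((int (arrival c k) - 1) * int (N l))) * inverse qinf
       else iqpoch (int (x k) - int (N l)))"

text \<open>The diagonals that may follow \<open>x\<close>. Interlacing constrains each entry
  separately, so they form a product of intervals; an entry that has just become finite has no upper
  bound.\<close>

definition arm_steps :: "nat \<Rightarrow> nat \<Rightarrow> nat \<Rightarrow> (nat \<Rightarrow> nat) \<Rightarrow> (nat \<Rightarrow> nat) set" where
  "arm_steps n c0 c1 x = PiE {c1..<n} (\<lambda>k. {y. (c0 \<le> k \<longrightarrow> y \<le> x k) \<and> (Suc k < n \<longrightarrow> x (Suc k) < y)})"

text \<open>A drop of at most one means that at most one entry becomes finite per step, so the next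
  smaller entry, if there is one, was already finite and bounds it from below.\<close>

definition pit_counts :: "nat \<Rightarrow> (nat \<Rightarrow> nat) \<Rightarrow> bool" where
  "pit_counts n c \<longleftrightarrow> c 0 \<le> n \<and> (\<forall>d. c (Suc d) \<le> c d \<and> c d \<le> Suc (c (Suc d))) \<and> (\<exists>d. c d = 0)"

definition strict_from :: "nat \<Rightarrow> nat \<Rightarrow> (nat \<Rightarrow> nat) \<Rightarrow> bool" where
  "strict_from a n x \<longleftrightarrow> (\<forall>k. a \<le> k \<longrightarrow> Suc k < n \<longrightarrow> x (Suc k) < x k)"

lemma pit_countsD:
  assumes "pit_counts n c"
  shows "c 0 \<le> n" "c (Suc d) \<le> c d" "c d \<le> Suc (c (Suc d))" "d \<le> d' \<Longrightarrow> c d' \<le> c d"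
proof -
  show *: "c 0 \<le> n" "c (Suc d) \<le> c d" "c d \<le> Suc (c (Suc d))" for d
    using assms by (auto simp: pit_counts_def)
  show "d \<le> d' \<Longrightarrow> c d' \<le> c d" for d d'
    by (rule lift_Suc_antimono_le) (use * in auto)
qed

lemma pit_counts_Suc: 
  assumes "pit_counts n c"
  shows "pit_counts n (c \<circ> Suc)"
proof -
  obtain d where "c d = 0" using assms by (auto simp: pit_counts_def)
  then have "c (Suc d) = 0" using pit_countsD(2)[OF assms, of d] by simp
  then show ?thesis
    using pit_countsD[OF assms] by (auto simp: pit_counts_def intro: order_trans)
qed

lemma strict_fromD:
  assumes "strict_from a n x" "a \<le> i" "i \<le> k" "k < n"
  shows "x k \<le> x i"
proof -
  have "x (i + e) \<le> x i" if "i + e < n" for e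
    using that
  proof (induction e)
    case (Suc e)
    then have "x (Suc (i + e)) < x (i + e)"
      using assms(1,2) by (simp add: strict_from_def)
    with Suc show ?case by simp
  qed simp
  from this[of "k - i"] show ?thesis using assms(3,4) by simp
qed

lemma arrival_eq_0: "c 0 \<le> k \<Longrightarrow> arrival c k = 0"
  unfolding arrival_def by (rule Least_equality) auto

lemma arrival_Suc:
  assumes "pit_counts n c" "k < c 0"
  shows "arrival c k = Suc (arrival (c \<circ> Suc) k)"
proof -
  obtain d where "c d = 0" using assms by (auto simp: pit_counts_def)
  then show ?thesis
    unfolding arrival_def using assms(2) by (subst Least_Suc[of _ d]) auto
qed

lemma fsum_Suc:
  assumes "finite {d. f d \<noteq> 0}"
  shows "fsum f = f 0 + fsum (f \<circ> Suc)"
proof -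
  have "{d. f d \<noteq> 0} = (if f 0 = 0 then {} else {0}) \<union> Suc ` {d. f (Suc d) \<noteq> 0}" (is "_ = ?A \<union> _")
    using not0_implies_Suc by (auto simp: image_iff) (metis not0_implies_Suc)+
  moreover have "finite {d. f (Suc d) \<noteq> 0}"
    using finite_vimageI[OF assms, of Suc] by (simp add: vimage_def)
  ultimately have "fsum f = sum f ?A + sum f (Suc ` {d. f (Suc d) \<noteq> 0})"
    unfolding fsum_def by (simp only:) (rule sum.union_disjoint, auto)
  then show ?thesis
    by (simp add: fsum_def sum.reindex o_def)
qed

lemma armsD:
  assumes "b \<in> arms n N c x"
  shows "b 0 = x" "b d \<in> extensional {c d..<n}"
    "c d \<le> k \<Longrightarrow> k < n \<Longrightarrow> b (Suc d) k \<le> b d k"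
    "c (Suc d) \<le> k \<Longrightarrow> Suc k < n \<Longrightarrow> b d (Suc k) < b (Suc d) k"
    "k < n \<Longrightarrow> \<forall>\<^sub>F d in sequentially. b d k = N k"
  using assms by (auto simp: arms_def)

text \<open>Once finite, an entry can only decrease along the diagonals, and it ends at
  \<open>N k\<close>.\<close>

lemma arms_ge:
  assumes b: "b \<in> arms n N c x" and c: "pit_counts n c" and k: "c d \<le> k" "k < n"
  shows "N k \<le> b d k"
proof -
  obtain D where D: "\<And>d. d \<ge> D \<Longrightarrow> b d k = N k"
    using armsD(5)[OF b k(2)] by (auto simp: eventually_sequentially)
  have "b (d + e) k \<le> b d k" for e
  proof (induction e)
    case (Suc e)
    have "c (d + e) \<le> k" using pit_countsD(4)[OF c, of d "d + e"] k by simp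
    then show ?case using armsD(3)[OF b _ k(2), of "d + e"] Suc by simp
  qed simp
  from this[of D] show ?thesis using D[of "d + D"] by simp
qed

lemma finite_arm_excess:
  assumes "b \<in> arms n N c x" "k < n"
  shows "finite {d. arm_excess N c b k d \<noteq> 0}"
proof -
  obtain D where D: "\<And>d. d \<ge> D \<Longrightarrow> b d k = N k"
    using armsD(5)[OF assms] by (auto simp: eventually_sequentially)
  have "d < D" if "arm_excess N c b k d \<noteq> 0" for d
    using that D[of d] by (cases "d < D") (auto simp: arm_excess_def split: if_splits)
  then have "{d. arm_excess N c b k d \<noteq> 0} \<subseteq> {..<D}" by auto
  then show ?thesis using finite_subset by blast
qed

lemma arms_shift:
  assumes "b \<in> arms n N c x"
  shows "b \<circ> Suc \<in> arms n N (c \<circ> Suc) (b 1)" "b 1 \<in> arm_steps n (c 0) (c 1) x"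
proof -
  have "\<forall>\<^sub>F d in sequentially. b (Suc d) k = N k" if "k < n" for k
    using armsD(5)[OF assms that] eventually_sequentially_Suc[of "\<lambda>d. b d k = N k"] by simp
  then show "b \<circ> Suc \<in> arms n N (c \<circ> Suc) (b 1)"
    using assms by (auto simp: arms_def)
  show "b 1 \<in> arm_steps n (c 0) (c 1) x"
    using armsD(1)[OF assms] armsD(2)[OF assms, of 1] armsD(3,4)[OF assms, of 0]
    by (auto simp: arm_steps_def PiE_iff)
qed

lemma arms_cons:
  assumes "b \<in> arms n N (c \<circ> Suc) y" "y \<in> arm_steps n (c 0) (c 1) x" "x \<in> extensional {c 0..<n}"
    and c: "pit_counts n c"
  shows "case_nat x b \<in> arms n N c x"
proof -
  have y: "y = b 0" using assms(1) by (simp add: arms_def)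
  have ev: "\<forall>\<^sub>F d in sequentially. case_nat x b d k = N k" if "k < n" for k
  proof -
    have "\<forall>\<^sub>F d in sequentially. case_nat x b (Suc d) k = N k"
      using armsD(5)[OF assms(1) that] by simp
    then show ?thesis
      using eventually_sequentially_Suc[of "\<lambda>d. case_nat x b d k = N k"] by simp
  qed
  have "case_nat x b d \<in> extensional {c d..<n}" for d
    using armsD(2)[OF assms(1)] assms(3) by (cases d) auto
  moreover have "case_nat x b (Suc d) k \<le> case_nat x b d k" if "c d \<le> k" "k < n" for d k
    using that assms(2) armsD(3)[OF assms(1), of "d - 1" k] pit_countsD(2)[OF c, of 0]
    by (cases d) (auto simp: y arm_steps_def PiE_iff)
  moreover have "case_nat x b d (Suc k) < case_nat x b (Suc d) k" if "c (Suc d) \<le> k" "Suc k < n" for d k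
    using that assms(2) armsD(4)[OF assms(1), of "d - 1" k]
    by (cases d) (auto simp: y arm_steps_def PiE_iff)
  ultimately show ?thesis
    unfolding arms_def using ev by simp
qed

text \<open>Splitting off the main diagonal leaves a next diagonal and an arm that starts there;
  this is the recursion for the generating function.\<close>

lemma bij_betw_arms:
  assumes "x \<in> extensional {c 0..<n}" and c: "pit_counts n c"
  shows "bij_betw (\<lambda>(y, b). case_nat x b)
    (SIGMA y : arm_steps n (c 0) (c 1) x. arms n N (c \<circ> Suc) y) (arms n N c x)"
proof (rule bij_betw_byWitness[where f' = "\<lambda>b. (b 1, b \<circ> Suc)"])
  show "\<forall>b\<in>arms n N c x. (case (b 1, b \<circ> Suc) of (y, b) \<Rightarrow> case_nat x b) = b"
  proof
    fix b assume "b \<in> arms n N c x"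
    then have "b 0 = x" by (simp add: arms_def)
    then show "(case (b 1, b \<circ> Suc) of (y, b) \<Rightarrow> case_nat x b) = b"
      by (simp add: fun_eq_iff split: nat.split)
  qed
  show "(\<lambda>(y, b). case_nat x b) ` (SIGMA y : arm_steps n (c 0) (c 1) x. arms n N (c \<circ> Suc) y) \<subseteq> arms n N c x"
    using arms_cons[OF _ _ assms] by auto
  show "(\<lambda>b. (b 1, b \<circ> Suc)) ` arms n N c x \<subseteq> (SIGMA y : arm_steps n (c 0) (c 1) x. arms n N (c \<circ> Suc) y)"
    using arms_shift by auto
qed (auto simp: arms_def)

text \<open>The prepended diagonal itself is not counted, but the former main diagonal
  \<open>y\<close> now is.\<close>

lemma arm_weight_cons:
  assumes b: "b \<in> arms n N (c \<circ> Suc) y" and c: "pit_counts n c"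
  shows "int (arm_weight n N c (case_nat x b)) =
    (\<Sum>k = c 1..<n. int (y k) - int (N k)) + int (arm_weight n N (c \<circ> Suc) b)"
proof -
  have excess: "arm_excess N c (case_nat x b) k (Suc d) = arm_excess N (c \<circ> Suc) b k d" for k d
    by (simp add: arm_excess_def)
  have "arm_weight n N c (case_nat x b) = (\<Sum>k<n. fsum (arm_excess N (c \<circ> Suc) b k))"
    unfolding arm_weight_def excess by simp
  also have "\<dots> = (\<Sum>k<n. arm_excess N (c \<circ> Suc) b k 0 + fsum (arm_excess N (c \<circ> Suc) b k \<circ> Suc))"
    by (intro sum.cong refl fsum_Suc finite_arm_excess[OF b]) auto
  finally have weight: "arm_weight n N c (case_nat x b) =
      (\<Sum>k<n. arm_excess N (c \<circ> Suc) b k 0) + arm_weight n N (c \<circ> Suc) b"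
    by (simp add: sum.distrib arm_weight_def o_def)
  have "int (\<Sum>k<n. arm_excess N (c \<circ> Suc) b k 0) = (\<Sum>k = c 1..<n. int (y k) - int (N k))"
  proof -
    have "y = b 0" using b by (simp add: arms_def)
    have "int (arm_excess N (c \<circ> Suc) b k 0) = (if c 1 \<le> k then int (y k) - int (N k) else 0)" if "k < n" for k
      using arms_ge[OF b pit_counts_Suc[OF c], of 0 k] that \<open>y = b 0\<close> by (simp add: arm_excess_def of_nat_diff)
    then have "int (\<Sum>k<n. arm_excess N (c \<circ> Suc) b k 0) = (\<Sum>k<n. if c 1 \<le> k then int (y k) - int (N k) else 0)"
      by simp
    also have "\<dots> = (\<Sum>k\<in>{..<n} \<inter> {k. c 1 \<le> k}. int (y k) - int (N k))"
      by (simp add: sum.inter_restrict)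
    also have "{..<n} \<inter> {k. c 1 \<le> k} = {c 1..<n}" by auto
    finally show ?thesis .
  qed
  then show ?thesis unfolding weight of_nat_add by simp
qed

text \<open>The entry \<open>x (Suc k)\<close> separates \<open>y (Suc k)\<close> from
  \<open>y k\<close>; the bound \<open>c0 <= Suc c1\<close> ensures that it is finite.\<close>

lemma arm_steps_strict:
  assumes "y \<in> arm_steps n c0 c1 x" "c0 \<le> Suc c1"
  shows "strict_from c1 n y" "y \<in> extensional {c1..<n}"
  unfolding strict_from_def
proof (intro allI impI)
  fix k assume k: "c1 \<le> k" "Suc k < n"
  then have "y (Suc k) \<le> x (Suc k)" "x (Suc k) < y k"
    using assms by (auto simp: arm_steps_def PiE_iff)
  then show "y (Suc k) < y k" by simp
qed (use assms in \<open>auto simp: arm_steps_def PiE_iff\<close>)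

text \<open>The weight q^(x_k - N_l) is produced by scaling row k with q^(x_k) and column l with
  q^(-N_l). The column factor also hits the infinite rows, which raises their exponent by one
  step.\<close>

lemma arm_gf_scaled:
  assumes "c 0 \<le> n"
  shows "qpow (\<Sum>k = c 0..<n. int (x k) - int (N k)) * arm_gf n N c x =
    qpow (\<Sum>k<c 0. int (N k) * int (arrival c k)) *
    det_of n (\<lambda>k l. if k < c 0 then qpow (- (int (arrival c k) * int (N l))) * inverse qinf
       else qpow (int (x k) - int (N l)) * iqpoch (int (x k) - int (N l)))"
proof -
  let ?E = "\<lambda>k l. if k < c 0 then qpow (- ((int (arrival c k) - 1) * int (N l))) * inverse qinf
       else iqpoch (int (x k) - int (N l))"
  let ?a = "\<lambda>k. qpow (if k < c 0 then 0 else int (x k)) :: rat fls"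
  let ?b = "\<lambda>l. qpow (- int (N l)) :: rat fls"
  have split: "sum h {..<n} = sum h {..<c 0} + sum h {c 0..<n}" for h :: "nat \<Rightarrow> int"
    using assms by (metis lessThan_atLeast0 sum.atLeastLessThan_concat zero_le)
  have "det_of n (\<lambda>k l. ?a k * ?E k l * ?b l) =
    det_of n (\<lambda>k l. if k < c 0 then qpow (- (int (arrival c k) * int (N l))) * inverse qinf
       else qpow (int (x k) - int (N l)) * iqpoch (int (x k) - int (N l)))"
  proof (rule det_of_cong)
    fix k l
    have "- (int (arrival c k) * int (N l)) = - ((int (arrival c k) - 1) * int (N l)) + - int (N l)"
      by (simp add: algebra_simps)
    moreover have "int (x k) - int (N l) = int (x k) + - int (N l)" by simp
    ultimately show "?a k * ?E k l * ?b l =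
        (if k < c 0 then qpow (- (int (arrival c k) * int (N l))) * inverse qinf
         else qpow (int (x k) - int (N l)) * iqpoch (int (x k) - int (N l)))"
      by (simp only: qpow_add) (simp add: mult_ac)
  qed
  moreover have "(\<Prod>k<n. ?a k) = qpow (\<Sum>k = c 0..<n. int (x k))"
    unfolding prod_qpow split by simp
  moreover have "(\<Prod>l<n. ?b l) = qpow (- (\<Sum>k<c 0. int (N k)) - (\<Sum>k = c 0..<n. int (N k)))"
    unfolding prod_qpow split by (simp add: sum_negf)
  ultimately have det: "det_of n (\<lambda>k l. if k < c 0 then qpow (- (int (arrival c k) * int (N l))) * inverse qinf
       else qpow (int (x k) - int (N l)) * iqpoch (int (x k) - int (N l))) =
    qpow ((\<Sum>k = c 0..<n. int (x k)) + (- (\<Sum>k<c 0. int (N k)) - (\<Sum>k = c 0..<n. int (N k)))) * det_of n ?E"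
    by (simp only: det_of_scale qpow_add)
  have exps: "(\<Sum>k = c 0..<n. int (x k) - int (N k)) + (\<Sum>k<c 0. int (N k) * (int (arrival c k) - 1)) =
    (\<Sum>k<c 0. int (N k) * int (arrival c k)) +
    ((\<Sum>k = c 0..<n. int (x k)) + (- (\<Sum>k<c 0. int (N k)) - (\<Sum>k = c 0..<n. int (N k))))"
    by (simp add: sum_subtractf right_diff_distrib)
  show ?thesis
    unfolding det arm_gf_def mult.assoc[symmetric] qpow_add[symmetric] exps ..
qed

text \<open>
  Each row of the determinant is summed over its own interval, so the sum over the next diagonal is
  taken row by row. The row sums telescope to differences of consecutive rows of the next determinant.
\<close>

lemma lf_sum_arm_gf:
  assumes c: "pit_counts n c" and x: "strict_from (c 0) n x"
  shows "lf_sum (\<lambda>y. qpow (\<Sum>k = c 1..<n. int (y k) - int (N k)) * arm_gf n N (c \<circ> Suc) y)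
    (arm_steps n (c 0) (c 1) x) (arm_gf n N c x)"
proof -
  have c01: "c 1 \<le> c 0" "c 0 \<le> Suc (c 1)" "c 0 \<le> n"
    using pit_countsD[OF c] by auto
  define G where "G k l = (if k < c 0 then qpow (- ((int (arrival c k) - 1) * int (N l))) * inverse qinf
       else iqpoch (int (x k) - int (N l)))" for k l
  define F where "F k l = (if c 1 \<le> k \<and> Suc k < n then G k l - G (Suc k) l else G k l)" for k l
  define f where "f y l = qpow (int y - int (N l)) * iqpoch (int y - int (N l))" for y l
  define C where "C = (\<Sum>k<c 0. int (N k) * (int (arrival c k) - 1))"
  let ?I = "{c 1..<n}"
  let ?S = "\<lambda>k. {y. (c 0 \<le> k \<longrightarrow> y \<le> x k) \<and> (Suc k < n \<longrightarrow> x (Suc k) < y)}"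
  have arr: "int (arrival (c \<circ> Suc) k) = int (arrival c k) - 1" if "k < c 1" for k
    using arrival_Suc[OF c, of k] that c01 by simp
  have arr1: "arrival c k = 1" if "c 1 \<le> k" "k < c 0" for k
    using arrival_Suc[OF c that(2)] arrival_eq_0[of "c \<circ> Suc" k] that by simp
  have row: "lf_sum (\<lambda>y. f y l) (?S k) (F k l)" if k: "k \<in> ?I" "l < n" for k l
  proof (cases "c 0 \<le> k")
    case True
    show ?thesis
    proof (cases "Suc k < n")
      case Suc: True
      then have "x (Suc k) \<le> x k" using x True by (auto simp: strict_from_def)
      moreover have "?S k = {x (Suc k)<..x k}" using True Suc by auto
      ultimately show ?thesis
        using lf_sum_finite[of "{x (Suc k)<..x k}" "\<lambda>y. f y l"] True Suc c01
        by (simp add: f_def sum_qpow_iqpoch F_def G_def)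
    next
      case False
      then have "?S k = {..x k}" using True by auto
      then show ?thesis
        using lf_sum_finite[of "{..x k}" "\<lambda>y. f y l"] True False
        by (simp add: f_def sum_qpow_iqpoch_atMost F_def G_def)
    qed
  next
    case False
    \<comment> \<open>Here k = c 1 is the entry that becomes finite on this diagonal. Its sum has no
      upper end, and the limit 1/(q)_inf is exactly row k of \<open>G\<close>, since its arrival is
      1.\<close>
    then have k': "k < c 0" "Suc k = c 0" using k c01 by auto
    have G: "G k l = inverse qinf" using k' k arr1[of k] by (simp add: G_def)
    show ?thesis
    proof (cases "Suc k < n")
      case True
      then have "?S k = {x (Suc k)<..}" using k' by auto
      then show ?thesis
        using lf_sum_qpow_iqpoch[of "int (N l)" "x (Suc k)"] G True k' k
        by (simp add: f_def F_def) (simp add: G_def)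
    next
      case False
      then have "?S k = UNIV" using k' by auto
      then show ?thesis
        using lf_sum_qpow_iqpoch_UNIV[of "int (N l)"] G False k' k
        by (simp add: f_def F_def)
    qed
  qed
  have "lf_sum (\<lambda>y. det_of n (\<lambda>k l. if k \<in> ?I then f (y k) l else F k l)) (PiE ?I ?S) (det_of n F)"
    by (rule lf_sum_det_of[OF _ row]) auto
  then have "lf_sum (\<lambda>y. qpow C * det_of n (\<lambda>k l. if k \<in> ?I then f (y k) l else F k l)) (PiE ?I ?S) (qpow C * det_of n F)"
    by (rule lf_sum_cmult)
  moreover have "det_of n F = det_of n G"
    unfolding F_def by (rule det_of_row_differences)
  then have "qpow C * det_of n F = arm_gf n N c x"
    by (simp add: arm_gf_def C_def G_def)
  moreover have "qpow C * det_of n (\<lambda>k l. if k \<in> ?I then f (y k) l else F k l) =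
      qpow (\<Sum>k = c 1..<n. int (y k) - int (N k)) * arm_gf n N (c \<circ> Suc) y" for y
  proof -
    \<comment> \<open>The entry that becomes finite now has arrival 1, so its exponent
      \<open>arrival c k - 1\<close> is zero and may be dropped.\<close>
    have "C = (\<Sum>k<c 1. int (N k) * (int (arrival c k) - 1))"
      unfolding C_def by (rule sum.mono_neutral_right) (use c01 arr1 in auto)
    also have "\<dots> = (\<Sum>k<c 1. int (N k) * int (arrival (c \<circ> Suc) k))"
      by (intro sum.cong) (auto simp: arr)
    finally have C: "C = (\<Sum>k<c 1. int (N k) * int (arrival (c \<circ> Suc) k))" .
    have "det_of n (\<lambda>k l. if k \<in> ?I then f (y k) l else F k l) =
        det_of n (\<lambda>k l. if k < c 1 then qpow (- (int (arrival (c \<circ> Suc) k) * int (N l))) * inverse qinf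
          else qpow (int (y k) - int (N l)) * iqpoch (int (y k) - int (N l)))"
      by (rule det_of_cong) (use c01 in \<open>auto simp: f_def F_def G_def arr\<close>)
    then show ?thesis
      using arm_gf_scaled[of "c \<circ> Suc" n y N] c01 by (simp add: C)
  qed
  ultimately show ?thesis
    by (simp add: arm_steps_def)
qed

text \<open>For rows k >= i and columns l <= i the argument is negative, because x_k <= x_i < N_i <=
  N_l, and these zeros form a singular block. This matches the absence of arms by
  \<open>arms_ge\<close>.\<close>

lemma arm_gf_eq_0:
  assumes "strict_from (c 0) n x" "strict_from 0 n N" "c 0 \<le> i" "i < n" "x i < N i"
  shows "arm_gf n N c x = 0"
proof -
  have "x k < N l" if "i \<le> k" "k < n" "l \<le> i" for k l
    using strict_fromD[OF assms(1,3) that(1,2)] strict_fromD[OF assms(2), of l i] that assms by simp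
  then have "det_of n (\<lambda>k l. if k < c 0 then qpow (- ((int (arrival c k) - 1) * int (N l))) * inverse qinf
       else iqpoch (int (x k) - int (N l))) = 0"
    using assms(3,4) by (intro det_of_zero_block[of i]) auto
  then show ?thesis by (simp add: arm_gf_def)
qed

section \<open>Arms counted by weight\<close>

lemma fls_subdegree_det_of_nonneg:
  fixes F :: "nat \<Rightarrow> nat \<Rightarrow> 'a::field fls"
  assumes "\<And>k l. 0 \<le> fls_subdegree (F k l)"
  shows "0 \<le> fls_subdegree (det_of n F)"
proof -
  have iff: "0 \<le> fls_subdegree f \<longleftrightarrow> fls_vanishes (- 1) f" for f :: "'a fls"
    by (auto simp: fls_vanishes_iff_subdegree)
  have "0 \<le> fls_subdegree (\<Prod>k\<in>I. F k (p k))" for I :: "nat set" and p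
    by (induction I rule: infinite_finite_induct) (auto intro: fls_subdegree_mult_nonneg assms)
  then have "0 \<le> fls_subdegree (signof p * (\<Prod>k\<in>I. F k (p k)))" for I :: "nat set" and p
    by (simp add: sign_def)
  then show ?thesis
    unfolding det_of_leibniz iff by (intro fls_vanishes_sum) auto
qed

lemma fls_subdegree_arm_gf_nonneg: "c 0 = 0 \<Longrightarrow> 0 \<le> fls_subdegree (arm_gf n N c x)"
  by (simp add: arm_gf_def fls_subdegree_det_of_nonneg)

text \<open>The base of the induction: entries are squeezed between the first diagonal and the
  limit, which coincide, and the determinant is unitriangular because \<open>N\<close> is strictly
  decreasing.\<close>

lemma arms_terminal:
  assumes c: "pit_counts n c" "c 0 = 0" and N: "strict_from 0 n N"
    and x: "x \<in> extensional {c 0..<n}" "\<And>k. k < n \<Longrightarrow> x k = N k"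
  shows "arms n N c x = {\<lambda>d. x}" "arm_weight n N c (\<lambda>d. x) = 0" "arm_gf n N c x = 1"
proof -
  have c0: "c d = 0" for d
    using pit_countsD(4)[OF c(1), of 0 d] c(2) by simp
  have "x (Suc k) < x k" if "Suc k < n" for k
    using N x(2) that by (auto simp: strict_from_def)
  then have "(\<lambda>d. x) \<in> arms n N c x"
    using x by (auto simp: arms_def c0)
  moreover have "b = (\<lambda>d. x)" if b: "b \<in> arms n N c x" for b
  proof
    fix d
    have le: "b d k \<le> x k" if "k < n" for k
    proof (induction d)
      case 0
      then show ?case using armsD(1)[OF b] by simp
    next
      case (Suc d)
      then show ?case using armsD(3)[OF b, of d k] c0 that by simp
    qed
    show "b d = x"
    proof (rule extensionalityI)
      show "b d \<in> extensional {..<n}" "x \<in> extensional {..<n}"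
        using armsD(2)[OF b, of d] x(1) by (simp_all add: c0 atLeast0LessThan)
      show "b d k = x k" if "k \<in> {..<n}" for k
        using le[of k] arms_ge[OF b c(1), of d k] that x(2)[of k] c0 by simp
    qed
  qed
  ultimately show "arms n N c x = {\<lambda>d. x}" by blast
  show "arm_weight n N c (\<lambda>d. x) = 0"
    using x(2) by (simp add: arm_weight_def arm_excess_def fsum_def)
  let ?A = "mat n n (\<lambda>(k, l). iqpoch (int (x k) - int (N l)))"
  have "N k < N l" if "l < k" "k < n" for k l
  proof -
    have "N k \<le> N (Suc l)" using strict_fromD[OF N, of "Suc l" k] that by simp
    also have "\<dots> < N l" using N that by (simp add: strict_from_def)
    finally show ?thesis .
  qed
  then have "upper_triangular ?A"
    using x(2) by (auto simp: upper_triangular_def)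
  then have "det ?A = prod_list (diag_mat ?A)"
    by (rule det_upper_triangular[where n = n]) simp
  also have "diag_mat ?A = map (\<lambda>_. 1) [0..<n]"
    using x(2) by (auto simp: diag_mat_def)
  finally show "arm_gf n N c x = 1"
    by (simp add: arm_gf_def c(2) map_replicate_const)
qed

lemma card_Sigma_support:
  assumes "finite {y\<in>S. B y \<noteq> {}}" "\<And>y. y \<in> S \<Longrightarrow> finite (B y)"
  shows "finite (Sigma S B)" "card (Sigma S B) = (\<Sum>y | y \<in> S \<and> B y \<noteq> {}. card (B y))"
proof -
  have eq: "Sigma S B = Sigma {y\<in>S. B y \<noteq> {}} B" by auto
  show "finite (Sigma S B)" "card (Sigma S B) = (\<Sum>y | y \<in> S \<and> B y \<noteq> {}. card (B y))"
    unfolding eq using assms by (auto intro!: finite_SigmaI card_SigmaI)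
qed

text \<open>
  Either a diagonal that has not yet reached \<open>N\<close> contributes to the weight, or else the number of
  remaining diagonals with infinite entries drops. Hence the induction on \<open>K + p\<close>.
\<close>

lemma fls_nth_arm_gf:
  assumes N: "strict_from 0 n N" and c: "pit_counts n c" "c p = 0"
    and x: "x \<in> extensional {c 0..<n}" "strict_from (c 0) n x"
  shows "finite {b \<in> arms n N c x. int (arm_weight n N c b) = K} \<and>
    fls_nth (arm_gf n N c x) K = of_nat (card {b \<in> arms n N c x. int (arm_weight n N c b) = K})"
  using c x
proof (induction "nat K + p" arbitrary: K p c x rule: less_induct)
  case less
  note c = less.prems(1,2) and x = less.prems(3,4)
  have c01: "c 1 \<le> c 0" "c 0 \<le> Suc (c 1)" "c 0 \<le> n"
    using pit_countsD[OF c(1)] by auto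
  define st where "st = arm_steps n (c 0) (c 1) x"
  define w where "w y = (\<Sum>k = c 1..<n. int (y k) - int (N k))" for y
  define B where "B y = {b \<in> arms n N (c \<circ> Suc) y. int (arm_weight n N (c \<circ> Suc) b) = K - w y}" for y
  have c': "pit_counts n (c \<circ> Suc)" by (rule pit_counts_Suc[OF c(1)])
  have c'_p: "(c \<circ> Suc) (p - 1) = 0"
    using c(2) pit_countsD(2)[OF c(1), of 0] by (cases p) auto
  have B: "finite (B y) \<and> fls_nth (arm_gf n N (c \<circ> Suc) y) (K - w y) = of_nat (card (B y))"
    if "y \<in> st" for y
  proof -
    have y: "strict_from ((c \<circ> Suc) 0) n y" "y \<in> extensional {(c \<circ> Suc) 0..<n}"
      using arm_steps_strict[of y n "c 0" "c 1" x] that c01 by (auto simp: st_def)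
    show ?thesis
    proof (cases "\<exists>i. c 1 \<le> i \<and> i < n \<and> y i < N i")
      case True
      then obtain i where i: "c 1 \<le> i" "i < n" "y i < N i" by auto
      have "b \<notin> arms n N (c \<circ> Suc) y" for b
        using arms_ge[OF _ c', of b N y 0 i] armsD(1)[of b n N "c \<circ> Suc" y] i by auto
      then have "arms n N (c \<circ> Suc) y = {}" by blast
      then show ?thesis
        using arm_gf_eq_0[of "c \<circ> Suc" n y N i] y N i by (simp add: B_def)
    next
      case False
      then have ge: "\<And>k. c 1 \<le> k \<Longrightarrow> k < n \<Longrightarrow> N k \<le> y k" by (auto simp: not_less)
      then have w0: "0 \<le> w y" by (auto simp: w_def intro!: sum_nonneg)
      \<comment> \<open>If p > 0, removing a diagonal lowers p. If p = 0, it lowers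
        \<open>nat K\<close> when w y and K are positive; for w y > 0 >= K both sides are 0, since
        the remaining coefficient has a negative index. The case w y = 0 means y = N, the terminal
        arm.\<close>
      consider "p > 0" | "p = 0" "w y = 0" | "p = 0" "w y > 0" "K > 0" | "p = 0" "w y > 0" "K \<le> 0"
        using w0 by linarith
      then show ?thesis
      proof cases
        case 1
        then have "nat (K - w y) + (p - 1) < nat K + p" using w0 by linarith
        from less.hyps[OF this c' c'_p y(2,1)] show ?thesis unfolding B_def .
      next
        case 3
        then have "nat (K - w y) + (p - 1) < nat K + p" by linarith
        from less.hyps[OF this c' c'_p y(2,1)] show ?thesis unfolding B_def .
      next
        case 4
        then have "c 1 = 0" using c c01 by simp
        then have "0 \<le> fls_subdegree (arm_gf n N (c \<circ> Suc) y)"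
          by (intro fls_subdegree_arm_gf_nonneg) simp
        then have "fls_nth (arm_gf n N (c \<circ> Suc) y) (K - w y) = 0"
          using 4 by (intro fls_eq0_below_subdegree) simp
        moreover have "B y = {}" using 4 by (auto simp: B_def)
        ultimately show ?thesis by simp
      next
        case 2
        then have c1: "c 1 = 0" using c c01 by simp
        have "int (y k) - int (N k) = 0" if "k \<in> {c 1..<n}" for k
          using sum_nonneg_0[of "{c 1..<n}" "\<lambda>k. int (y k) - int (N k)"] 2(2) ge that
          by (auto simp: w_def)
        then have y_eq: "\<And>k. k < n \<Longrightarrow> y k = N k" using c1 by simp
        have "(c \<circ> Suc) 0 = 0" using c1 by simp
        have t: "arms n N (c \<circ> Suc) y = {\<lambda>d. y}" "arm_weight n N (c \<circ> Suc) (\<lambda>d. y) = 0"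
            "arm_gf n N (c \<circ> Suc) y = 1"
          using arms_terminal[OF c' \<open>(c \<circ> Suc) 0 = 0\<close> N y(2)] y_eq by blast+
        have "B y = (if K = 0 then {\<lambda>d. y} else {})"
          unfolding B_def t(1) by (auto simp: t(2) 2)
        then show ?thesis unfolding t(3) by (simp add: 2)
      qed
    qed
  qed
  note L = lf_sum_nth[OF lf_sum_arm_gf[OF c(1) x(2), of N, folded st_def w_def], of K, unfolded fls_nth_qpow_mult]
  \<comment> \<open>The coefficients are cardinalities, so they are nonzero exactly for nonempty
    fibres. Local finiteness of the sum thus also shows that the arms of weight \<open>K\<close> are
    finite in number.\<close>
  have nz: "{y \<in> st. fls_nth (arm_gf n N (c \<circ> Suc) y) (K - w y) \<noteq> 0} = {y \<in> st. B y \<noteq> {}}"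
    using B by auto
  have fin: "finite (Sigma st B)" and card: "card (Sigma st B) = (\<Sum>y | y \<in> st \<and> B y \<noteq> {}. card (B y))"
    using card_Sigma_support[of st B] L(1) B unfolding nz by auto
  have "bij_betw (\<lambda>(y, b). case_nat x b) (Sigma st B) {b \<in> arms n N c x. int (arm_weight n N c b) = K}"
  proof (rule bij_betw_subset[OF bij_betw_arms[OF x(1) c(1), of N, folded st_def]])
    show "Sigma st B \<subseteq> (SIGMA y : st. arms n N (c \<circ> Suc) y)"
      by (auto simp: B_def)
    have weight: "int (arm_weight n N c (case_nat x b)) = w y + int (arm_weight n N (c \<circ> Suc) b)"
      if "b \<in> arms n N (c \<circ> Suc) y" for y b
      using arm_weight_cons[OF that c(1), of x] by (simp add: w_def)
    have img: "(\<lambda>(y, b). case_nat x b) ` (SIGMA y : st. arms n N (c \<circ> Suc) y) = arms n N c x"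
      using bij_betw_arms[OF x(1) c(1), of N] by (simp add: st_def bij_betw_def)
    show "(\<lambda>(y, b). case_nat x b) ` Sigma st B = {b \<in> arms n N c x. int (arm_weight n N c b) = K}"
    proof (intro equalityI subsetI)
      fix z assume "z \<in> (\<lambda>(y, b). case_nat x b) ` Sigma st B"
      then obtain y b where yb: "y \<in> st" "b \<in> B y" and z: "z = case_nat x b" by auto
      then have b: "b \<in> arms n N (c \<circ> Suc) y" and "int (arm_weight n N (c \<circ> Suc) b) = K - w y"
        by (simp_all add: B_def)
      then have "int (arm_weight n N c z) = K" unfolding z weight[OF b] by simp
      moreover have "z \<in> arms n N c x"
        unfolding img[symmetric] z using yb(1) b by (intro image_eqI[of _ _ "(y, b)"]) auto
      ultimately show "z \<in> {b \<in> arms n N c x. int (arm_weight n N c b) = K}" by simp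
    next
      fix z assume z: "z \<in> {b \<in> arms n N c x. int (arm_weight n N c b) = K}"
      then have "z \<in> (\<lambda>(y, b). case_nat x b) ` (SIGMA y : st. arms n N (c \<circ> Suc) y)"
        unfolding img by simp
      then obtain y b where yb: "y \<in> st" "b \<in> arms n N (c \<circ> Suc) y" and zb: "z = case_nat x b" by auto
      have "b \<in> B y" using z weight[OF yb(2)] yb(2) by (simp add: B_def zb)
      then show "z \<in> (\<lambda>(y, b). case_nat x b) ` Sigma st B"
        using yb(1) zb by (intro image_eqI[of _ _ "(y, b)"]) auto
    qed
  qed
  note bij = bij_betw_finite[OF this] bij_betw_same_card[OF this, symmetric]
  have "fls_nth (arm_gf n N c x) K = (\<Sum>y | y \<in> st \<and> B y \<noteq> {}. of_nat (card (B y)))"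
    unfolding L(2) nz by (intro sum.cong refl) (use B in simp)
  then show ?case
    using bij fin card by simp
qed

lemma lf_sum_arms:
  assumes N: "strict_from 0 n N" and c: "pit_counts n c"
    and x: "x \<in> extensional {c 0..<n}" "strict_from (c 0) n x"
  shows "lf_sum (\<lambda>b. qpow (int (arm_weight n N c b))) (arms n N c x) (arm_gf n N c x)"
proof (rule lf_sumI_nth)
  obtain p where p: "c p = 0" using c by (auto simp: pit_counts_def)
  note count = fls_nth_arm_gf[OF N c p x]
  show "loc_finite (\<lambda>b. qpow (int (arm_weight n N c b)) :: rat fls) (arms n N c x)"
    unfolding loc_finite_def
  proof
    fix K
    have "{b \<in> arms n N c x. \<not> fls_vanishes K (qpow (int (arm_weight n N c b)) :: rat fls)} \<subseteq>
        (\<Union>k\<in>{0..K}. {b \<in> arms n N c x. int (arm_weight n N c b) = k})"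
      by (auto simp: fls_vanishes_def fls_nth_qpow split: if_splits)
    then show "finite {b \<in> arms n N c x. \<not> fls_vanishes K (qpow (int (arm_weight n N c b)) :: rat fls)}"
      by (rule finite_subset) (use count in auto)
  qed
  fix k
  show "fls_nth (arm_gf n N c x) k =
    (\<Sum>b | b \<in> arms n N c x \<and> fls_nth (qpow (int (arm_weight n N c b)) :: rat fls) k \<noteq> 0.
      fls_nth (qpow (int (arm_weight n N c b))) k)"
  proof -
    have "{b \<in> arms n N c x. fls_nth (qpow (int (arm_weight n N c b)) :: rat fls) k \<noteq> 0} =
        {b \<in> arms n N c x. int (arm_weight n N c b) = k}"
      by (auto simp: fls_nth_qpow split: if_splits)
    then show ?thesis
      using count[of k] by (simp add: fls_nth_qpow)
  qed
qed

section \<open>Arrays and their arms\<close>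

definition weakly_decr :: "(nat \<Rightarrow> nat) \<Rightarrow> bool" where
  "weakly_decr lam \<longleftrightarrow> (\<forall>i\<ge>1. lam (Suc i) \<le> lam i)"

lemma weakly_decrD: "weakly_decr lam \<Longrightarrow> 1 \<le> i \<Longrightarrow> i \<le> j \<Longrightarrow> lam j \<le> lam i"
proof -
  assume lam: "weakly_decr lam" "1 \<le> i" "i \<le> j"
  have "lam (i + e) \<le> lam i" for e
  proof (induction e)
    case (Suc e)
    have "lam (Suc (i + e)) \<le> lam (i + e)" using lam by (simp add: weakly_decr_def)
    with Suc show ?case by simp
  qed simp
  from this[of "j - i"] show "lam j \<le> lam i" using lam by simp
qed

lemma is_partition_weakly_decr: "is_partition lam \<Longrightarrow> weakly_decr lam"
  by (simp add: is_partition_def weakly_decr_def)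

lemma down_closed_eq_atLeastAtMost:
  assumes "finite S" "\<And>i. i \<in> S \<Longrightarrow> 1 \<le> i" "\<And>i j. j \<in> S \<Longrightarrow> 1 \<le> i \<Longrightarrow> i \<le> j \<Longrightarrow> i \<in> S"
  shows "S = {1..card S}"
proof (cases "S = {}")
  case False
  define M where "M = Max S"
  have M: "M \<in> S" "\<And>i. i \<in> S \<Longrightarrow> i \<le> M" using assms(1) False by (auto simp: M_def)
  have "S = {1..M}"
  proof (intro equalityI subsetI)
    fix i assume "i \<in> S"
    then show "i \<in> {1..M}" using M(2) assms(2) by simp
  next
    fix i assume "i \<in> {1..M}"
    then show "i \<in> S" using assms(3)[OF M(1), of i] by simp
  qed
  then show ?thesis by simp
qed simp

lemma part_length_eq_0:
  assumes "is_partition nu" "part_length nu \<le> n" "n < i"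
  shows "nu i = 0"
proof (rule ccontr)
  assume nz: "nu i \<noteq> 0"
  have dec: "weakly_decr nu" using assms(1) by (rule is_partition_weakly_decr)
  have "{1..i} \<subseteq> {i. 1 \<le> i \<and> nu i \<noteq> 0}"
  proof
    fix j assume "j \<in> {1..i}"
    then show "j \<in> {i. 1 \<le> i \<and> nu i \<noteq> 0}"
      using weakly_decrD[OF dec, of j i] nz by auto
  qed
  then have "card {1..i} \<le> part_length nu"
    unfolding part_length_def using assms(1) by (intro card_mono) (auto simp: is_partition_def)
  with assms show False by simp
qed

lemma conj_part_iff:
  assumes "is_partition lam" "1 \<le> i" "1 \<le> j"
  shows "i \<le> conj_part lam j \<longleftrightarrow> j \<le> lam i"
proof -
  let ?S = "{i. i \<ge> 1 \<and> j \<le> lam i}"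
  have dec: "weakly_decr lam" using assms(1) by (rule is_partition_weakly_decr)
  have "finite ?S"
    using assms(1,3) by (intro finite_subset[of ?S "{i. i \<ge> 1 \<and> lam i \<noteq> 0}"]) (auto simp: is_partition_def)
  then have "?S = {1..card ?S}"
    using weakly_decrD[OF dec] by (intro down_closed_eq_atLeastAtMost) (auto intro: order_trans)
  then have "i \<in> ?S \<longleftrightarrow> i \<in> {1..card ?S}" by simp
  then show ?thesis using assms(2) by (simp add: conj_part_def)
qed

lemma conj_part_decr:
  assumes "is_partition lam"
  shows "weakly_decr (conj_part lam)"
  unfolding weakly_decr_def
proof (intro allI impI)
  fix j :: nat assume "1 \<le> j"
  show "conj_part lam (Suc j) \<le> conj_part lam j"
    using conj_part_iff[OF assms, of "conj_part lam (Suc j)" "Suc j"]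
      conj_part_iff[OF assms, of "conj_part lam (Suc j)" j] \<open>1 \<le> j\<close>
    by (cases "conj_part lam (Suc j) = 0") auto
qed

lemma diagram_conj_part:
  assumes "is_partition lam" "1 \<le> i" "1 \<le> j"
  shows "(j, i) \<in> diagram (conj_part lam) \<longleftrightarrow> (i, j) \<in> diagram lam"
  using conj_part_iff[OF assms] assms(2,3) by (simp add: diagram_def)

text \<open>The diagonal through position \<open>lam (Suc k)\<close> of row \<open>Suc k\<close>,
  numbered so that (n, m) lies on diagonal 0. It equals P_(k+1).\<close>

definition reach :: "nat \<Rightarrow> nat \<Rightarrow> (nat \<Rightarrow> nat) \<Rightarrow> nat \<Rightarrow> int" where
  "reach n m lam k = int (lam (Suc k)) - int m + int n - int (Suc k)"

text \<open>Besides the infinite entries this counts the rows in which the diagonal would lie at a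
  column index of 0 or less; so every diagonal has \<open>n\<close> entries.\<close>

definition row_pits :: "nat \<Rightarrow> nat \<Rightarrow> (nat \<Rightarrow> nat) \<Rightarrow> nat \<Rightarrow> nat" where
  "row_pits n m lam d = card {k. k < n \<and> int d \<le> reach n m lam k}"

definition shifted :: "nat \<Rightarrow> (nat \<Rightarrow> nat) \<Rightarrow> nat \<Rightarrow> nat" where
  "shifted n nu k = nu (Suc k) + (n - Suc k)"

text \<open>The truncated subtraction in the column index is exact on the given range of
  \<open>k\<close>, by \<open>outside_diagram\<close>.\<close>

definition row_arm ::
    "nat \<Rightarrow> nat \<Rightarrow> (nat \<Rightarrow> nat) \<Rightarrow> (nat \<Rightarrow> nat \<Rightarrow> enat) \<Rightarrow> nat \<Rightarrow> nat \<Rightarrow> nat" where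
  "row_arm n m lam a d =
     (\<lambda>k\<in>{row_pits n m lam d..<n}. the_enat (a (Suc k) (Suc k + d + m - n)) + (n - Suc k))"

text \<open>\<open>reach\<close> decreases from row to row, so the rows that are still infinite on a
  diagonal form an initial segment.\<close>

lemma row_pits_iff:
  assumes "weakly_decr lam" "k < n"
  shows "k < row_pits n m lam d \<longleftrightarrow> int d \<le> reach n m lam k"
proof -
  let ?S = "Suc ` {k. k < n \<and> int d \<le> reach n m lam k}"
  have "?S = {1..card ?S}"
  proof (rule down_closed_eq_atLeastAtMost)
    fix i j assume "j \<in> ?S" "1 \<le> i" "i \<le> j"
    then have "i - 1 < n" "lam j \<le> lam i" "int d \<le> reach n m lam (j - 1)" "1 \<le> j"
      using weakly_decrD[OF assms(1), of i j] by auto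
    then have "i - 1 < n \<and> int d \<le> reach n m lam (i - 1)"
      using \<open>1 \<le> i\<close> \<open>i \<le> j\<close> by (auto simp: reach_def)
    then show "i \<in> ?S" using \<open>1 \<le> i\<close> by (intro image_eqI[of _ _ "i - 1"]) auto
  qed auto
  moreover have "card ?S = row_pits n m lam d"
    by (simp add: row_pits_def card_image)
  ultimately have "Suc k \<in> ?S \<longleftrightarrow> Suc k \<in> {1..row_pits n m lam d}" by simp
  then show ?thesis using assms(2) by (auto simp: Suc_le_eq)
qed

lemma row_pits_le: "row_pits n m lam d \<le> n"
proof -
  have "row_pits n m lam d \<le> card {..<n}"
    unfolding row_pits_def by (intro card_mono) auto
  then show ?thesis by simp
qed

text \<open>\<open>reach\<close> drops by at least one from each row to the next, so no two rows
  have their last infinite entry on the same diagonal; and no row reaches diagonal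
  \<open>lam 1 + n\<close>.\<close>

lemma pit_counts_row_pits:
  assumes "weakly_decr lam"
  shows "pit_counts n (row_pits n m lam)"
  unfolding pit_counts_def
proof (intro conjI allI)
  show "row_pits n m lam 0 \<le> n" by (rule row_pits_le)
  fix d
  show "row_pits n m lam (Suc d) \<le> row_pits n m lam d"
    unfolding row_pits_def by (intro card_mono) auto
  show "row_pits n m lam d \<le> Suc (row_pits n m lam (Suc d))"
  proof (rule ccontr)
    assume "\<not> ?thesis"
    then have less: "Suc (row_pits n m lam (Suc d)) < row_pits n m lam d" by simp
    define k where "k = row_pits n m lam (Suc d)"
    have k: "Suc k < n" using less row_pits_le[of n m lam d] by (simp add: k_def)
    have "int d \<le> reach n m lam (Suc k)"
      using row_pits_iff[OF assms k, of m d] less by (simp add: k_def)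
    moreover have "lam (Suc (Suc k)) \<le> lam (Suc k)" using weakly_decrD[OF assms] by simp
    ultimately have "int (Suc d) \<le> reach n m lam k" by (simp add: reach_def)
    then show False using row_pits_iff[OF assms, of k n m "Suc d"] k by (simp add: k_def)
  qed
next
  have "\<not> int (lam 1 + n) \<le> reach n m lam k" if "k < n" for k
    using weakly_decrD[OF assms, of 1 "Suc k"] by (simp add: reach_def)
  then have "row_pits n m lam (lam 1 + n) = 0"
    by (auto simp: row_pits_def simp del: of_nat_add)
  then show "\<exists>d. row_pits n m lam d = 0" ..
qed

text \<open>A row becomes finite one diagonal after its \<open>reach\<close>; \<open>nat\<close>
  covers the rows that are already finite on the main diagonal.\<close>

lemma arrival_row_pits:
  assumes "weakly_decr lam" "k < n"
  shows "arrival (row_pits n m lam) k = nat (reach n m lam k + 1)"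
proof -
  have "row_pits n m lam d \<le> k \<longleftrightarrow> nat (reach n m lam k + 1) \<le> d" for d
    using row_pits_iff[OF assms, of m d] by linarith
  then show ?thesis
    unfolding arrival_def by (intro Least_equality) auto
qed

lemma strict_from_shifted:
  assumes "weakly_decr nu"
  shows "strict_from 0 n (shifted n nu)"
  unfolding strict_from_def
proof (intro allI impI)
  fix k assume "Suc k < n"
  moreover have "nu (Suc (Suc k)) \<le> nu (Suc k)" using assms by (rule weakly_decrD) auto
  ultimately show "shifted n nu (Suc k) < shifted n nu k"
    unfolding shifted_def by (intro add_le_less_mono diff_less_mono2) auto
qed

lemma outside_diagram:
  assumes "weakly_decr lam" "row_pits n m lam d \<le> k" "k < n"
  shows "n < Suc k + d + m" "(Suc k, Suc k + d + m - n) \<notin> diagram lam"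
proof -
  have "reach n m lam k < int d"
    using row_pits_iff[OF assms(1,3), of m d] assms(2) by simp
  then have "int (lam (Suc k)) + int n < int (Suc k + d + m)"
    by (simp add: reach_def)
  then show "n < Suc k + d + m" "(Suc k, Suc k + d + m - n) \<notin> diagram lam"
    by (auto simp: diagram_def)
qed

lemma row_pits_outside:
  assumes "weakly_decr lam" "1 \<le> i" "i \<le> n" "1 \<le> j" "i + m \<le> n + j" "(i, j) \<notin> diagram lam"
  shows "row_pits n m lam (n + j - (m + i)) \<le> i - 1"
proof -
  have "lam i < j" using assms by (auto simp: diagram_def)
  then have "\<not> int (n + j - (m + i)) \<le> reach n m lam (i - 1)"
    using assms by (simp add: reach_def of_nat_diff)
  moreover have "i - 1 < n" using assms by simp
  ultimately have "\<not> i - 1 < row_pits n m lam (n + j - (m + i))"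
    using row_pits_iff[OF assms(1)] by blast
  then show ?thesis by simp
qed

text \<open>A symmetric relation, so that facts on row arms carry over to column arms by exchanging
  the shapes, without showing that conjugation is an involution.\<close>

definition dual_shapes :: "(nat \<Rightarrow> nat) \<Rightarrow> (nat \<Rightarrow> nat) \<Rightarrow> bool" where
  "dual_shapes lam lam' \<longleftrightarrow> weakly_decr lam \<and> weakly_decr lam' \<and>
     (\<forall>i\<ge>1. \<forall>j\<ge>1. (i, j) \<in> diagram lam \<longleftrightarrow> (j, i) \<in> diagram lam')"

lemma dual_shapes_sym: "dual_shapes lam lam' \<Longrightarrow> dual_shapes lam' lam"
  by (auto simp: dual_shapes_def)

lemma dual_shapesD:
  assumes "dual_shapes lam lam'"
  shows "weakly_decr lam" "weakly_decr lam'"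
    "1 \<le> i \<Longrightarrow> 1 \<le> j \<Longrightarrow> (j, i) \<in> diagram lam' \<longleftrightarrow> (i, j) \<in> diagram lam"
  using assms by (auto simp: dual_shapes_def)

lemma dual_shapes_conj_part: "is_partition lam \<Longrightarrow> dual_shapes lam (conj_part lam)"
  using diagram_conj_part[of lam]
  by (auto simp: dual_shapes_def is_partition_weakly_decr conj_part_decr)

lemma pit_arrays_transpose:
  assumes "dual_shapes lam lam'" "a \<in> pit_arrays n m mu nu lam"
  shows "(\<lambda>i j. a j i) \<in> pit_arrays m n nu mu lam'"
  using assms(2) dual_shapesD(3)[OF assms(1)] by (auto simp: pit_arrays_def)

lemma pit_arraysD:
  assumes "a \<in> pit_arrays n m mu nu lam"
  shows "i = 0 \<or> j = 0 \<Longrightarrow> a i j = 0"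
    "1 \<le> i \<Longrightarrow> 1 \<le> j \<Longrightarrow> a (Suc i) j \<le> a i j"
    "1 \<le> i \<Longrightarrow> 1 \<le> j \<Longrightarrow> a i (Suc j) \<le> a i j"
    "a (Suc n) (Suc m) = 0"
    "1 \<le> i \<Longrightarrow> \<forall>\<^sub>F j in sequentially. a i j = enat (nu i)"
    "1 \<le> j \<Longrightarrow> \<forall>\<^sub>F i in sequentially. a i j = enat (mu j)"
    "1 \<le> i \<Longrightarrow> 1 \<le> j \<Longrightarrow> a i j = \<infinity> \<longleftrightarrow> (i, j) \<in> diagram lam"
  using assms by (auto simp: pit_arrays_def)

lemma the_enat_mono: "x \<le> y \<Longrightarrow> y \<noteq> \<infinity> \<Longrightarrow> the_enat x \<le> the_enat y"
  by (cases x; cases y) auto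

text \<open>Monotonicity along rows gives the weak inequality. Monotonicity along columns gives the
  strict one, because the shift \<open>n - Suc k\<close> drops by one from row to row.\<close>

lemma row_arm_in_arms:
  assumes a: "a \<in> pit_arrays n m mu nu lam" and dec: "weakly_decr lam"
  shows "row_arm n m lam a \<in> arms n (shifted n nu) (row_pits n m lam) (row_arm n m lam a 0)"
  unfolding arms_def
proof (intro CollectI conjI allI impI)
  let ?c = "row_pits n m lam"
  have c: "pit_counts n ?c" by (rule pit_counts_row_pits[OF dec])
  have fin: "a (Suc k) (Suc k + d + m - n) \<noteq> \<infinity>" if "?c d \<le> k" "k < n" for d k
    using outside_diagram[OF dec that] pit_arraysD(7)[OF a, of "Suc k" "Suc k + d + m - n"] by simp
  fix d
  show "row_arm n m lam a d \<in> extensional {?c d..<n}" by (simp add: row_arm_def)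
  fix k
  show "row_arm n m lam a (Suc d) k \<le> row_arm n m lam a d k" if k: "?c d \<le> k" "k < n"
  proof -
    have "Suc k + Suc d + m - n = Suc (Suc k + d + m - n)"
      using outside_diagram(1)[OF dec k] by simp
    then have "a (Suc k) (Suc k + Suc d + m - n) \<le> a (Suc k) (Suc k + d + m - n)"
      using pit_arraysD(3)[OF a, of "Suc k" "Suc k + d + m - n"] outside_diagram(1)[OF dec k] by simp
    then have "the_enat (a (Suc k) (Suc k + Suc d + m - n)) \<le> the_enat (a (Suc k) (Suc k + d + m - n))"
      using fin[OF k] by (rule the_enat_mono)
    then show ?thesis
      using k pit_countsD(2)[OF c, of d] by (simp add: row_arm_def)
  qed
  show "row_arm n m lam a d (Suc k) < row_arm n m lam a (Suc d) k" if k: "?c (Suc d) \<le> k" "Suc k < n"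
  proof -
    have k': "k < n" using k by simp
    have "a (Suc (Suc k)) (Suc (Suc k) + d + m - n) \<le> a (Suc k) (Suc k + Suc d + m - n)"
      using pit_arraysD(2)[OF a, of "Suc k" "Suc k + Suc d + m - n"] outside_diagram(1)[OF dec k(1) k'] by simp
    then have "the_enat (a (Suc (Suc k)) (Suc (Suc k) + d + m - n)) \<le> the_enat (a (Suc k) (Suc k + Suc d + m - n))"
      using fin[OF k(1) k'] by (rule the_enat_mono)
    then show ?thesis
      using k pit_countsD(3)[OF c, of d] by (simp add: row_arm_def)
  qed
next
  fix k assume k: "k < n"
  let ?c = "row_pits n m lam"
  have c: "pit_counts n ?c" by (rule pit_counts_row_pits[OF dec])
  obtain D where D: "?c D = 0" using c by (auto simp: pit_counts_def)
  obtain J where J: "\<And>j. j \<ge> J \<Longrightarrow> a (Suc k) j = enat (nu (Suc k))"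
    using pit_arraysD(5)[OF a, of "Suc k"] by (auto simp: eventually_sequentially)
  have "row_arm n m lam a d k = shifted n nu k" if "d \<ge> D + J + n" for d
  proof -
    have "?c d \<le> k" using pit_countsD(4)[OF c, of D d] D that by simp
    moreover have "a (Suc k) (Suc k + d + m - n) = enat (nu (Suc k))" by (rule J) (use that in simp)
    ultimately show ?thesis using k by (simp add: row_arm_def shifted_def)
  qed
  then show "\<forall>\<^sub>F d in sequentially. row_arm n m lam a d k = shifted n nu k"
    by (auto simp: eventually_sequentially)
qed simp

text \<open>
  The array determined by its two arms. Both arms contain the main diagonal, so that the description is
  symmetric under transposition.
\<close>

definition glued ::
    "nat \<Rightarrow> nat \<Rightarrow> (nat \<Rightarrow> nat) \<Rightarrow> (nat \<Rightarrow> nat \<Rightarrow> nat) \<Rightarrow> (nat \<Rightarrow> nat \<Rightarrow> nat) \<Rightarrow> (nat \<Rightarrow> nat \<Rightarrow> enat) \<Rightarrow> bool" where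
  "glued n m lam b b' a \<longleftrightarrow>
     (\<forall>i j. i = 0 \<or> j = 0 \<longrightarrow> a i j = 0) \<and>
     (\<forall>i j. 1 \<le> i \<and> 1 \<le> j \<and> (i, j) \<in> diagram lam \<longrightarrow> a i j = \<infinity>) \<and>
     (\<forall>i j. 1 \<le> i \<and> i \<le> n \<and> 1 \<le> j \<and> i + m \<le> n + j \<and> (i, j) \<notin> diagram lam \<longrightarrow>
        a i j = enat (b (n + j - (m + i)) (i - 1) - (n - i))) \<and>
     (\<forall>i j. 1 \<le> j \<and> j \<le> m \<and> 1 \<le> i \<and> j + n \<le> m + i \<and> (i, j) \<notin> diagram lam \<longrightarrow>
        a i j = enat (b' (m + i - (n + j)) (j - 1) - (m - j))) \<and>
     (\<forall>i j. n < i \<and> m < j \<longrightarrow> a i j = 0)"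

lemma gluedD:
  assumes "glued n m lam b b' a"
  shows "i = 0 \<or> j = 0 \<Longrightarrow> a i j = 0"
    "1 \<le> i \<Longrightarrow> 1 \<le> j \<Longrightarrow> (i, j) \<in> diagram lam \<Longrightarrow> a i j = \<infinity>"
    "1 \<le> i \<Longrightarrow> i \<le> n \<Longrightarrow> 1 \<le> j \<Longrightarrow> i + m \<le> n + j \<Longrightarrow> (i, j) \<notin> diagram lam \<Longrightarrow>
       a i j = enat (b (n + j - (m + i)) (i - 1) - (n - i))"
    "1 \<le> j \<Longrightarrow> j \<le> m \<Longrightarrow> 1 \<le> i \<Longrightarrow> j + n \<le> m + i \<Longrightarrow> (i, j) \<notin> diagram lam \<Longrightarrow>
       a i j = enat (b' (m + i - (n + j)) (j - 1) - (m - j))"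
    "n < i \<Longrightarrow> m < j \<Longrightarrow> a i j = 0"
  using assms unfolding glued_def by auto

lemma glued_transpose:
  assumes "dual_shapes lam lam'" "glued n m lam b b' a"
  shows "glued m n lam' b' b (\<lambda>i j. a j i)"
  unfolding glued_def
proof (intro conjI allI impI)
  note g = gluedD[OF assms(2)] and dual = dual_shapesD(3)[OF assms(1)]
  fix i j
  show "a j i = 0" if "i = 0 \<or> j = 0" using g(1)[of j i] that by auto
  show "a j i = \<infinity>" if "1 \<le> i \<and> 1 \<le> j \<and> (i, j) \<in> diagram lam'"
    using g(2)[of j i] dual[of j i] that by simp
  show "a j i = enat (b' (m + j - (n + i)) (i - 1) - (m - i))"
    if "1 \<le> i \<and> i \<le> m \<and> 1 \<le> j \<and> i + n \<le> m + j \<and> (i, j) \<notin> diagram lam'"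
    using g(4)[of i j] dual[of j i] that by simp
  show "a j i = enat (b (n + i - (m + j)) (j - 1) - (n - j))"
    if "1 \<le> j \<and> j \<le> n \<and> 1 \<le> i \<and> j + m \<le> n + i \<and> (i, j) \<notin> diagram lam'"
    using g(3)[of j i] dual[of j i] that by simp
  show "a j i = 0" if "m < i \<and> n < j" using g(5)[of j i] that by simp
qed

lemma glued_cases:
  fixes i j n m :: nat
  obtains "i = 0 \<or> j = 0"
  | "1 \<le> i" "1 \<le> j" "(i, j) \<in> diagram lam"
  | "1 \<le> i" "i \<le> n" "1 \<le> j" "i + m \<le> n + j" "(i, j) \<notin> diagram lam"
  | "1 \<le> j" "j \<le> m" "1 \<le> i" "j + n \<le> m + i" "(i, j) \<notin> diagram lam"
  | "n < i" "m < j"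
  by (cases "i = 0 \<or> j = 0"; cases "(i, j) \<in> diagram lam"; cases "i \<le> n"; cases "j \<le> m"; linarith)

lemma glued_unique:
  assumes "glued n m lam b b' a" "glued n m lam b b' a'"
  shows "a = a'"
proof (intro ext)
  fix i j
  show "a i j = a' i j"
    by (rule glued_cases[where i = i and j = j and lam = lam and n = n and m = m]; use gluedD[OF assms(1)] gluedD[OF assms(2)] in simp)
qed

text \<open>Monotonicity along rows follows from this by transposition.\<close>

lemma glued_mono:
  assumes g: "glued n m lam b b' a" and dual: "dual_shapes lam lam'"
    and b: "b \<in> arms n N (row_pits n m lam) x" and b': "b' \<in> arms m M (row_pits m n lam') x'"
    and ij: "1 \<le> i" "1 \<le> j"
  shows "a (Suc i) j \<le> a i j"
proof (cases "(i, j) \<in> diagram lam")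
  case True
  then show ?thesis using gluedD(2)[OF g ij] by simp
next
  case False
  note dec = dual_shapesD(1)[OF dual] and dec' = dual_shapesD(2)[OF dual]
  have out: "(Suc i, j) \<notin> diagram lam"
    using False weakly_decrD[OF dec ij(1), of "Suc i"] ij by (auto simp: diagram_def)
  \<comment> \<open>Since both arms contain the main diagonal, two vertical neighbours lie in a
    common arm unless the lower one is in the zero corner; values of different arms are never
    compared.\<close>
  consider "j \<le> m" "j + n \<le> m + i" | "Suc i \<le> n" "Suc i + m \<le> n + j" | "i = n" "m < j" | "n < i" "m < j"
    by linarith
  then show ?thesis
  proof cases
    case 1
    have "(j, i) \<notin> diagram lam'"
      using False dual_shapesD(3)[OF dual ij] by simp
    then have "row_pits m n lam' (m + i - (n + j)) \<le> j - 1"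
      using 1 ij by (intro row_pits_outside[OF dec']) auto
    then have "b' (Suc (m + i - (n + j))) (j - 1) \<le> b' (m + i - (n + j)) (j - 1)"
      using 1 ij by (intro armsD(3)[OF b']) auto
    then have "b' (Suc (m + i - (n + j))) (j - 1) - (m - j) \<le> b' (m + i - (n + j)) (j - 1) - (m - j)"
      by (rule diff_le_mono)
    moreover have "m + Suc i - (n + j) = Suc (m + i - (n + j))" using 1 by simp
    ultimately show ?thesis
      using gluedD(4)[OF g ij(2) 1(1) ij(1) 1(2) False] gluedD(4)[OF g ij(2) 1(1) _ _ out] 1 by simp
  next
    case 2
    have "row_pits n m lam (n + j - (m + i)) \<le> i - 1"
      using 2 ij False by (intro row_pits_outside[OF dec]) auto
    moreover have d: "n + j - (m + i) = Suc (n + j - (m + Suc i))" using 2 by simp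
    ultimately have "b (n + j - (m + Suc i)) (Suc (i - 1)) < b (n + j - (m + i)) (i - 1)"
      using 2 ij unfolding d by (intro armsD(4)[OF b]) auto
    then have "b (n + j - (m + Suc i)) i - (n - Suc i) \<le> b (n + j - (m + i)) (i - 1) - (n - i)"
      using 2 ij by simp
    then show ?thesis
      using gluedD(3)[OF g _ 2(1) ij(2) 2(2) out] gluedD(3)[OF g ij(1) _ ij(2) _ False] 2 by simp
  next
    case 3
    then show ?thesis using gluedD(5)[OF g, of "Suc i" j] by simp
  next
    case 4
    then show ?thesis using gluedD(5)[OF g, of "Suc i" j] by simp
  qed
qed

lemma glued_eventually:
  assumes g: "glued n m lam b b' a"
    and nu: "\<And>i. n < i \<Longrightarrow> nu i = 0"
    and b: "b \<in> arms n (shifted n nu) (row_pits n m lam) x" and i: "1 \<le> i"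
  shows "\<forall>\<^sub>F j in sequentially. a i j = enat (nu i)"
proof (cases "i \<le> n")
  case True
  have "\<forall>\<^sub>F d in sequentially. b d (i - 1) = shifted n nu (i - 1)"
    by (rule armsD(5)[OF b]) (use True i in simp)
  then obtain D where D: "\<And>d. d \<ge> D \<Longrightarrow> b d (i - 1) = nu i + (n - i)"
    using i by (auto simp: eventually_sequentially shifted_def)
  have "a i j = enat (nu i)" if "j \<ge> D + m + i + lam i + 1" for j
  proof -
    have "(i, j) \<notin> diagram lam" using that by (simp add: diagram_def)
    then have "a i j = enat (b (n + j - (m + i)) (i - 1) - (n - i))"
      using that True i by (intro gluedD(3)[OF g]) auto
    also have "b (n + j - (m + i)) (i - 1) = nu i + (n - i)"
      by (rule D) (use that in simp)
    finally show ?thesis by simp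
  qed
  then show ?thesis by (auto simp: eventually_sequentially)
next
  case False
  then have "a i j = enat (nu i)" if "j \<ge> Suc m" for j
    using gluedD(5)[OF g, of i j] nu that by (simp add: zero_enat_def)
  then show ?thesis by (auto simp: eventually_sequentially)
qed

lemma glued_in_pit_arrays:
  assumes g: "glued n m lam b b' a" and dual: "dual_shapes lam lam'"
    and nu: "\<And>i. n < i \<Longrightarrow> nu i = 0" and mu: "\<And>j. m < j \<Longrightarrow> mu j = 0"
    and b: "b \<in> arms n (shifted n nu) (row_pits n m lam) x"
    and b': "b' \<in> arms m (shifted m mu) (row_pits m n lam') x'"
  shows "a \<in> pit_arrays n m mu nu lam"
proof -
  have gT: "glued m n lam' b' b (\<lambda>i j. a j i)" by (rule glued_transpose[OF dual g])
  have finite_entry: "a i j = \<infinity> \<longleftrightarrow> (i, j) \<in> diagram lam" if ij: "1 \<le> i" "1 \<le> j" for i j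
    by (rule glued_cases[where i = i and j = j and lam = lam and n = n and m = m];
        use gluedD(1,2,3,5)[OF g, of i j] gluedD(4)[OF g, of j i] ij in \<open>cases "(i, j) \<in> diagram lam"; simp\<close>)
  have "a (i + 1) j \<le> a i j \<and> a i (j + 1) \<le> a i j" if "1 \<le> i" "1 \<le> j" for i j
    using glued_mono[OF g dual b b' that] glued_mono[OF gT dual_shapes_sym[OF dual] b' b that(2,1)] by simp
  moreover have "\<forall>\<^sub>F j in sequentially. a i j = enat (nu i)" if "1 \<le> i" for i
    by (rule glued_eventually[OF g nu b that])
  moreover have "\<forall>\<^sub>F i in sequentially. a i j = enat (mu j)" if "1 \<le> j" for j
    by (rule glued_eventually[OF gT mu b' that])
  moreover have "a (n + 1) (m + 1) = 0" by (rule gluedD(5)[OF g]) auto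
  moreover have "a i j = 0" if "i = 0 \<or> j = 0" for i j by (rule gluedD(1)[OF g that])
  ultimately show ?thesis
    unfolding pit_arrays_def using finite_entry by blast
qed

lemma pit_array_glued_row:
  assumes a: "a \<in> pit_arrays n m mu nu lam" and dec: "weakly_decr lam"
    and ij: "1 \<le> i" "i \<le> n" "1 \<le> j" "i + m \<le> n + j" "(i, j) \<notin> diagram lam"
  shows "a i j = enat (row_arm n m lam a (n + j - (m + i)) (i - 1) - (n - i))"
proof -
  have c: "row_pits n m lam (n + j - (m + i)) \<le> i - 1"
    by (rule row_pits_outside[OF dec ij])
  have "Suc (i - 1) = i" "Suc (i - 1) + (n + j - (m + i)) + m - n = j" using ij by auto
  moreover have "i - 1 < n" using ij by simp
  ultimately have "row_arm n m lam a (n + j - (m + i)) (i - 1) = the_enat (a i j) + (n - i)"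
    using c by (simp add: row_arm_def)
  moreover have "a i j \<noteq> \<infinity>" using pit_arraysD(7)[OF a] ij by simp
  ultimately show ?thesis by (cases "a i j") auto
qed

lemma pit_array_glued:
  assumes a: "a \<in> pit_arrays n m mu nu lam" and dual: "dual_shapes lam lam'"
    and corner: "lam (n + 1) < m + 1"
  shows "glued n m lam (row_arm n m lam a) (row_arm m n lam' (\<lambda>i j. a j i)) a"
  unfolding glued_def
proof (intro conjI allI impI)
  note aT = pit_arrays_transpose[OF dual a]
  fix i j
  show "a i j = 0" if "i = 0 \<or> j = 0" by (rule pit_arraysD(1)[OF a that])
  show "a i j = \<infinity>" if "1 \<le> i \<and> 1 \<le> j \<and> (i, j) \<in> diagram lam"
    using pit_arraysD(7)[OF a] that by blast
  show "a i j = enat (row_arm n m lam a (n + j - (m + i)) (i - 1) - (n - i))"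
    if "1 \<le> i \<and> i \<le> n \<and> 1 \<le> j \<and> i + m \<le> n + j \<and> (i, j) \<notin> diagram lam"
    using that by (intro pit_array_glued_row[OF a dual_shapesD(1)[OF dual]]) auto
  show "a i j = enat (row_arm m n lam' (\<lambda>i j. a j i) (m + i - (n + j)) (j - 1) - (m - j))"
    if "1 \<le> j \<and> j \<le> m \<and> 1 \<le> i \<and> j + n \<le> m + i \<and> (i, j) \<notin> diagram lam"
    using that dual_shapesD(3)[OF dual, of i j]
    by (intro pit_array_glued_row[OF aT dual_shapesD(2)[OF dual]]) auto
  show "a i j = 0" if ij: "n < i \<and> m < j"
  proof -
    have "a (Suc n + k) j' \<le> a (Suc n) j'" if "1 \<le> j'" for k j'
    proof (induction k)
      case (Suc k)
      then show ?case using pit_arraysD(2)[OF a, of "Suc n + k" j'] that by (auto intro: order_trans)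
    qed simp
    from this[of j "i - Suc n"] have "a i j \<le> a (Suc n) j" using ij by simp
    also have "a (Suc n) (Suc m + k) \<le> a (Suc n) (Suc m)" for k
    proof (induction k)
      case (Suc k)
      then show ?case using pit_arraysD(3)[OF a, of "Suc n" "Suc m + k"] by (auto intro: order_trans)
    qed simp
    from this[of "j - Suc m"] have "a (Suc n) j \<le> a (Suc n) (Suc m)" using ij by simp
    also have "a (Suc n) (Suc m) = 0" by (rule pit_arraysD(4)[OF a])
    finally show ?thesis by simp
  qed
qed

lemma row_arm_glued:
  assumes g: "glued n m lam b b' a" and dec: "weakly_decr lam"
    and b: "b \<in> arms n (shifted n nu) (row_pits n m lam) x"
  shows "row_arm n m lam a = b"
proof
  fix d
  have c: "pit_counts n (row_pits n m lam)" by (rule pit_counts_row_pits[OF dec])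
  show "row_arm n m lam a d = b d"
  proof (rule extensionalityI)
    show "row_arm n m lam a d \<in> extensional {row_pits n m lam d..<n}" by (simp add: row_arm_def)
    show "b d \<in> extensional {row_pits n m lam d..<n}" by (rule armsD(2)[OF b])
    fix k assume "k \<in> {row_pits n m lam d..<n}"
    then have k: "row_pits n m lam d \<le> k" "k < n" by auto
    note out = outside_diagram[OF dec k]
    define j where "j = Suc k + d + m - n"
    have j: "1 \<le> j" "Suc k + m \<le> n + j" "n + j - (m + Suc k) = d" using out(1) by (auto simp: j_def)
    have "a (Suc k) j = enat (b (n + j - (m + Suc k)) (Suc k - 1) - (n - Suc k))"
      by (rule gluedD(3)[OF g]) (use k j out(2) in \<open>auto simp: j_def\<close>)
    then have "a (Suc k) j = enat (b d k - (n - Suc k))" unfolding j(3) by simp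
    \<comment> \<open>This makes the subtraction of the shift in \<open>glued\<close> exact, so that
      adding it back recovers \<open>b d k\<close>.\<close>
    moreover have "n - Suc k \<le> b d k"
      using arms_ge[OF b c k] by (simp add: shifted_def)
    ultimately show "row_arm n m lam a d k = b d k"
      using k by (simp add: row_arm_def j_def)
  qed
qed

section \<open>The main diagonal and the correspondence of arrays with pairs of arms\<close>

lemma eq_if_less_iff:
  fixes a b n :: nat
  assumes "\<And>k. k < n \<Longrightarrow> k < a \<longleftrightarrow> k < b" "a \<le> n" "b \<le> n"
  shows "a = b"
  using assms(1)[of a] assms(1)[of b] assms(2,3) by (cases a b rule: linorder_cases) auto

text \<open>At t = n - (k + 1) the condition that defines \<open>pit_rank\<close> says exactly that
  \<open>reach\<close> is nonnegative in row k + 1. So the rank is the number of finite entries on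
  the main diagonal.\<close>

lemma row_pits_0:
  assumes "weakly_decr lam"
  shows "row_pits n m lam 0 = n - pit_rank n m lam"
proof -
  let ?P = "\<lambda>t. t \<le> n \<and> (t = n \<or> int (lam (n - t)) \<ge> int m - int t)"
  let ?r = "pit_rank n m lam"
  have r: "?P ?r" unfolding pit_rank_def by (rule LeastI[of ?P n]) simp
  have least: "?r \<le> t" if "?P t" for t
    unfolding pit_rank_def by (rule Least_le[of ?P]) (rule that)
  have "k < row_pits n m lam 0 \<longleftrightarrow> k < n - ?r" if k: "k < n" for k
  proof -
    have "0 \<le> reach n m lam k \<longleftrightarrow> k < n - ?r"
    proof
      assume "0 \<le> reach n m lam k"
      then have "?P (n - Suc k)" using k by (simp add: reach_def of_nat_diff)
      from least[OF this] show "k < n - ?r" using k by simp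
    next
      assume k': "k < n - ?r"
      then have "lam (n - ?r) \<le> lam (Suc k)" by (intro weakly_decrD[OF assms]) auto
      moreover have "int m - int ?r \<le> int (lam (n - ?r))" using r k' by auto
      ultimately show "0 \<le> reach n m lam k" using k' by (simp add: reach_def)
    qed
    then show ?thesis using row_pits_iff[OF assms k, of m 0] by simp
  qed
  then show ?thesis
    by (rule eq_if_less_iff[of n]) (auto simp: row_pits_le)
qed

text \<open>The main diagonal has the same infinite entries after transposition. Positions that
  would lie above the first row count as infinite, which agrees with r <= n.\<close>

lemma row_pits_0_dual:
  assumes "dual_shapes lam lam'"
  shows "row_pits m n lam' 0 = m - pit_rank n m lam"
proof -
  let ?r = "pit_rank n m lam"
  note dec = dual_shapesD(1)[OF assms] and dec' = dual_shapesD(2)[OF assms]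
  have r: "?r \<le> n" "?r \<le> m" using pit_rank_le[of n m lam] by auto
  have "l < row_pits m n lam' 0 \<longleftrightarrow> l < m - ?r" if l: "l < m" for l
  proof (cases "n + Suc l \<le> m")
    case True
    then have "0 \<le> reach m n lam' l" by (simp add: reach_def)
    then show ?thesis using row_pits_iff[OF dec' l, of n 0] True r by simp
  next
    case False
    define i where "i = n + Suc l - m"
    have i: "1 \<le> i" "i \<le> n" using False l by (auto simp: i_def)
    have "0 \<le> reach m n lam' l \<longleftrightarrow> (Suc l, i) \<in> diagram lam'"
      using False l by (auto simp: reach_def diagram_def i_def)
    also have "\<dots> \<longleftrightarrow> (i, Suc l) \<in> diagram lam"
      using dual_shapesD(3)[OF assms, of i "Suc l"] i by simp
    also have "\<dots> \<longleftrightarrow> 0 \<le> reach n m lam (i - 1)"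
    proof -
      have "int i = int n + int (Suc l) - int m" "Suc (i - 1) = i"
        using False i by (simp_all add: i_def of_nat_diff)
      then show ?thesis
        unfolding reach_def using i by (simp only:) (auto simp: diagram_def)
    qed
    also have "\<dots> \<longleftrightarrow> i - 1 < n - ?r"
      using row_pits_iff[OF dec, of "i - 1" n m 0] i by (simp add: row_pits_0[OF dec])
    finally show ?thesis
      using row_pits_iff[OF dec' l, of n 0] False l r by (auto simp: i_def)
  qed
  then show ?thesis
    by (rule eq_if_less_iff[of m]) (auto simp: row_pits_le)
qed

text \<open>On the main diagonal the row arm takes precedence, so \<open>glued\<close> holds only if
  both arms agree there.\<close>

definition glue ::
    "nat \<Rightarrow> nat \<Rightarrow> (nat \<Rightarrow> nat) \<Rightarrow> (nat \<Rightarrow> nat \<Rightarrow> nat) \<Rightarrow> (nat \<Rightarrow> nat \<Rightarrow> nat) \<Rightarrow> nat \<Rightarrow> nat \<Rightarrow> enat" where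
  "glue n m lam b b' i j =
     (if i = 0 \<or> j = 0 then 0 else if (i, j) \<in> diagram lam then \<infinity>
      else if i \<le> n \<and> i + m \<le> n + j then enat (b (n + j - (m + i)) (i - 1) - (n - i))
      else if j \<le> m then enat (b' (m + i - (n + j)) (j - 1) - (m - j)) else 0)"

lemma glued_glue:
  assumes "weakly_decr lam" "lam (n + 1) < m + 1"
    and diag: "\<And>i j. 1 \<le> i \<Longrightarrow> 1 \<le> j \<Longrightarrow> i \<le> n \<Longrightarrow> i + m = n + j \<Longrightarrow> (i, j) \<notin> diagram lam \<Longrightarrow> b 0 (i - 1) = b' 0 (j - 1)"
  shows "glued n m lam b b' (glue n m lam b b')"
  unfolding glued_def
proof (intro conjI allI impI)
  fix i j
  show "glue n m lam b b' i j = enat (b' (m + i - (n + j)) (j - 1) - (m - j))"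
    if "1 \<le> j \<and> j \<le> m \<and> 1 \<le> i \<and> j + n \<le> m + i \<and> (i, j) \<notin> diagram lam"
  proof (cases "i + m = n + j")
    case True
    then have "i \<le> n" "n - i = m - j" using that by auto
    then show ?thesis using True diag[of i j] that by (simp add: glue_def add.commute)
  next
    case False
    then have "\<not> i + m \<le> n + j" using that by auto
    then show ?thesis using that by (simp add: glue_def)
  qed
  show "glue n m lam b b' i j = 0" if "n < i \<and> m < j"
  proof -
    \<comment> \<open>The hypothesis on \<open>lam (n + 1)\<close> keeps the diagram, and with it
      the value \<open>\<infinity>\<close>, out of the corner.\<close>
    have "lam i \<le> lam (n + 1)" using that by (intro weakly_decrD[OF assms(1)]) auto
    then show ?thesis using assms(2) that by (simp add: glue_def diagram_def)
  qed
qed (auto simp: glue_def)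

text \<open>The finite entries of the main diagonal are its last \<open>r\<close> ones; below
  \<open>n - r\<close> the entries are infinite and left undefined, as in
  \<open>arms\<close>.\<close>

definition diag_state :: "nat \<Rightarrow> nat \<Rightarrow> nat list \<Rightarrow> nat \<Rightarrow> nat" where
  "diag_state n r A = (\<lambda>k\<in>{n - r..<n}. A ! (k - (n - r)))"

lemma diag_state_strict:
  assumes "A \<in> decreasing_tuples r" "r \<le> n"
  shows "strict_from (n - r) n (diag_state n r A)"
  unfolding strict_from_def
proof (intro allI impI)
  fix k assume "n - r \<le> k" "Suc k < n"
  moreover from this have "A ! (Suc k - (n - r)) < A ! (k - (n - r))"
    using assms(2) by (intro decreasing_tuplesD(5)[OF assms(1)]) auto
  ultimately show "diag_state n r A (Suc k) < diag_state n r A k"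
    by (simp add: diag_state_def)
qed

lemma arms_strict:
  assumes "b \<in> arms n N c x" "pit_counts n c" "c 0 \<le> k" "Suc k < n"
  shows "b 0 (Suc k) < b 0 k"
proof -
  have "b 0 (Suc k) < b (Suc 0) k"
    by (rule armsD(4)[OF assms(1)]) (use assms pit_countsD(2)[OF assms(2), of 0] in auto)
  also have "\<dots> \<le> b 0 k"
    by (rule armsD(3)[OF assms(1)]) (use assms in auto)
  finally show ?thesis .
qed

lemma glued_glue_arms:
  assumes dual: "dual_shapes lam lam'" and corner: "lam (n + 1) < m + 1"
  defines "r \<equiv> pit_rank n m lam"
  assumes "A \<in> decreasing_tuples r"
    and b: "b \<in> arms n N (row_pits n m lam) (diag_state n r A)"
    and b': "b' \<in> arms m M (row_pits m n lam') (diag_state m r A)"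
  shows "glued n m lam b b' (glue n m lam b b')"
proof (rule glued_glue[OF dual_shapesD(1)[OF dual] corner])
  note dec = dual_shapesD(1)[OF dual]
  have r: "r \<le> n" "r \<le> m" using pit_rank_le[of n m lam] by (auto simp: r_def)
  have c0: "row_pits n m lam 0 = n - r" using row_pits_0[OF dec] by (simp add: r_def)
  fix i j assume ij: "1 \<le> i" "1 \<le> j" "i \<le> n" "i + m = n + j" "(i, j) \<notin> diagram lam"
  have "row_pits n m lam (n + j - (m + i)) \<le> i - 1"
    using ij by (intro row_pits_outside[OF dec]) auto
  then have "n - r \<le> i - 1" using ij c0 by (simp add: add.commute)
  moreover have "i - 1 < n" "j - 1 < m" "m - r \<le> j - 1" "i - 1 - (n - r) = j - 1 - (m - r)"
    using ij r \<open>n - r \<le> i - 1\<close> by linarith+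
  ultimately show "b 0 (i - 1) = b' 0 (j - 1)"
    using ij by (simp add: armsD(1)[OF b] armsD(1)[OF b'] diag_state_def)
qed

text \<open>An array amounts to its main diagonal and two arms that start from it; the corner beyond
  (n, m) carries no information because it is zero.\<close>

lemma bij_betw_glue:
  fixes n m :: nat and nu mu lam lam' :: "nat \<Rightarrow> nat"
  assumes dual: "dual_shapes lam lam'"
    and nu: "\<And>i. n < i \<Longrightarrow> nu i = 0" and mu: "\<And>j. m < j \<Longrightarrow> mu j = 0"
    and corner: "lam (n + 1) < m + 1"
  defines "r \<equiv> pit_rank n m lam"
  shows "bij_betw (\<lambda>(A, b, b'). glue n m lam b b')
    (SIGMA A : decreasing_tuples r.
       arms n (shifted n nu) (row_pits n m lam) (diag_state n r A) \<times>
       arms m (shifted m mu) (row_pits m n lam') (diag_state m r A))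
    (pit_arrays n m mu nu lam)" (is "bij_betw ?h ?S _")
proof (rule bij_betw_byWitness[where f' = "\<lambda>a. (map (\<lambda>t. row_arm n m lam a 0 (n - r + t)) [0..<r],
      row_arm n m lam a, row_arm m n lam' (\<lambda>i j. a j i))"])
  note dec = dual_shapesD(1)[OF dual] and dec' = dual_shapesD(2)[OF dual]
  have r: "r \<le> n" "r \<le> m" using pit_rank_le[of n m lam] by (auto simp: r_def)
  have c0: "row_pits n m lam 0 = n - r" "row_pits m n lam' 0 = m - r"
    using row_pits_0[OF dec] row_pits_0_dual[OF dual] by (auto simp: r_def)
  note glued = glued_glue_arms[OF dual corner, folded r_def]
  show "\<forall>s\<in>?S. (map (\<lambda>t. row_arm n m lam (?h s) 0 (n - r + t)) [0..<r],
      row_arm n m lam (?h s), row_arm m n lam' (\<lambda>i j. ?h s j i)) = s"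
  proof
    fix s assume "s \<in> ?S"
    then obtain A b b' where s: "s = (A, b, b')" and A: "A \<in> decreasing_tuples r"
      and b: "b \<in> arms n (shifted n nu) (row_pits n m lam) (diag_state n r A)"
      and b': "b' \<in> arms m (shifted m mu) (row_pits m n lam') (diag_state m r A)" by auto
    note g = glued[OF A b b']
    have 1: "row_arm n m lam (glue n m lam b b') = b"
      by (rule row_arm_glued[OF g dec b])
    have 2: "row_arm m n lam' (\<lambda>i j. glue n m lam b b' j i) = b'"
      by (rule row_arm_glued[OF glued_transpose[OF dual g] dec' b'])
    have "map (\<lambda>t. b 0 (n - r + t)) [0..<r] = A"
      using decreasing_tuplesD(1)[OF A] r
      by (intro nth_equalityI) (auto simp: armsD(1)[OF b] diag_state_def)
    then show "(map (\<lambda>t. row_arm n m lam (?h s) 0 (n - r + t)) [0..<r],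
      row_arm n m lam (?h s), row_arm m n lam' (\<lambda>i j. ?h s j i)) = s"
      by (simp add: s 1 2)
  qed
  show "?h ` ?S \<subseteq> pit_arrays n m mu nu lam"
  proof
    fix a assume "a \<in> ?h ` ?S"
    then obtain A b b' where a: "a = glue n m lam b b'" and A: "A \<in> decreasing_tuples r"
      and b: "b \<in> arms n (shifted n nu) (row_pits n m lam) (diag_state n r A)"
      and b': "b' \<in> arms m (shifted m mu) (row_pits m n lam') (diag_state m r A)" by auto
    show "a \<in> pit_arrays n m mu nu lam"
      unfolding a by (rule glued_in_pit_arrays[OF glued[OF A b b'] dual nu mu b b'])
  qed
  have inv: "(map (\<lambda>t. row_arm n m lam a 0 (n - r + t)) [0..<r],
      row_arm n m lam a, row_arm m n lam' (\<lambda>i j. a j i)) \<in> ?S"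
    if a: "a \<in> pit_arrays n m mu nu lam" for a
  proof -
    define A where "A = map (\<lambda>t. row_arm n m lam a 0 (n - r + t)) [0..<r]"
    note b = row_arm_in_arms[OF a dec] and b' = row_arm_in_arms[OF pit_arrays_transpose[OF dual a] dec']
    have A_nth: "A ! t = row_arm n m lam a 0 (n - r + t)" if "t < r" for t
      using that by (simp add: A_def)
    have step: "A ! Suc s < A ! s" if s: "Suc s < r" for s
    proof -
      have "row_arm n m lam a 0 (Suc (n - r + s)) < row_arm n m lam a 0 (n - r + s)"
        by (rule arms_strict[OF b pit_counts_row_pits[OF dec]]) (use c0 r s in linarith)+
      then show ?thesis
        unfolding A_nth[OF s] A_nth[OF Suc_lessD[OF s]] add_Suc_right .
    qed
    have "A ! t < A ! s" if "s < t" "t < r" for s t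
      using that
    proof (induction t)
      case (Suc t)
      then show ?case using step[of t] by (cases "s = t") auto
    qed simp
    then have A: "A \<in> decreasing_tuples r"
      by (auto simp: decreasing_tuples_def sorted_wrt_iff_nth_less A_def)
    have "row_arm n m lam a 0 = diag_state n r A"
    proof (rule extensionalityI)
      show "row_arm n m lam a 0 \<in> extensional {n - r..<n}" "diag_state n r A \<in> extensional {n - r..<n}"
        by (simp_all add: row_arm_def diag_state_def c0)
      show "row_arm n m lam a 0 k = diag_state n r A k" if "k \<in> {n - r..<n}" for k
      proof -
        have "k - (n - r) < r" "n - r + (k - (n - r)) = k" using that r by auto
        then show ?thesis using that A_nth[of "k - (n - r)"] by (simp add: diag_state_def)
      qed
    qed
    moreover have "row_arm m n lam' (\<lambda>i j. a j i) 0 = diag_state m r A"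
    proof (rule extensionalityI)
      show "row_arm m n lam' (\<lambda>i j. a j i) 0 \<in> extensional {m - r..<m}" "diag_state m r A \<in> extensional {m - r..<m}"
        by (simp_all add: row_arm_def diag_state_def c0)
      fix k assume k: "k \<in> {m - r..<m}"
      \<comment> \<open>Index \<open>k\<close> on the diagonal of the transposed array and
        \<open>k'\<close> on that of the array denote the same position, and the shifts
        \<open>m - Suc k\<close> and \<open>n - Suc k'\<close> agree, so both arms start from the
        same tuple.\<close>
      define k' where "k' = n - r + (k - (m - r))"
      have k': "k' < n" "n - r \<le> k'" "Suc k + n - m = Suc k'" "Suc k' + m - n = Suc k" "m - Suc k = n - Suc k'"
        using k r by (auto simp: k'_def)
      have "diag_state m r A k = row_arm n m lam a 0 k'"
      proof -
        have "k - (m - r) < r" using k r by auto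
        from A_nth[OF this] show ?thesis using k by (simp add: diag_state_def k'_def)
      qed
      then show "row_arm m n lam' (\<lambda>i j. a j i) 0 k = diag_state m r A k"
        using k k' by (simp add: row_arm_def c0)
    qed
    ultimately show ?thesis
      unfolding A_def[symmetric] using A b b' by simp
  qed
  then show "(\<lambda>a. (map (\<lambda>t. row_arm n m lam a 0 (n - r + t)) [0..<r],
      row_arm n m lam a, row_arm m n lam' (\<lambda>i j. a j i))) ` pit_arrays n m mu nu lam \<subseteq> ?S"
    by auto
  show "\<forall>a\<in>pit_arrays n m mu nu lam. ?h (map (\<lambda>t. row_arm n m lam a 0 (n - r + t)) [0..<r],
      row_arm n m lam a, row_arm m n lam' (\<lambda>i j. a j i)) = a"
  proof
    fix a assume a: "a \<in> pit_arrays n m mu nu lam"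
    from inv[OF a] obtain A where "A \<in> decreasing_tuples r"
      "row_arm n m lam a \<in> arms n (shifted n nu) (row_pits n m lam) (diag_state n r A)"
      "row_arm m n lam' (\<lambda>i j. a j i) \<in> arms m (shifted m mu) (row_pits m n lam') (diag_state m r A)"
      by auto
    from glued_unique[OF glued[OF this] pit_array_glued[OF a dual corner]]
    show "?h (map (\<lambda>t. row_arm n m lam a 0 (n - r + t)) [0..<r],
      row_arm n m lam a, row_arm m n lam' (\<lambda>i j. a j i)) = a" by simp
  qed
qed

section \<open>The weight of an array in terms of its arms\<close>

lemma infsum_eq_finite_sum:
  fixes f :: "'b \<Rightarrow> 'a::{comm_monoid_add,t2_space}"
  assumes "finite F" "F \<subseteq> S" "\<And>s. s \<in> S \<Longrightarrow> s \<notin> F \<Longrightarrow> f s = 0"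
  shows "infsum f S = sum f F"
proof -
  have "infsum f S = infsum f F"
    by (rule infsum_cong_neutral) (use assms in auto)
  then show ?thesis using assms(1) by simp
qed

text \<open>The offset \<open>e\<close> selects the first diagonal to be counted: 0 for the row
  part, which owns the main diagonal, and 1 for the column part, treated by transposition.
  Reindexing positions by row and diagonal makes the sum finite.\<close>

lemma infsum_row_arm:
  assumes a: "a \<in> pit_arrays n m mu nu lam" and dec: "weakly_decr lam"
    and corner: "\<And>i j. n < i \<Longrightarrow> m < j \<Longrightarrow> a i j = 0" and nu: "\<And>i. n < i \<Longrightarrow> nu i = 0"
  shows "(\<Sum>\<^sub>\<infinity>(i, j)\<in>{(i, j). 1 \<le> i \<and> 1 \<le> j \<and> int i - int n + int e \<le> int j - int m \<and> (i, j) \<notin> diagram lam}.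
      int (the_enat (a i j)) - int (nu i)) =
    int (\<Sum>k<n. fsum (\<lambda>d. arm_excess (shifted n nu) (row_pits n m lam) (row_arm n m lam a) k (d + e)))"
    (is "infsum ?f ?S = _")
proof -
  let ?c = "row_pits n m lam" and ?b = "row_arm n m lam a"
  define E where "E k d = arm_excess (shifted n nu) ?c ?b k (d + e)" for k d
  define h where "h = (\<lambda>(k, d). (Suc k, Suc k + (d + e) + m - n))"
  define D where "D = (SIGMA k : {..<n}. {d. E k d \<noteq> 0})"
  have arm: "?b \<in> arms n (shifted n nu) ?c (?b 0)" by (rule row_arm_in_arms[OF a dec])
  have c: "pit_counts n ?c" by (rule pit_counts_row_pits[OF dec])
  have ge: "shifted n nu k \<le> ?b d k" if "?c d \<le> k" "k < n" for d k
    by (rule arms_ge[OF arm c that])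
  have finD: "finite D"
    unfolding D_def
  proof (intro finite_SigmaI)
    fix k assume k: "k \<in> {..<n}"
    have "{d. E k d \<noteq> 0} = (\<lambda>d. d + e) -` {d. arm_excess (shifted n nu) ?c ?b k d \<noteq> 0}"
      by (auto simp: E_def)
    also have "finite \<dots>"
      by (rule finite_vimageI[OF finite_arm_excess[OF arm]]) (use k in \<open>auto simp: inj_on_def\<close>)
    finally show "finite {d. E k d \<noteq> 0}" .
  qed simp
  have D: "?c (d + e) \<le> k" "k < n" if "(k, d) \<in> D" for k d
    using that by (auto simp: D_def E_def arm_excess_def split: if_splits)
  have inj: "inj_on h D"
    using outside_diagram(1)[OF dec D] by (fastforce simp: inj_on_def h_def)
  have E_eq: "int (E (i - 1) d) = ?f (i, j)"
    if ij: "1 \<le> i" "i \<le> n" "1 \<le> j" "i + m \<le> n + j" "(i, j) \<notin> diagram lam"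
      and d: "d + e = n + j - (m + i)" for i j d
  proof -
    have k: "?c (d + e) \<le> i - 1" "i - 1 < n"
      unfolding d using row_pits_outside[OF dec ij] ij by auto
    have "Suc (i - 1) = i" "Suc (i - 1) + (d + e) + m - n = j" using ij d by auto
    then have "?b (d + e) (i - 1) = the_enat (a i j) + (n - i)" "shifted n nu (i - 1) = nu i + (n - i)"
      using k by (simp_all add: row_arm_def shifted_def)
    moreover have "shifted n nu (i - 1) \<le> ?b (d + e) (i - 1)" by (rule ge[OF k])
    ultimately show ?thesis using k(1) by (simp add: E_def arm_excess_def of_nat_diff)
  qed
  have hD: "fst (h p) = Suc (fst p) \<and> h p \<in> ?S \<and> ?f (h p) = int (case p of (k, d) \<Rightarrow> E k d)" if "p \<in> D" for p
  proof -
    obtain k d where p: "p = (k, d)" by (cases p)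
    note kd = D[OF that[unfolded p]]
    note out = outside_diagram[OF dec kd]
    have "int (E (Suc k - 1) d) = ?f (Suc k, Suc k + (d + e) + m - n)"
      by (rule E_eq) (use kd out in auto)
    then show ?thesis using out by (auto simp: p h_def)
  qed
  have "infsum ?f ?S = sum ?f (h ` D)"
  proof (rule infsum_eq_finite_sum)
    show "finite (h ` D)" using finD by simp
    show "h ` D \<subseteq> ?S"
    proof (rule image_subsetI)
      fix p assume "p \<in> D"
      from hD[OF this] show "h p \<in> ?S" by (elim conjE)
    qed
    fix s assume s: "s \<in> ?S" "s \<notin> h ` D"
    obtain i j where ij: "s = (i, j)" by (cases s)
    show "?f s = 0"
    proof (cases "i \<le> n")
      case False
      then have "m < j" using s ij by auto
      then show ?thesis using False corner[of i j] nu[of i] by (simp add: ij zero_enat_def)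
    next
      case True
      define d where "d = n + j - (m + i) - e"
      have *: "d + e = n + j - (m + i)" "1 \<le> i" "1 \<le> j" "i + m \<le> n + j" "(i, j) \<notin> diagram lam"
        using s True by (auto simp: ij d_def)
      then have eq: "int (E (i - 1) d) = ?f (i, j)"
        using True by (intro E_eq) auto
      have "E (i - 1) d = 0"
      proof (rule ccontr)
        assume "E (i - 1) d \<noteq> 0"
        then have "(i - 1, d) \<in> D" using True * by (auto simp: D_def)
        moreover have "h (i - 1, d) = s" using * by (auto simp: h_def ij)
        ultimately show False using s(2) by (metis image_eqI)
      qed
      then show ?thesis using eq ij by simp
    qed
  qed
  also have "\<dots> = (\<Sum>p\<in>D. ?f (h p))"
    using inj by (simp add: sum.reindex)
  also have "\<dots> = (\<Sum>p\<in>D. int (case p of (k, d) \<Rightarrow> E k d))"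
  proof (rule sum.cong[OF refl])
    fix p assume "p \<in> D"
    from hD[OF this] show "?f (h p) = int (case p of (k, d) \<Rightarrow> E k d)" by (elim conjE)
  qed
  also have "\<dots> = int (\<Sum>k<n. \<Sum>d | E k d \<noteq> 0. E k d)"
  proof -
    have "finite {d. E k d \<noteq> 0}" if "k < n" for k
    proof -
      have "{d. E k d \<noteq> 0} \<subseteq> snd ` D" using that by (force simp: D_def)
      then show ?thesis using finD finite_subset by blast
    qed
    then have "(\<Sum>k<n. \<Sum>d | E k d \<noteq> 0. E k d) = (\<Sum>(k, d)\<in>D. E k d)"
      unfolding D_def by (intro sum.Sigma) auto
    then show ?thesis by simp
  qed
  finally show ?thesis by (simp add: fsum_def E_def)
qed

text \<open>The condition i - n <= j - m assigns the main diagonal to the row part, so its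
  contribution relative to \<open>nu\<close> is split off and the two arm weights count the
  remaining diagonals.\<close>

lemma pit_weight_arms:
  assumes a: "a \<in> pit_arrays n m mu nu lam" and dual: "dual_shapes lam lam'"
    and nu: "\<And>i. n < i \<Longrightarrow> nu i = 0" and mu: "\<And>j. m < j \<Longrightarrow> mu j = 0"
    and corner: "lam (n + 1) < m + 1"
  shows "pit_weight n m mu nu lam a =
    (\<Sum>k = row_pits n m lam 0..<n. int (row_arm n m lam a 0 k) - int (shifted n nu k)) +
    int (arm_weight n (shifted n nu) (row_pits n m lam) (row_arm n m lam a)) +
    int (arm_weight m (shifted m mu) (row_pits m n lam') (row_arm m n lam' (\<lambda>i j. a j i)))"
proof -
  note dec = dual_shapesD(1)[OF dual] and dec' = dual_shapesD(2)[OF dual]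
  let ?c = "row_pits n m lam" and ?b = "row_arm n m lam a"
  let ?S = "{(i, j). 1 \<le> i \<and> 1 \<le> j \<and> int i - int n > int j - int m \<and> (i, j) \<notin> diagram lam}"
  let ?S' = "{(j, i). 1 \<le> j \<and> 1 \<le> i \<and> int j - int m + int 1 \<le> int i - int n \<and> (j, i) \<notin> diagram lam'}"
  have aT: "(\<lambda>i j. a j i) \<in> pit_arrays m n nu mu lam'" by (rule pit_arrays_transpose[OF dual a])
  have zero: "a i j = 0" if "n < i" "m < j" for i j
    by (rule gluedD(5)[OF pit_array_glued[OF a dual corner] that])
  have arm: "?b \<in> arms n (shifted n nu) ?c (?b 0)" by (rule row_arm_in_arms[OF a dec])
  have c: "pit_counts n ?c" by (rule pit_counts_row_pits[OF dec])
  have 1: "(\<Sum>\<^sub>\<infinity>(i, j)\<in>{(i, j). 1 \<le> i \<and> 1 \<le> j \<and> int i - int n \<le> int j - int m \<and> (i, j) \<notin> diagram lam}.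
      int (the_enat (a i j)) - int (nu i)) = int (\<Sum>k<n. fsum (arm_excess (shifted n nu) ?c ?b k))"
    using infsum_row_arm[OF a dec zero nu, of 0] by simp
  have "bij_betw prod.swap ?S' ?S"
  proof (rule bij_betw_byWitness[where f' = prod.swap])
    show "prod.swap ` ?S' \<subseteq> ?S" "prod.swap ` ?S \<subseteq> ?S'"
      using dual_shapesD(3)[OF dual] by auto
  qed auto
  then have "(\<Sum>\<^sub>\<infinity>(i, j)\<in>?S. int (the_enat (a i j)) - int (mu j)) =
      (\<Sum>\<^sub>\<infinity>p\<in>?S'. (case prod.swap p of (i, j) \<Rightarrow> int (the_enat (a i j)) - int (mu j)))"
    by (rule infsum_reindex_bij_betw[symmetric])
  also have "\<dots> = (\<Sum>\<^sub>\<infinity>(j, i)\<in>?S'. int (the_enat (a i j)) - int (mu j))"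
    by (intro infsum_cong) auto
  also have "\<dots> = int (arm_weight m (shifted m mu) (row_pits m n lam') (row_arm m n lam' (\<lambda>i j. a j i)))"
    using infsum_row_arm[OF aT dec' _ mu, of 1] zero by (simp add: arm_weight_def)
  finally have 2: "(\<Sum>\<^sub>\<infinity>(i, j)\<in>?S. int (the_enat (a i j)) - int (mu j)) =
      int (arm_weight m (shifted m mu) (row_pits m n lam') (row_arm m n lam' (\<lambda>i j. a j i)))" .
  have "(\<Sum>k<n. fsum (arm_excess (shifted n nu) ?c ?b k)) =
      (\<Sum>k<n. arm_excess (shifted n nu) ?c ?b k 0 + fsum (arm_excess (shifted n nu) ?c ?b k \<circ> Suc))"
    by (intro sum.cong refl fsum_Suc finite_arm_excess[OF arm]) auto
  also have "\<dots> = (\<Sum>k<n. arm_excess (shifted n nu) ?c ?b k 0) + arm_weight n (shifted n nu) ?c ?b"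
    by (simp add: sum.distrib arm_weight_def o_def)
  finally have 3: "(\<Sum>k<n. fsum (arm_excess (shifted n nu) ?c ?b k)) =
      (\<Sum>k<n. arm_excess (shifted n nu) ?c ?b k 0) + arm_weight n (shifted n nu) ?c ?b" .
  have "int (\<Sum>k<n. arm_excess (shifted n nu) ?c ?b k 0) =
      (\<Sum>k<n. if ?c 0 \<le> k then int (?b 0 k) - int (shifted n nu k) else 0)"
    using arms_ge[OF arm c, of 0] by (auto simp: arm_excess_def of_nat_diff intro!: sum.cong)
  also have "\<dots> = (\<Sum>k\<in>{..<n} \<inter> {k. ?c 0 \<le> k}. int (?b 0 k) - int (shifted n nu k))"
    by (simp add: sum.inter_restrict)
  also have "{..<n} \<inter> {k. ?c 0 \<le> k} = {?c 0..<n}" by auto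
  finally show ?thesis
    unfolding pit_weight_def 1 2 3 by simp
qed

section \<open>The generating function of arrays with a pit\<close>

text \<open>If at each order only finitely many outer indices contribute, the inner sums make the
  double family locally finite, and \<open>lf_sum_Sigma\<close> applies.\<close>

lemma lf_sum_SigmaI:
  fixes f :: "'b \<Rightarrow> 'c \<Rightarrow> 'a::ab_group_add fls"
  assumes fin: "\<And>K. finite {x\<in>A. \<exists>y\<in>B x. \<not> fls_vanishes K (f x y)}"
    and inner: "\<And>x. x \<in> A \<Longrightarrow> lf_sum (f x) (B x) (g x)"
  obtains t where "lf_sum (\<lambda>(x, y). f x y) (Sigma A B) t" "lf_sum g A t"
proof -
  have "loc_finite (\<lambda>(x, y). f x y) (Sigma A B)"
    unfolding loc_finite_def
  proof
    fix K
    let ?A = "{x\<in>A. \<exists>y\<in>B x. \<not> fls_vanishes K (f x y)}"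
    have "finite (SIGMA x : ?A. {y\<in>B x. \<not> fls_vanishes K (f x y)})"
      using fin lf_sum_loc_finite[OF inner] by (intro finite_SigmaI) (auto simp: loc_finite_def)
    moreover have "{p \<in> Sigma A B. \<not> fls_vanishes K (case p of (x, y) \<Rightarrow> f x y)} \<subseteq>
        (SIGMA x : ?A. {y\<in>B x. \<not> fls_vanishes K (f x y)})"
      by auto
    ultimately show "finite {p \<in> Sigma A B. \<not> fls_vanishes K (case p of (x, y) \<Rightarrow> f x y)}"
      by (rule finite_subset[rotated])
  qed
  then obtain t where t: "lf_sum (\<lambda>(x, y). f x y) (Sigma A B) t"
    by (rule loc_finite_imp_lf_sum)
  show ?thesis
    by (rule that[OF t lf_sum_Sigma[OF t inner]])
qed

lemma pit_weight_nonneg: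
  assumes a: "a \<in> pit_arrays n m mu nu lam" and dual: "dual_shapes lam lam'"
    and nu: "\<And>i. n < i \<Longrightarrow> nu i = 0" and mu: "\<And>j. m < j \<Longrightarrow> mu j = 0"
    and corner: "lam (n + 1) < m + 1"
  shows "0 \<le> pit_weight n m mu nu lam a"
proof -
  note dec = dual_shapesD(1)[OF dual]
  have "0 \<le> (\<Sum>k = row_pits n m lam 0..<n. int (row_arm n m lam a 0 k) - int (shifted n nu k))"
    using arms_ge[OF row_arm_in_arms[OF a dec] pit_counts_row_pits[OF dec], of 0]
    by (intro sum_nonneg) auto
  then show ?thesis
    by (subst pit_weight_arms[OF a dual nu mu corner]) simp_all
qed

lemma fps_to_fls_chi:
  assumes t: "lf_sum (\<lambda>a. qpow (pit_weight n m mu nu lam a)) (pit_arrays n m mu nu lam) t"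
    and nonneg: "\<And>a. a \<in> pit_arrays n m mu nu lam \<Longrightarrow> 0 \<le> pit_weight n m mu nu lam a"
  shows "fps_to_fls (chi n m mu nu lam) = t"
proof (rule fls_eqI)
  fix k
  let ?S = "{a \<in> pit_arrays n m mu nu lam. pit_weight n m mu nu lam a = k}"
  have "{a \<in> pit_arrays n m mu nu lam. fls_nth (qpow (pit_weight n m mu nu lam a) :: rat fls) k \<noteq> 0} = ?S"
    by (auto simp: fls_nth_qpow)
  then have "fls_nth t k = of_nat (card ?S)"
    using lf_sum_nth(2)[OF t, of k] by (simp add: fls_nth_qpow)
  moreover have "?S = {}" if "k < 0"
    using nonneg that by fastforce
  ultimately show "fls_nth (fps_to_fls (chi n m mu nu lam)) k = fls_nth t k"
    by (cases "k < 0") (simp_all add: chi_def)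
qed

lemma chi_eq_diagonal_sum:
  fixes n m :: nat and nu mu lam lam' :: "nat \<Rightarrow> nat"
  assumes dual: "dual_shapes lam lam'"
    and nu: "\<And>i. n < i \<Longrightarrow> nu i = 0" and mu: "\<And>j. m < j \<Longrightarrow> mu j = 0"
    and corner: "lam (n + 1) < m + 1" and dec_nu: "weakly_decr nu" and dec_mu: "weakly_decr mu"
  defines "r \<equiv> pit_rank n m lam"
  shows "lf_sum (\<lambda>A. (qpow (\<Sum>k = n - r..<n. int (diag_state n r A k) - int (shifted n nu k)) *
        arm_gf n (shifted n nu) (row_pits n m lam) (diag_state n r A)) *
        arm_gf m (shifted m mu) (row_pits m n lam') (diag_state m r A))
      (decreasing_tuples r) (fps_to_fls (chi n m mu nu lam))"
proof -
  note dec = dual_shapesD(1)[OF dual] and dec' = dual_shapesD(2)[OF dual]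
  let ?N = "shifted n nu" and ?M = "shifted m mu"
  let ?c = "row_pits n m lam" and ?c' = "row_pits m n lam'"
  have r: "r \<le> n" "r \<le> m" using pit_rank_le[of n m lam] by (auto simp: r_def)
  have c0: "?c 0 = n - r" "?c' 0 = m - r"
    using row_pits_0[OF dec] row_pits_0_dual[OF dual] by (auto simp: r_def)
  have c: "pit_counts n ?c" and c': "pit_counts m ?c'"
    by (auto intro: pit_counts_row_pits dec dec')
  define w where "w A = (\<Sum>k = n - r..<n. int (diag_state n r A k) - int (?N k))" for A
  define B where "B A = arms n ?N ?c (diag_state n r A) \<times> arms m ?M ?c' (diag_state m r A)" for A
  define f :: "nat list \<Rightarrow> _ \<Rightarrow> rat fls" where
    "f A p = qpow (w A) * (qpow (int (arm_weight n ?N ?c (fst p))) * qpow (int (arm_weight m ?M ?c' (snd p))))" for A p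
  define g where "g A = qpow (w A) * (arm_gf n ?N ?c (diag_state n r A) * arm_gf m ?M ?c' (diag_state m r A))" for A
  have f_eq: "f A (b, b') = qpow (w A + int (arm_weight n ?N ?c b) + int (arm_weight m ?M ?c' b'))" for A b b'
    by (simp add: f_def qpow_add mult.assoc)
  have inner: "lf_sum (f A) (B A) (g A)" if A: "A \<in> decreasing_tuples r" for A
  proof -
    have "lf_sum (\<lambda>b. qpow (int (arm_weight n ?N ?c b))) (arms n ?N ?c (diag_state n r A)) (arm_gf n ?N ?c (diag_state n r A))"
      by (rule lf_sum_arms[OF strict_from_shifted[OF dec_nu] c])
        (use diag_state_strict[OF A r(1)] in \<open>simp_all add: c0 diag_state_def\<close>)
    moreover have "lf_sum (\<lambda>b. qpow (int (arm_weight m ?M ?c' b))) (arms m ?M ?c' (diag_state m r A)) (arm_gf m ?M ?c' (diag_state m r A))"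
      by (rule lf_sum_arms[OF strict_from_shifted[OF dec_mu] c'])
        (use diag_state_strict[OF A r(2)] in \<open>simp_all add: c0 diag_state_def\<close>)
    ultimately show ?thesis
      unfolding f_def g_def B_def
      using lf_sum_cmult[OF lf_sum_product] by (simp add: case_prod_unfold)
  qed
  have w_ge: "int (diag_state n r A k) - int (?N k) \<le> w A \<and> 0 \<le> w A" if "(b, b') \<in> B A" "k \<in> {n - r..<n}" for A b b' k
  proof -
    have "int (?N k) \<le> int (diag_state n r A k)" if "k \<in> {n - r..<n}" for k
      using arms_ge[of b n ?N ?c "diag_state n r A" 0 k] armsD(1)[of b n ?N ?c "diag_state n r A"] c c0
        \<open>(b, b') \<in> B A\<close> that by (auto simp: B_def)
    then show ?thesis
      unfolding w_def using that(2) by (auto intro!: member_le_sum[of k "{n - r..<n}" "\<lambda>k. int (diag_state n r A k) - int (?N k)"] sum_nonneg)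
  qed
  have "finite {A \<in> decreasing_tuples r. \<exists>p\<in>B A. \<not> fls_vanishes K (f A p)}" for K
  proof -
    \<comment> \<open>Entries of a tuple that admits arms are at least the corresponding
      \<open>?N\<close>, so each difference is bounded by \<open>w A\<close>. Weight at most
      \<open>K\<close> therefore bounds every entry by \<open>L\<close>, leaving finitely many
      tuples.\<close>
    define L where "L = nat K + (\<Sum>k<n. ?N k)"
    have "A \<in> {A. set A \<subseteq> {..L} \<and> length A = r}"
      if mem: "A \<in> {A \<in> decreasing_tuples r. \<exists>p\<in>B A. \<not> fls_vanishes K (f A p)}" for A
    proof -
      obtain b b' where A: "A \<in> decreasing_tuples r" and p: "(b, b') \<in> B A"
        and nv: "\<not> fls_vanishes K (f A (b, b'))"
        using mem by auto
      have "w A + int (arm_weight n ?N ?c b) + int (arm_weight m ?M ?c' b') \<le> K"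
        using nv by (auto simp: f_eq fls_vanishes_def fls_nth_qpow split: if_splits)
      then have wK: "w A \<le> K" by simp
      have "A ! t \<le> L" if t: "t < r" for t
      proof -
        let ?k = "n - r + t"
        have k: "?k \<in> {n - r..<n}" using t r by auto
        have "int (diag_state n r A ?k) - int (?N ?k) \<le> K" "0 \<le> K"
          using w_ge[OF p k] wK by auto
        moreover have "diag_state n r A ?k = A ! t" using k by (simp add: diag_state_def)
        moreover have "?N ?k \<le> (\<Sum>k<n. ?N k)" using k by (intro member_le_sum) auto
        ultimately show ?thesis by (simp add: L_def)
      qed
      then show ?thesis using decreasing_tuplesD(1)[OF A] by (auto simp: in_set_conv_nth)
    qed
    then have "{A \<in> decreasing_tuples r. \<exists>p\<in>B A. \<not> fls_vanishes K (f A p)} \<subseteq> {A. set A \<subseteq> {..L} \<and> length A = r}"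
      by (rule subsetI)
    then show ?thesis
      using finite_lists_length_eq[of "{..L}" r] finite_subset by blast
  qed
  then obtain t where t: "lf_sum (\<lambda>(A, p). f A p) (Sigma (decreasing_tuples r) B) t" "lf_sum g (decreasing_tuples r) t"
    using inner by (rule lf_sum_SigmaI)
  have "f A (b, b') = qpow (pit_weight n m mu nu lam (glue n m lam b b'))"
    if A: "A \<in> decreasing_tuples r" and p: "(b, b') \<in> B A" for A b b'
  proof -
    have b: "b \<in> arms n ?N ?c (diag_state n r A)" and b': "b' \<in> arms m ?M ?c' (diag_state m r A)"
      using p by (auto simp: B_def)
    note gl = glued_glue_arms[OF dual corner, folded r_def, OF A b b']
    have a: "glue n m lam b b' \<in> pit_arrays n m mu nu lam"
      by (rule glued_in_pit_arrays[OF gl dual nu mu b b'])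
    have "pit_weight n m mu nu lam (glue n m lam b b') =
        w A + int (arm_weight n ?N ?c b) + int (arm_weight m ?M ?c' b')"
      by (subst pit_weight_arms[OF a dual nu mu corner])
        (simp_all add: row_arm_glued[OF gl dec b] row_arm_glued[OF glued_transpose[OF dual gl] dec' b']
          armsD(1)[OF b] c0 w_def)
    then show ?thesis by (simp add: f_eq)
  qed
  then have total: "lf_sum (\<lambda>s. qpow (pit_weight n m mu nu lam (case s of (A, b, b') \<Rightarrow> glue n m lam b b')))
      (Sigma (decreasing_tuples r) B) t"
    by (intro lf_sum_cong[THEN iffD1, OF _ refl refl t(1)]) auto
  have bij: "bij_betw (\<lambda>(A, b, b'). glue n m lam b b') (Sigma (decreasing_tuples r) B) (pit_arrays n m mu nu lam)"
    unfolding B_def r_def by (rule bij_betw_glue[OF dual nu mu corner])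
  from total have "lf_sum (\<lambda>a. qpow (pit_weight n m mu nu lam a)) (pit_arrays n m mu nu lam) t"
    unfolding lf_sum_reindex_iff[OF bij, of "\<lambda>a. qpow (pit_weight n m mu nu lam a)"] .
  then have "fps_to_fls (chi n m mu nu lam) = t"
    by (rule fps_to_fls_chi) (rule pit_weight_nonneg[OF _ dual nu mu corner])
  then show ?thesis
    using t(2) by (simp add: g_def[abs_def] w_def mult.assoc)
qed

section \<open>Alternants as stacked determinants\<close>

lemma stacked_det_scale:
  fixes c :: "'a::comm_ring_1"
  shows "stacked_det a r (\<lambda>k l. u k l * c) (\<lambda>t l. s t * (f t l * c)) =
    (\<Prod>t<r. s t) * c ^ (a + r) * stacked_det a r u f"
proof -
  have "stacked_det a r (\<lambda>k l. u k l * c) (\<lambda>t l. s t * (f t l * c)) =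
    det_of (a + r) (\<lambda>k l. ((if k < a then 1 else s (k - a)) * c) * (if k < a then u k l else f (k - a) l) * 1)"
    unfolding stacked_det_def by (intro det_of_cong) (simp add: mult_ac)
  also have "\<dots> = (\<Prod>t<r. s t) * c ^ (a + r) * stacked_det a r u f"
    unfolding det_of_scale stacked_det_def by (simp add: prod_lessThan_add prod.distrib)
  finally show ?thesis .
qed

text \<open>The sign of moving \<open>r\<close> rows past \<open>a\<close> rows.\<close>

lemma alternant_append:
  assumes "length xs = r" "length ys = a"
  shows "alternant (a + r) E (xs @ ys) =
    (- 1) ^ (r * a) * stacked_det a r (\<lambda>k l. ys ! k powi E (Suc l)) (\<lambda>t l. xs ! t powi E (Suc l))"
proof -
  let ?A = "mat (a + r) (a + r) (\<lambda>(k, l). (xs @ ys) ! k powi E (Suc l))"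
  have "det ?A = (- 1) ^ (r * a) *
    det (mat (a + r) (a + r) (\<lambda>(i, j). ?A $$ (if i < a then i + r else if i < r + a then i - a else i, j)))"
    by (rule det_swap_initial_rows) auto
  also have "det (mat (a + r) (a + r) (\<lambda>(i, j). ?A $$ (if i < a then i + r else if i < r + a then i - a else i, j))) =
    stacked_det a r (\<lambda>k l. ys ! k powi E (Suc l)) (\<lambda>t l. xs ! t powi E (Suc l))"
    unfolding stacked_det_def using assms
    by (intro arg_cong[of _ _ Determinant.det] eq_matI) (auto simp: nth_append)
  finally show ?thesis by (simp add: alternant_def)
qed

lemma pit_N_Suc: "k < n \<Longrightarrow> pit_N n nu (Suc k) = int (shifted n nu k)"
  by (simp add: pit_N_def shifted_def of_nat_diff)

lemma pit_M_Suc: "k < m \<Longrightarrow> pit_M m mu (Suc k) = int (shifted m mu k)"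
  by (simp add: pit_M_def shifted_def of_nat_diff)

lemma pit_P_Suc: "pit_P n m lam (Suc k) = reach n m lam k"
  by (simp add: pit_P_def pit_pi_def reach_def)

lemma pit_Q_Suc: "pit_Q n m lam (Suc k) = reach m n (conj_part lam) k"
  by (simp add: pit_Q_def pit_kappa_def reach_def)

lemma a_N_stacked:
  assumes "length A = r" and r: "r = pit_rank n m lam"
  shows "a_N n m nu lam A = (- 1) ^ (r * (n - r)) *
    stacked_det (n - r) r (\<lambda>k l. qpow (- ((reach n m lam k + 1) * int (shifted n nu l))))
      (\<lambda>t l. qpow (int (A ! t) * int (shifted n nu l)))"
proof -
  have rn: "n - r + r = n" using pit_rank_le[of n m lam] r by simp
  let ?ys = "map (\<lambda>i. fls_X powi (- pit_P n m lam i - 1)) [1..<Suc (n - r)] :: rat fls list"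
  have "a_N n m nu lam A = (- 1) ^ (r * (n - r)) *
    stacked_det (n - r) r (\<lambda>k l. ?ys ! k powi pit_N n nu (Suc l))
      (\<lambda>t l. map (\<lambda>a. fls_X powi int a) A ! t powi pit_N n nu (Suc l))"
    using alternant_append[of "map (\<lambda>a. fls_X powi int a) A :: rat fls list" r ?ys "n - r" "pit_N n nu"] assms(1)
    unfolding a_N_def r[symmetric] rn by (simp del: fls_X_power_int upt_Suc)
  also have "stacked_det (n - r) r (\<lambda>k l. ?ys ! k powi pit_N n nu (Suc l))
      (\<lambda>t l. map (\<lambda>a. fls_X powi int a) A ! t powi pit_N n nu (Suc l)) =
    stacked_det (n - r) r (\<lambda>k l. qpow (- ((reach n m lam k + 1) * int (shifted n nu l))))
      (\<lambda>t l. qpow (int (A ! t) * int (shifted n nu l)))"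
  proof (rule stacked_det_cong; unfold rn)
    fix k l assume k: "k < n - r" "l < n"
    have "?ys ! k = qpow (- reach n m lam k - 1)"
      using k(1) by (simp add: qpow_def pit_P_Suc del: fls_X_power_int upt_Suc)
    then show "?ys ! k powi pit_N n nu (Suc l) = qpow (- ((reach n m lam k + 1) * int (shifted n nu l)))"
    proof -
      have "(- reach n m lam k - 1) * int (shifted n nu l) = - ((reach n m lam k + 1) * int (shifted n nu l))"
        by (simp add: algebra_simps)
      then show ?thesis using k \<open>?ys ! k = _\<close> by (simp only: qpow_powi pit_N_Suc)
    qed
  next
    fix t l assume t: "t < r" "l < n"
    have "map (\<lambda>a. fls_X powi int a) A ! t = (qpow (int (A ! t)) :: rat fls)"
      using t assms(1) by (simp add: qpow_def del: fls_X_power_int)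
    then show "map (\<lambda>a. fls_X powi int a) A ! t powi pit_N n nu (Suc l) = (qpow (int (A ! t) * int (shifted n nu l)) :: rat fls)"
      using t by (simp only: qpow_powi pit_N_Suc)
  qed
  finally show ?thesis .
qed

lemma a_M_stacked:
  assumes "length A = r" and r: "r = pit_rank n m lam"
  shows "a_M n m mu lam A = (- 1) ^ (r * (m - r)) *
    stacked_det (m - r) r (\<lambda>k l. qpow (- (reach m n (conj_part lam) k * int (shifted m mu l))))
      (\<lambda>t l. qpow (- int (A ! t) * int (shifted m mu l)))"
proof -
  have rn: "m - r + r = m" using pit_rank_le[of n m lam] r by simp
  let ?ys = "map (\<lambda>j. fls_X powi (- pit_Q n m lam j)) [1..<Suc (m - r)] :: rat fls list"
  have "a_M n m mu lam A = (- 1) ^ (r * (m - r)) *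
    stacked_det (m - r) r (\<lambda>k l. ?ys ! k powi pit_M m mu (Suc l))
      (\<lambda>t l. map (\<lambda>a. fls_X powi (- int a)) A ! t powi pit_M m mu (Suc l))"
    using alternant_append[of "map (\<lambda>a. fls_X powi (- int a)) A :: rat fls list" r ?ys "m - r" "pit_M m mu"] assms(1)
    unfolding a_M_def r[symmetric] rn by (simp del: fls_X_power_int upt_Suc)
  also have "stacked_det (m - r) r (\<lambda>k l. ?ys ! k powi pit_M m mu (Suc l))
      (\<lambda>t l. map (\<lambda>a. fls_X powi (- int a)) A ! t powi pit_M m mu (Suc l)) =
    stacked_det (m - r) r (\<lambda>k l. qpow (- (reach m n (conj_part lam) k * int (shifted m mu l))))
      (\<lambda>t l. qpow (- int (A ! t) * int (shifted m mu l)))"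
  proof (rule stacked_det_cong; unfold rn)
    fix k l assume k: "k < m - r" "l < m"
    have "?ys ! k = qpow (- reach m n (conj_part lam) k)"
      using k(1) by (simp add: qpow_def pit_Q_Suc del: fls_X_power_int upt_Suc)
    then show "?ys ! k powi pit_M m mu (Suc l) = qpow (- (reach m n (conj_part lam) k * int (shifted m mu l)))"
      using k by (simp only: qpow_powi pit_M_Suc minus_mult_left)
  next
    fix t l assume t: "t < r" "l < m"
    have "map (\<lambda>a. fls_X powi (- int a)) A ! t = (qpow (- int (A ! t)) :: rat fls)"
      using t assms(1) by (simp add: qpow_def del: fls_X_power_int)
    then show "map (\<lambda>a. fls_X powi (- int a)) A ! t powi pit_M m mu (Suc l) = (qpow (- int (A ! t) * int (shifted m mu l)) :: rat fls)"
      using t by (simp only: qpow_powi pit_M_Suc)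
  qed
  finally show ?thesis .
qed

lemma pit_Delta_eq:
  assumes "r = pit_rank n m lam"
  shows "pit_Delta n m mu nu lam =
    (\<Sum>k<m - r. int (shifted m mu k) * reach m n (conj_part lam) k) +
    (\<Sum>k<n - r. int (shifted n nu k) * (reach n m lam k + 1))"
proof -
  have "(\<Sum>j = 1..m - r. pit_M m mu j * pit_Q n m lam j) =
      (\<Sum>k<m - r. int (shifted m mu k) * reach m n (conj_part lam) k)"
    unfolding One_nat_def sum.atLeast1_atMost_eq by (intro sum.cong) (auto simp: pit_M_Suc pit_Q_Suc)
  moreover have "(\<Sum>i = 1..n - r. pit_N n nu i * (pit_P n m lam i + 1)) =
      (\<Sum>k<n - r. int (shifted n nu k) * (reach n m lam k + 1))"
    unfolding One_nat_def sum.atLeast1_atMost_eq by (intro sum.cong) (auto simp: pit_N_Suc pit_P_Suc)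
  ultimately show ?thesis by (simp add: pit_Delta_def assms)
qed

text \<open>The scalars are distributed over rows: one factor 1/(q)_inf to every row of both
  determinants, and the sign and the Gaussian power of A_t to the variable rows of the second. The
  rows then have the pairings on the right of \<open>diagonal_sum\<close>.\<close>

lemma pit_term_stacked:
  assumes A: "length A = r" and r: "r = pit_rank n m lam"
  shows "pit_term n m mu nu lam A = (- 1) ^ (r * (m + n)) *
    (stacked_det (n - r) r
       (\<lambda>k l. qpow (- ((reach n m lam k + 1) * int (shifted n nu l))) * inverse qinf)
       (\<lambda>t l. qpow (int (A ! t) * int (shifted n nu l)) * inverse qinf) *
     stacked_det (m - r) r
       (\<lambda>k l. qpow (- (reach m n (conj_part lam) k * int (shifted m mu l))) * inverse qinf)
       (\<lambda>t l. (- 1) ^ (A ! t) * qpow (int ((A ! t + 1) choose 2)) * (qpow (- int (A ! t) * int (shifted m mu l)) * inverse qinf)))"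
proof -
  have rn: "r \<le> n" "r \<le> m" using pit_rank_le[of n m lam] r by auto
  let ?DN = "stacked_det (n - r) r (\<lambda>k l. qpow (- ((reach n m lam k + 1) * int (shifted n nu l))) :: rat fls)
      (\<lambda>t l. qpow (int (A ! t) * int (shifted n nu l)))"
  let ?DM = "stacked_det (m - r) r (\<lambda>k l. qpow (- (reach m n (conj_part lam) k * int (shifted m mu l))) :: rat fls)
      (\<lambda>t l. qpow (- int (A ! t) * int (shifted m mu l)))"
  have "(\<Prod>t<r. (- 1) ^ (A ! t) :: rat fls) = (- 1) ^ sum_list A"
    using A by (simp add: power_sum sum_list_sum_nth atLeast0LessThan)
  moreover have "(\<Prod>t<r. qpow (int ((A ! t + 1) choose 2)) :: rat fls) = fls_X ^ (\<Sum>a\<leftarrow>A. (a + 1) choose 2)"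
  proof -
    have "(\<Sum>a\<leftarrow>A. (a + 1) choose 2) = (\<Sum>t<r. (A ! t + 1) choose 2)"
      using A by (simp add: sum_list_sum_nth atLeast0LessThan)
    then show ?thesis
      unfolding prod_qpow by (simp only: qpow_def of_nat_sum[symmetric] power_int_of_nat)
  qed
  ultimately have sgn: "(\<Prod>t<r. (- 1) ^ (A ! t) * qpow (int ((A ! t + 1) choose 2)) :: rat fls) =
      (- 1) ^ sum_list A * fls_X ^ (\<Sum>a\<leftarrow>A. (a + 1) choose 2)"
    by (simp only: prod.distrib)
  have N: "stacked_det (n - r) r
       (\<lambda>k l. qpow (- ((reach n m lam k + 1) * int (shifted n nu l))) * inverse qinf)
       (\<lambda>t l. qpow (int (A ! t) * int (shifted n nu l)) * inverse qinf) = inverse qinf ^ n * ?DN"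
    using stacked_det_scale[of "n - r" r _ "inverse qinf" "\<lambda>t. 1"] rn by simp
  have M: "stacked_det (m - r) r
       (\<lambda>k l. qpow (- (reach m n (conj_part lam) k * int (shifted m mu l))) * inverse qinf)
       (\<lambda>t l. (- 1) ^ (A ! t) * qpow (int ((A ! t + 1) choose 2)) * (qpow (- int (A ! t) * int (shifted m mu l)) * inverse qinf)) =
     ((- 1) ^ sum_list A * fls_X ^ (\<Sum>a\<leftarrow>A. (a + 1) choose 2)) * inverse qinf ^ m * ?DM"
    unfolding stacked_det_scale sgn using rn by simp
  \<comment> \<open>The two row moves cost r(n-r) + r(m-r) signs, which differs from r(m+n) by the
    even number 2r^2.\<close>
  have "r * (m + n) = r * (n - r) + r * (m - r) + 2 * (r * r)"
    using rn by (simp flip: add_mult_distrib2 mult.assoc) (simp add: mult.commute flip: add_mult_distrib2)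
  then have "(- 1) ^ (r * (m + n)) = ((- 1) ^ (r * (n - r)) * (- 1) ^ (r * (m - r)) :: rat fls)"
    by (simp add: power_add power_mult)
  then show ?thesis
    unfolding pit_term_def a_N_stacked[OF A r] a_M_stacked[OF A r] N M
    by (simp add: field_simps power_add)
qed

section \<open>Comparison of the two sums over decreasing tuples\<close>

theorem theorem2:
  fixes n m :: nat and nu mu lam :: "nat \<Rightarrow> nat"
  assumes "is_partition nu" and "is_partition mu" and "is_partition lam"
    and "part_length nu \<le> n" and "part_length mu \<le> m"
    and "lam (n + 1) < m + 1"
  shows "pit_term n m mu nu lam summable_on decreasing_tuples (pit_rank n m lam) \<and>
    fps_to_fls (chi n m mu nu lam) =
      (- 1) ^ (pit_rank n m lam * (m + n)) * fls_X powi pit_Delta n m mu nu lam *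
      (\<Sum>\<^sub>\<infinity>A\<in>decreasing_tuples (pit_rank n m lam). pit_term n m mu nu lam A)"
proof -
  define r where "r = pit_rank n m lam"
  define lam' where "lam' = conj_part lam"
  let ?N = "shifted n nu" and ?M = "shifted m mu"
  let ?c = "row_pits n m lam" and ?c' = "row_pits m n lam'"
  have dual: "dual_shapes lam lam'"
    unfolding lam'_def by (rule dual_shapes_conj_part[OF assms(3)])
  note dec = dual_shapesD(1)[OF dual] and dec' = dual_shapesD(2)[OF dual]
  have r: "r \<le> n" "r \<le> m" "n - r + r = n" "m - r + r = m"
    using pit_rank_le[of n m lam] by (auto simp: r_def)
  have c0: "?c 0 = n - r" "?c' 0 = m - r"
    using row_pits_0[OF dec] row_pits_0_dual[OF dual] by (auto simp: r_def)
  define u where "u k l = qpow (- ((reach n m lam k + 1) * int (?N l))) * inverse qinf" for k l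
  define v where "v k l = qpow (- (reach m n lam' k * int (?M l))) * inverse qinf" for k l
  define f where "f x l = qpow (int x - int (?N l)) * iqpoch (int x - int (?N l))" for x l
  define g where "g x l = iqpoch (int x - int (?M l))" for x l
  define f' :: "nat \<Rightarrow> nat \<Rightarrow> rat fls" where "f' x l = qpow (int x * int (?N l)) * inverse qinf" for x l
  define g' :: "nat \<Rightarrow> nat \<Rightarrow> rat fls" where
    "g' x l = (- 1) ^ x * qpow (int ((x + 1) choose 2)) * (qpow (- int x * int (?M l)) * inverse qinf)" for x l
  \<comment> \<open>The rows from the arms and the rows from the alternants have the same pairings
    \<open>H\<close>, which is all that \<open>pairing_value\<close> depends on.\<close>
  have "\<exists>H. lf_sum (\<lambda>x. f x l * g x l') UNIV H \<and> lf_sum (\<lambda>x. f' x l * g' x l') UNIV H" for l l'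
    unfolding f_def g_def f'_def g'_def using diagonal_sum[of "?N l" "?M l'"] by blast
  then obtain H where H: "\<And>l l'. lf_sum (\<lambda>x. f x l * g x l') UNIV (H l l')"
      "\<And>l l'. lf_sum (\<lambda>x. f' x l * g' x l') UNIV (H l l')"
    by metis
  define Z where "Z = pairing_value (n - r) (m - r) r u v H / fact r"
  define D where "D = pit_Delta n m mu nu lam"
  define sg :: "rat fls" where "sg = (- 1) ^ (r * (m + n))"
  \<comment> \<open>The weight of the main diagonal is absorbed by the row arm, whose exponents
    become arrival = P + 1; the column arm keeps arrival - 1 = Q. The two prefactors multiply to
    q^D.\<close>
  have lhs: "(qpow (\<Sum>k = n - r..<n. int (diag_state n r A k) - int (?N k)) * arm_gf n ?N ?c (diag_state n r A)) *
      arm_gf m ?M ?c' (diag_state m r A) =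
    qpow D * (stacked_det (n - r) r u (\<lambda>t. f (A ! t)) * stacked_det (m - r) r v (\<lambda>t. g (A ! t)))" for A
  proof -
    have arr: "int (arrival ?c k) = reach n m lam k + 1" if "k < n - r" for k
    proof -
      have "k < n" "0 \<le> reach n m lam k"
        using row_pits_iff[OF dec, of k n m 0] that c0 by auto
      then show ?thesis using arrival_row_pits[OF dec, of k n m] by simp
    qed
    have arr': "int (arrival ?c' k) = reach m n lam' k + 1" if "k < m - r" for k
    proof -
      have "k < m" "0 \<le> reach m n lam' k"
        using row_pits_iff[OF dec', of k m n 0] that c0 by auto
      then show ?thesis using arrival_row_pits[OF dec', of k m n] by simp
    qed
    have "qpow (\<Sum>k = n - r..<n. int (diag_state n r A k) - int (?N k)) * arm_gf n ?N ?c (diag_state n r A) =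
      qpow (\<Sum>k<n - r. int (?N k) * (reach n m lam k + 1)) * stacked_det (n - r) r u (\<lambda>t. f (A ! t))"
    proof -
      have "det_of n (\<lambda>k l. if k < n - r then qpow (- (int (arrival ?c k) * int (?N l))) * inverse qinf
          else qpow (int (diag_state n r A k) - int (?N l)) * iqpoch (int (diag_state n r A k) - int (?N l))) =
        stacked_det (n - r) r u (\<lambda>t. f (A ! t))"
        unfolding stacked_det_def r(3)
        by (intro det_of_cong) (auto simp: arr u_def f_def diag_state_def)
      then show ?thesis
        using arm_gf_scaled[of ?c n "diag_state n r A" ?N] by (simp add: c0 arr)
    qed
    moreover have "arm_gf m ?M ?c' (diag_state m r A) =
      qpow (\<Sum>k<m - r. int (?M k) * reach m n lam' k) * stacked_det (m - r) r v (\<lambda>t. g (A ! t))"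
    proof -
      have "det_of m (\<lambda>k l. if k < m - r then qpow (- ((int (arrival ?c' k) - 1) * int (?M l))) * inverse qinf
          else iqpoch (int (diag_state m r A k) - int (?M l))) =
        stacked_det (m - r) r v (\<lambda>t. g (A ! t))"
        unfolding stacked_det_def r(4)
        by (intro det_of_cong) (auto simp: arr' v_def g_def diag_state_def)
      then show ?thesis
        unfolding arm_gf_def c0 by (simp add: arr')
    qed
    ultimately show ?thesis
      unfolding D_def pit_Delta_eq[OF r_def] lam'_def qpow_add by (simp add: mult_ac)
  qed
  have "lf_sum (\<lambda>A. stacked_det (n - r) r u (\<lambda>t. f (A ! t)) * stacked_det (m - r) r v (\<lambda>t. g (A ! t)))
      (decreasing_tuples r) Z"
    unfolding Z_def by (rule lf_sum_stacked_det[OF H(1)])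
  then have "lf_sum (\<lambda>A. (qpow (\<Sum>k = n - r..<n. int (diag_state n r A k) - int (?N k)) *
      arm_gf n ?N ?c (diag_state n r A)) * arm_gf m ?M ?c' (diag_state m r A)) (decreasing_tuples r) (qpow D * Z)"
    unfolding lhs by (rule lf_sum_cmult)
  moreover have "lf_sum (\<lambda>A. (qpow (\<Sum>k = n - r..<n. int (diag_state n r A k) - int (?N k)) *
      arm_gf n ?N ?c (diag_state n r A)) * arm_gf m ?M ?c' (diag_state m r A)) (decreasing_tuples r)
      (fps_to_fls (chi n m mu nu lam))"
    unfolding r_def
    by (rule chi_eq_diagonal_sum[OF dual part_length_eq_0[OF assms(1,4)] part_length_eq_0[OF assms(2,5)] assms(6)
        is_partition_weakly_decr[OF assms(1)] is_partition_weakly_decr[OF assms(2)]])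
  ultimately have chi: "fps_to_fls (chi n m mu nu lam) = qpow D * Z"
    by (rule lf_sum_unique[rotated])
  have "lf_sum (\<lambda>A. stacked_det (n - r) r u (\<lambda>t. f' (A ! t)) * stacked_det (m - r) r v (\<lambda>t. g' (A ! t)))
      (decreasing_tuples r) Z"
    unfolding Z_def by (rule lf_sum_stacked_det[OF H(2)])
  then have "lf_sum (\<lambda>A. sg * (stacked_det (n - r) r u (\<lambda>t. f' (A ! t)) * stacked_det (m - r) r v (\<lambda>t. g' (A ! t))))
      (decreasing_tuples r) (sg * Z)"
    by (rule lf_sum_cmult)
  moreover have "sg * (stacked_det (n - r) r u (\<lambda>t. f' (A ! t)) * stacked_det (m - r) r v (\<lambda>t. g' (A ! t))) =
      pit_term n m mu nu lam A" if "A \<in> decreasing_tuples r" for A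
    unfolding pit_term_stacked[OF decreasing_tuplesD(1)[OF that] r_def]
      sg_def u_def[abs_def] v_def[abs_def] f'_def[abs_def] g'_def[abs_def] lam'_def ..
  ultimately have "lf_sum (pit_term n m mu nu lam) (decreasing_tuples r) (sg * Z)"
    by (rule lf_sum_cong[THEN iffD1, rotated -1]) auto
  then have sum: "(pit_term n m mu nu lam has_sum (sg * Z)) (decreasing_tuples r)"
    by (rule lf_sum_has_sum)
  \<comment> \<open>The sign occurs both inside \<open>pit_term\<close> and in front of the sum, so
    it cancels.\<close>
  have "sg * sg = 1"
    by (simp add: sg_def flip: power_mult_distrib)
  moreover have "sg * qpow D * (sg * Z) = (sg * sg) * (qpow D * Z)"
    by (simp only: mult_ac)
  ultimately have "fps_to_fls (chi n m mu nu lam) = sg * qpow D * infsum (pit_term n m mu nu lam) (decreasing_tuples r)"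
    using infsumI[OF sum] chi by simp
  then show ?thesis
    using sum unfolding sg_def D_def qpow_def r_def summable_on_def by blast
qed

end
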